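(* The extendable indecomposable $\mathrm{u}_q^+$-modules are, up to isomorphism, exactly the following: 1. The modules $M_i^{\overline{-2i}}$ for $0\le i\le d-1$. Each of these extends to a $\mathrm{u}_q$-module in a unique way, and the $\mathrm{u}_q$-modules so obtained are all the simple $\mathrm{u}_q$-modules (up to isomorphism). 2. The projective indecomposable modules $P_i$ for $0\le i\le d-1$. Each of these extends in two non-isomorphic ways to a $\mathrm{u}_q$-module, except $P_{\frac{d+1}{2}}$ when $d$ is odd.
   Context: Let $q\in\mathbb{C}$ be a primitive $n$-th root of unity with $n\ge 3$, $n\ne 4$, and set $d=n$ if $n$ is odd, $d=n/2$ if $n$ is even. The algebra $\mathrm{u}_q=\mathrm{u}_q(\mathfrak{sl}_2(\mathbb{C}))$ is the $\mathbb{C}$-algebra generated by $E,F,K$ with relations $E^d=F^d=0$, $K^d=1$, $KE=q^2EK$, $KF=q^{-2}FK$, $EF-FE=\frac{K-K^{-1}}{q-q^{-1}}$. It is a Hopf algebra with $\Delta(E)=1\otimes E+E\otimes K$, $\Delta(F)=K^{-1}\otimes F+F\otimes 1$, $\Delta(K)=K\otimes K$, and $\mathrm{u}_q^+$ is its sub-Hopf algebra generated by $E$ and $K$ (with basis $\{E^iK^j\}_{0\le i,j\le d-1}$). For $i\in\mathbb{Z}/d\mathbb{Z}$ and $0\le u\le d-1$, $M_i^u$ is the $\mathrm{u}_q^+$-module with $\mathbb{C}$-basis $e_i^0,\dots,e_i^u$ and action $Ke_i^j=q^{2(i+j)}e_i^j$, $Ee_i^j=e_i^{j+1}$ for $0\le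 j\le u-1$, $Ee_i^u=0$. These form a complete list of pairwise non-isomorphic indecomposable $\mathrm{u}_q^+$-modules. Write $P_i=M_i^{d-1}$. For an integer $a$ (or a class modulo $d$), $\overline{a}$ denotes the representative of $a$ modulo $d$ in $\{0,\dots,d-1\}$. A $\mathrm{u}_q^+$-module is called extendable if there is a $\mathrm{u}_q$-module structure on it whose restriction to $\mathrm{u}_q^+$ is the given $\mathrm{u}_q^+$-action; such a structure is called an extension of it, and two extensions are called non-isomorphic if they are non-isomorphic as $\mathrm{u}_q$-modules.
   Formalization: "Extends in two non-isomorphic ways" is proved as "at least two" (and not for the exceptional P_{(d+1)/2}); "exactly two" is false, since F e^0 = c e^{d-1} with any complex c gives pairwise non-isomorphic extensions of every other P_i. *)

theory Defs
  imports
    Complex_Main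
    "HOL-Library.Poly_Mapping"
    "HOL-Algebra.QuotRing"
    "HOL-Algebra.Generated_Rings"
    "HOL-Algebra.Module"
begin

section \<open>Left modules over a not necessarily commutative ring\<close>

text \<open>The locale \<open>module\<close> of HOL-Algebra asks for a commutative ring of scalars. Here the same
  axioms are imposed over an arbitrary ring, on the same record type.

  A module over a \<open>\<complex>\<close>-algebra is a module over the underlying ring; its vector space structure is
  the one given by the scalars in the algebra.\<close>

locale left_module = R?: ring R + M?: abelian_group M
  for R :: "('a, 'r) ring_scheme" (structure) and M :: "('a, 'b, 'c) module_scheme" (structure) +
  assumes smult_closed:
      "\<lbrakk>a \<in> carrier R; x \<in> carrier M\<rbrakk> \<Longrightarrow> a \<odot>\<^bsub>M\<^esub> x \<in> carrier M"
    and smult_l_distr: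
      "\<lbrakk>a \<in> carrier R; b \<in> carrier R; x \<in> carrier M\<rbrakk> \<Longrightarrow>
        (a \<oplus>\<^bsub>R\<^esub> b) \<odot>\<^bsub>M\<^esub> x = a \<odot>\<^bsub>M\<^esub> x \<oplus>\<^bsub>M\<^esub> b \<odot>\<^bsub>M\<^esub> x"
    and smult_r_distr:
      "\<lbrakk>a \<in> carrier R; x \<in> carrier M; y \<in> carrier M\<rbrakk> \<Longrightarrow>
        a \<odot>\<^bsub>M\<^esub> (x \<oplus>\<^bsub>M\<^esub> y) = a \<odot>\<^bsub>M\<^esub> x \<oplus>\<^bsub>M\<^esub> a \<odot>\<^bsub>M\<^esub> y"
    and smult_assoc1:
      "\<lbrakk>a \<in> carrier R; b \<in> carrier R; x \<in> carrier M\<rbrakk> \<Longrightarrow>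
        (a \<otimes>\<^bsub>R\<^esub> b) \<odot>\<^bsub>M\<^esub> x = a \<odot>\<^bsub>M\<^esub> (b \<odot>\<^bsub>M\<^esub> x)"
    and smult_one:
      "x \<in> carrier M \<Longrightarrow> \<one>\<^bsub>R\<^esub> \<odot>\<^bsub>M\<^esub> x = x"

definition module_hom ::
    "('a, 'r) ring_scheme \<Rightarrow> ('a, 'b) module \<Rightarrow> ('a, 'c) module \<Rightarrow> ('b \<Rightarrow> 'c) set" where
  "module_hom R M N = {f \<in> carrier M \<rightarrow> carrier N.
     (\<forall>x\<in>carrier M. \<forall>y\<in>carrier M. f (x \<oplus>\<^bsub>M\<^esub> y) = f x \<oplus>\<^bsub>N\<^esub> f y) \<and>
     (\<forall>a\<in>carrier R. \<forall>x\<in>carrier M. f (a \<odot>\<^bsub>M\<^esub> x) = a \<odot>\<^bsub>N\<^esub> f x)}"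

definition module_isomorphic ::
    "('a, 'r) ring_scheme \<Rightarrow> ('a, 'b) module \<Rightarrow> ('a, 'c) module \<Rightarrow> bool" where
  "module_isomorphic R M N \<longleftrightarrow>
     (\<exists>f \<in> module_hom R M N. bij_betw f (carrier M) (carrier N))"

definition simple_module :: "('a, 'r) ring_scheme \<Rightarrow> ('a, 'b) module \<Rightarrow> bool" where
  "simple_module R M \<longleftrightarrow> left_module R M \<and> carrier M \<noteq> {\<zero>\<^bsub>M\<^esub>} \<and>
     (\<forall>H. submodule H R M \<longrightarrow> H = {\<zero>\<^bsub>M\<^esub>} \<or> H = carrier M)"

definition indecomposable_module :: "('a, 'r) ring_scheme \<Rightarrow> ('a, 'b) module \<Rightarrow> bool" where
  "indecomposable_module R M \<longleftrightarrow> left_module R M \<and> carrier M \<noteq> {\<zero>\<^bsub>M\<^esub>} \<and>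
     (\<forall>H1 H2. submodule H1 R M \<and> submodule H2 R M \<and>
        H1 <+>\<^bsub>M\<^esub> H2 = carrier M \<and> H1 \<inter> H2 = {\<zero>\<^bsub>M\<^esub>} \<longrightarrow>
        H1 = {\<zero>\<^bsub>M\<^esub>} \<or> H2 = {\<zero>\<^bsub>M\<^esub>})"

text \<open>The type arguments say where the test modules \<open>N\<close> and \<open>L\<close> of the lifting property live; a
  theorem in which they are type variables asserts lifting against all test modules.\<close>

definition projective_module ::
    "'c itself \<Rightarrow> 'e itself \<Rightarrow> ('a, 'r) ring_scheme \<Rightarrow> ('a, 'b) module \<Rightarrow> bool" where
  "projective_module _ _ R P \<longleftrightarrow> left_module R P \<and>
     (\<forall>(N :: ('a, 'c) module) (L :: ('a, 'e) module) g f.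
        left_module R N \<and> left_module R L \<and>
        g \<in> module_hom R N L \<and> g ` carrier N = carrier L \<and> f \<in> module_hom R P L \<longrightarrow>
        (\<exists>h \<in> module_hom R P N. \<forall>x\<in>carrier P. g (h x) = f x))"


section \<open>The free algebra on three generators\<close>

datatype gen = Gen_E | Gen_F | Gen_K

text \<open>With concatenation as addition of lists, the convolution product that \<open>Poly_Mapping\<close> puts on
  \<open>gen list \<Rightarrow>\<^sub>0 complex\<close> makes it the free associative unital \<open>\<complex>\<close>-algebra on \<open>gen\<close>.\<close>

instantiation list :: (type) monoid_add
begin

definition zero_list :: "'a list" where "zero_list = []"

definition plus_list :: "'a list \<Rightarrow> 'a list \<Rightarrow> 'a list" where "plus_list xs ys = xs @ ys"

instance
  by standard (simp_all add: zero_list_def plus_list_def)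

end

type_synonym free_alg = "gen list \<Rightarrow>\<^sub>0 complex"

definition gen_var :: "gen \<Rightarrow> free_alg" where
  "gen_var g = Poly_Mapping.single [g] 1"

definition scalar :: "complex \<Rightarrow> free_alg" where
  "scalar c = Poly_Mapping.single [] c"

definition free_ring :: "free_alg ring" where
  "free_ring = \<lparr>carrier = UNIV, monoid.mult = (*), one = 1, zero = 0, add = (+)\<rparr>"


section \<open>The small quantum group and its Borel part\<close>

text \<open>Given \<open>K\<^sup>d = 1\<close>, the inverse of \<open>K\<close> is \<open>K ^ (d - 1)\<close>.\<close>

definition uq_relations :: "complex \<Rightarrow> nat \<Rightarrow> free_alg set" where
  "uq_relations q d =
     (let E = gen_var Gen_E; F = gen_var Gen_F; K = gen_var Gen_K in
      {E ^ d, F ^ d, K ^ d - 1,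
       K * E - scalar (q ^ 2) * E * K,
       K * F - scalar (inverse (q ^ 2)) * F * K,
       E * F - F * E - scalar (1 / (q - inverse q)) * (K - K ^ (d - 1))})"

type_synonym uq_elem = "free_alg set"

definition uq_ideal :: "complex \<Rightarrow> nat \<Rightarrow> free_alg set" where
  "uq_ideal q d = Idl\<^bsub>free_ring\<^esub> (uq_relations q d)"

definition uq :: "complex \<Rightarrow> nat \<Rightarrow> uq_elem ring" where
  "uq q d = free_ring Quot (uq_ideal q d)"

definition uq_class :: "complex \<Rightarrow> nat \<Rightarrow> free_alg \<Rightarrow> uq_elem" where
  "uq_class q d x = uq_ideal q d +>\<^bsub>free_ring\<^esub> x"

abbreviation uq_E :: "complex \<Rightarrow> nat \<Rightarrow> uq_elem" where
  "uq_E q d \<equiv> uq_class q d (gen_var Gen_E)"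

abbreviation uq_K :: "complex \<Rightarrow> nat \<Rightarrow> uq_elem" where
  "uq_K q d \<equiv> uq_class q d (gen_var Gen_K)"

abbreviation uq_scalar :: "complex \<Rightarrow> nat \<Rightarrow> complex \<Rightarrow> uq_elem" where
  "uq_scalar q d c \<equiv> uq_class q d (scalar c)"

text \<open>The \<open>\<complex>\<close>-subalgebra generated by \<open>E\<close> and \<open>K\<close>. It is already a sub-Hopf algebra, since
  comultiplication, counit and antipode map \<open>E\<close> and \<open>K\<close> to polynomials in \<open>E\<close>, \<open>K\<close> and
  \<open>K\<^sup>-\<^sup>1\<close>.\<close>

definition uq_plus :: "complex \<Rightarrow> nat \<Rightarrow> uq_elem ring" where
  "uq_plus q d = (uq q d)\<lparr>carrier :=
     generate_ring (uq q d) (range (uq_scalar q d) \<union> {uq_E q d, uq_K q d})\<rparr>"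


section \<open>The indecomposable modules of the Borel part, and extensions\<close>

text \<open>\<open>is_M q d i u M\<close>: the module \<open>M\<close> over the Borel part is a copy of \<open>M\<^sub>i\<^sup>u\<close>, that is, it has a
  \<open>\<complex>\<close>-basis \<open>e 0, \<dots>, e u\<close> on which \<open>K\<close> and \<open>E\<close> act as prescribed. As \<open>E\<close> and \<open>K\<close> generate the
  algebra, this fixes \<open>M\<close> up to isomorphism, and the predicate is invariant under isomorphism.\<close>

definition is_M :: "complex \<Rightarrow> nat \<Rightarrow> nat \<Rightarrow> nat \<Rightarrow> (uq_elem, 'v) module \<Rightarrow> bool" where
  "is_M q d i u M \<longleftrightarrow> left_module (uq_plus q d) M \<and>
     (\<exists>e :: nat \<Rightarrow> 'v.
        (\<forall>j\<le>u. e j \<in> carrier M) \<and>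
        (\<forall>x\<in>carrier M. \<exists>!c :: nat \<Rightarrow> complex. (\<forall>j>u. c j = 0) \<and>
            x = (\<Oplus>\<^bsub>M\<^esub> j\<in>{..u}. uq_scalar q d (c j) \<odot>\<^bsub>M\<^esub> e j)) \<and>
        (\<forall>j\<le>u. uq_K q d \<odot>\<^bsub>M\<^esub> e j = uq_scalar q d (q ^ (2 * (i + j))) \<odot>\<^bsub>M\<^esub> e j) \<and>
        (\<forall>j<u. uq_E q d \<odot>\<^bsub>M\<^esub> e j = e (j + 1)) \<and>
        uq_E q d \<odot>\<^bsub>M\<^esub> e u = \<zero>\<^bsub>M\<^esub>)"

abbreviation is_P :: "complex \<Rightarrow> nat \<Rightarrow> nat \<Rightarrow> (uq_elem, 'v) module \<Rightarrow> bool" where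
  "is_P q d i M \<equiv> is_M q d i (d - 1) M"

definition residue_rep :: "nat \<Rightarrow> int \<Rightarrow> nat" where
  "residue_rep d a = nat (a mod int d)"

text \<open>An extension keeps the underlying abelian group and only replaces the scalar
  multiplication. Two extensions are the same if their scalar multiplications agree on the
  carriers; outside they are unconstrained.\<close>

definition is_extension ::
    "complex \<Rightarrow> nat \<Rightarrow> (uq_elem, 'v) module \<Rightarrow> (uq_elem \<Rightarrow> 'v \<Rightarrow> 'v) \<Rightarrow> bool" where
  "is_extension q d M s \<longleftrightarrow> left_module (uq q d) (M\<lparr>smult := s\<rparr>) \<and>
     (\<forall>a\<in>carrier (uq_plus q d). \<forall>x\<in>carrier M. s a x = a \<odot>\<^bsub>M\<^esub> x)"

definition extendable :: "complex \<Rightarrow> nat \<Rightarrow> (uq_elem, 'v) module \<Rightarrow> bool" where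
  "extendable q d M \<longleftrightarrow> (\<exists>s. is_extension q d M s)"

definition extends_uniquely :: "complex \<Rightarrow> nat \<Rightarrow> (uq_elem, 'v) module \<Rightarrow> bool" where
  "extends_uniquely q d M \<longleftrightarrow> extendable q d M \<and>
     (\<forall>s t. is_extension q d M s \<and> is_extension q d M t \<longrightarrow>
        (\<forall>a\<in>carrier (uq q d). \<forall>x\<in>carrier M. s a x = t a x))"

definition extends_in_two_ways :: "complex \<Rightarrow> nat \<Rightarrow> (uq_elem, 'v) module \<Rightarrow> bool" where
  "extends_in_two_ways q d M \<longleftrightarrow>
     (\<exists>s t. is_extension q d M s \<and> is_extension q d M t \<and>
        \<not> module_isomorphic (uq q d) (M\<lparr>smult := s\<rparr>) (M\<lparr>smult := t\<rparr>))"

definition primitive_root_of_unity :: "nat \<Rightarrow> complex \<Rightarrow> bool" where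
  "primitive_root_of_unity n q \<longleftrightarrow> n > 0 \<and> q ^ n = 1 \<and> (\<forall>k. 0 < k \<and> k < n \<longrightarrow> q ^ k \<noteq> 1)"

end

theory Submission
  imports Defs
begin

text \<open>
  Put \<open>\<omega> = q\<^sup>2\<close>, a root of unity of exact order \<open>d\<close>. Since \<open>K\<^sup>d = 1\<close>, the operator \<open>K\<close> is
  diagonalisable on every module, with powers of \<open>\<omega>\<close> as eigenvalues (\<open>weight_span\<close>). The operator
  \<open>E\<close> multiplies weights by \<open>\<omega>\<close>, and \<open>F\<close> divides them by \<open>\<omega>\<close>. The basis \<open>e 0, \<dots>, e u\<close> of
  \<open>M\<^sub>i\<^sup>u\<close> is a string of weight vectors whose weights are pairwise distinct because \<open>u < d\<close>.

  \<^emph>\<open>Indecomposable modules.\<close> Let \<open>E\<^sup>u \<noteq> 0 = E\<^sup>u\<^sup>+\<^sup>1\<close> on a module of arbitrary dimension. Some weight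
  vector \<open>x\<close> has \<open>E\<^sup>u x \<noteq> 0\<close>, and it generates a string. A linear functional \<open>\<phi>\<close> which takes the
  value \<open>1\<close> at \<open>E\<^sup>u x\<close> and vanishes on all other weights exists by Zorn's lemma, and the vectors
  \<open>y\<close> with \<open>\<phi> (E\<^sup>j y) = 0\<close> for all \<open>j\<close> form a complement of the string (\<open>complement\<close>). So an
  indecomposable module is a string. Conversely, strings are indecomposable, because every nonzero
  submodule contains the top vector \<open>e u\<close> (\<open>socle\<close>).

  \<^emph>\<open>Extensions of a string.\<close> Weights force \<open>F (e (j + 1))\<close> to be a multiple of \<open>e j\<close>, and
  \<open>F (e 0) = \<kappa> e u\<close>, where \<open>\<kappa>\<close> can only be nonzero if the weights close up to a full cycle, that is,
  if \<open>u = d - 1\<close>. The commutator relation, read from the bottom of the string upwards, determines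
  the other coefficients: \<open>F (e j) = f j * e (j - 1)\<close>, where \<open>f j\<close> is a nonzero multiple of
  \<open>(\<omega>\<^sup>j - 1) * (\<omega>\<^sup>2\<^sup>i\<^sup>+\<^sup>j\<^sup>-\<^sup>1 - 1)\<close>. At the top it says \<open>f (u + 1) = 0\<close>, which means \<open>u = d - 1\<close> or
  \<open>u \<equiv> - 2 i\<close> modulo \<open>d\<close>. Finally \<open>F\<^sup>d\<close> multiplies each basis vector of a full cycle by the product
  of all coefficients around the cycle, so \<open>F\<^sup>d = 0\<close> means that \<open>\<kappa>\<close> or some \<open>f j\<close> with
  \<open>0 < j < d\<close> vanishes. These conditions are necessary (\<open>F_structure\<close>) and sufficient (\<open>std_action\<close>,
  \<open>extensionI\<close>).

  If \<open>u \<equiv> - 2 i\<close>, then no \<open>f j\<close> with \<open>0 < j \<le> u\<close> vanishes. Hence the extension is unique, even if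
  \<open>u = d - 1\<close>, and it is simple, since \<open>F\<close> leads from \<open>e u\<close> back to all other basis vectors. If
  \<open>u = d - 1\<close> is not congruent to \<open>- 2 i\<close>, then some \<open>f j\<close> vanishes and \<open>\<kappa>\<close> is arbitrary; the
  extensions with \<open>\<kappa> = 0\<close> and \<open>\<kappa> = 1\<close> differ in whether \<open>F\<close> kills the line of weight \<open>\<omega>\<^sup>i\<close>. The two
  families of modules overlap exactly when \<open>2 i \<equiv> 1\<close> modulo \<open>d\<close>.

  \<^emph>\<open>Simple modules.\<close> A simple module contains a weight vector killed by \<open>F\<close>. The string which it
  generates under \<open>E\<close> is stable under \<open>F\<close>, so it is the whole module, and we are in the previous
  situation with \<open>\<kappa> = 0\<close>. In the case \<open>u = d - 1\<close> a vanishing \<open>f m\<close> would make the part of the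
  string from \<open>e m\<close> upwards a proper submodule (\<open>simple_uq_string\<close>).

  \<^emph>\<open>Projectivity.\<close> As \<open>E\<^sup>d = 0\<close> holds in every module, the generator \<open>e 0\<close> of \<open>P\<^sub>i\<close> is subject to the
  single condition of having weight \<open>\<omega>\<^sup>i\<close>. Weight vectors lift along surjections, since the
  projection onto a weight space is a polynomial in \<open>K\<close> (\<open>projective\<close>).
\<close>

section \<open>The free algebra, its quotient and the Borel part\<close>

lemma scalar_simps:
  "scalar 0 = 0" "scalar 1 = 1"
  "scalar (a + b) = scalar a + scalar b"
  "scalar a * scalar b = scalar (a * b)"
  by (simp_all add: scalar_def mult_single single_add flip: zero_list_def)


lemma free_alg_single_induct [case_names single add]:
  fixes x :: free_alg
  assumes single: "\<And>w c. P (Poly_Mapping.single w c)"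
    and add: "\<And>x y. P x \<Longrightarrow> P y \<Longrightarrow> P (x + y)"
  shows "P x"
proof (induction x rule: update_induct)
  case const
  then show ?case using single[of "[]" 0] by simp
next
  case (update f w c)
  then have "Poly_Mapping.update w c f = Poly_Mapping.single w c + f"
    by (intro poly_mapping_eqI)
      (auto simp: lookup_add lookup_single lookup_update when_def in_keys_iff)
  then show ?case using add[OF single update.IH] by simp
qed

lemma free_alg_induct [case_names scalar gen add mult]:
  fixes x :: free_alg
  assumes scalar: "\<And>c. P (scalar c)"
    and gen: "\<And>g. P (gen_var g)"
    and add: "\<And>x y. P x \<Longrightarrow> P y \<Longrightarrow> P (x + y)"
    and mult: "\<And>x y. P x \<Longrightarrow> P y \<Longrightarrow> P (x * y)"
  shows "P x"
proof -
  have word: "P (Poly_Mapping.single w 1)" for w :: "gen list"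
  proof (induction w)
    case Nil
    then show ?case using scalar[of 1] by (simp add: scalar_def)
  next
    case (Cons g w)
    have "Poly_Mapping.single (g # w) 1 = gen_var g * Poly_Mapping.single w (1 :: complex)"
      by (simp add: gen_var_def mult_single plus_list_def)
    then show ?case using mult[OF gen Cons.IH] by simp
  qed
  have monomial: "P (Poly_Mapping.single w c)" for w c
  proof -
    have "Poly_Mapping.single w c = scalar c * Poly_Mapping.single w 1"
      by (simp add: scalar_def mult_single plus_list_def)
    then show ?thesis using mult[OF scalar word] by simp
  qed
  show ?thesis
    by (induction x rule: free_alg_single_induct) (auto intro: monomial add)
qed

lemma scalar_commute: "scalar a * x = x * scalar a"
proof (induction x rule: free_alg_induct)
  case (scalar c)
  then show ?case by (simp add: scalar_simps mult.commute)
next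
  case (gen g)
  then show ?case by (simp add: scalar_def gen_var_def mult_single plus_list_def)
next
  case (add x y)
  then show ?case by (simp add: distrib_left distrib_right)
next
  case (mult x y)
  then show ?case by (metis mult.assoc)
qed

lemma free_ring_sel [simp]:
  "carrier free_ring = UNIV" "x \<otimes>\<^bsub>free_ring\<^esub> y = x * y" "\<one>\<^bsub>free_ring\<^esub> = 1"
  "\<zero>\<^bsub>free_ring\<^esub> = 0" "x \<oplus>\<^bsub>free_ring\<^esub> y = x + y"
  by (simp_all add: free_ring_def)

lemma ring_free_ring: "ring free_ring"
proof (rule ringI)
  show "abelian_group free_ring"
    by (rule abelian_groupI) (auto simp: algebra_simps intro: exI[of _ "- _"] add.left_inverse)
  show "Group.monoid free_ring"
    by (rule monoidI) (auto simp: algebra_simps)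
qed (auto simp: algebra_simps)

lemma ideal_uq_ideal: "ideal (uq_ideal q d) free_ring"
  unfolding uq_ideal_def by (rule ring.genideal_ideal[OF ring_free_ring]) simp

lemma ring_uq: "ring (uq q d)"
  unfolding uq_def by (rule ideal.quotient_is_ring[OF ideal_uq_ideal])

lemma carrier_uq: "carrier (uq q d) = range (uq_class q d)"
  by (auto simp: uq_def uq_class_def FactRing_def A_RCOSETS_def RCOSETS_def a_r_coset_def)

lemma uq_class_simps:
  "uq_class q d x \<oplus>\<^bsub>uq q d\<^esub> uq_class q d y = uq_class q d (x + y)"
  "uq_class q d x \<otimes>\<^bsub>uq q d\<^esub> uq_class q d y = uq_class q d (x * y)"
  "\<one>\<^bsub>uq q d\<^esub> = uq_class q d 1"
  "\<zero>\<^bsub>uq q d\<^esub> = uq_class q d 0"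
proof -
  note hom = ideal.rcos_ring_hom_ring[OF ideal_uq_ideal[of q d], folded uq_def]
  interpret ring_hom_ring free_ring "uq q d" "(+>\<^bsub>free_ring\<^esub>) (uq_ideal q d)" by (rule hom)
  show "uq_class q d x \<oplus>\<^bsub>uq q d\<^esub> uq_class q d y = uq_class q d (x + y)"
    "uq_class q d x \<otimes>\<^bsub>uq q d\<^esub> uq_class q d y = uq_class q d (x * y)"
    "\<one>\<^bsub>uq q d\<^esub> = uq_class q d 1"
    "\<zero>\<^bsub>uq q d\<^esub> = uq_class q d 0"
    unfolding uq_class_def using hom_add[of x y] hom_mult[of x y] hom_one hom_zero by simp_all
qed

lemma uq_class_eqI:
  assumes "x - y \<in> uq_ideal q d"
  shows "uq_class q d x = uq_class q d y"
proof -
  interpret ideal "uq_ideal q d" free_ring by (rule ideal_uq_ideal)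
  have "x \<in> uq_ideal q d +>\<^bsub>free_ring\<^esub> y"
    using assms by (force simp: a_r_coset_def r_coset_def)
  then show ?thesis unfolding uq_class_def by (intro a_repr_independence'[symmetric]) simp_all
qed

lemma uq_class_eqD:
  assumes "uq_class q d x = uq_class q d y"
  shows "x - y \<in> uq_ideal q d"
proof -
  interpret ideal "uq_ideal q d" free_ring by (rule ideal_uq_ideal)
  have "x \<in> uq_ideal q d +>\<^bsub>free_ring\<^esub> y"
    using assms a_rcos_self[of x] by (simp add: uq_class_def)
  then show ?thesis by (auto simp: a_r_coset_def r_coset_def)
qed

lemma uq_class_relation:
  assumes "x - y \<in> uq_relations q d"
  shows "uq_class q d x = uq_class q d y"
  by (rule uq_class_eqI)
    (use assms ring.genideal_self[OF ring_free_ring, of "uq_relations q d"] in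
      \<open>auto simp: uq_ideal_def\<close>)

lemma uq_class_relations:
  defines "E \<equiv> gen_var Gen_E" and "F \<equiv> gen_var Gen_F" and "K \<equiv> gen_var Gen_K"
  shows "uq_class q d (E ^ d) = uq_class q d 0"
    "uq_class q d (F ^ d) = uq_class q d 0"
    "uq_class q d (K ^ d) = uq_class q d 1"
    "uq_class q d (K * E) = uq_class q d (scalar (q\<^sup>2) * E * K)"
    "uq_class q d (K * F) = uq_class q d (scalar (inverse (q\<^sup>2)) * F * K)"
    "uq_class q d (E * F) =
      uq_class q d (F * E + scalar (1 / (q - inverse q)) * (K - K ^ (d - 1)))"
  by (rule uq_class_relation, simp add: uq_relations_def Let_def E_def F_def K_def algebra_simps)+

lemma uq_minus: "\<ominus>\<^bsub>uq q d\<^esub> uq_class q d x = uq_class q d (- x)"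
proof -
  interpret ring "uq q d" by (rule ring_uq)
  show ?thesis
    by (rule minus_equality) (auto simp: uq_class_simps carrier_uq)
qed

abbreviation uq_F :: "complex \<Rightarrow> nat \<Rightarrow> uq_elem" where
  "uq_F q d \<equiv> uq_class q d (gen_var Gen_F)"

text \<open>The elements of the free algebra that represent elements of the Borel part. Computing with
  representatives gives access to the type class arithmetic of the free algebra, which the coset
  ring does not have.\<close>

definition borel_alg :: "complex \<Rightarrow> nat \<Rightarrow> free_alg set" where
  "borel_alg q d = {x. uq_class q d x \<in> carrier (uq_plus q d)}"

lemma uq_plus_sel [simp]:
  "x \<otimes>\<^bsub>uq_plus q d\<^esub> y = x \<otimes>\<^bsub>uq q d\<^esub> y" "\<one>\<^bsub>uq_plus q d\<^esub> = \<one>\<^bsub>uq q d\<^esub>"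
  "\<zero>\<^bsub>uq_plus q d\<^esub> = \<zero>\<^bsub>uq q d\<^esub>" "x \<oplus>\<^bsub>uq_plus q d\<^esub> y = x \<oplus>\<^bsub>uq q d\<^esub> y"
  by (simp_all add: uq_plus_def)

lemma ring_uq_plus: "ring (uq_plus q d)"
  unfolding uq_plus_def by (rule ring.generate_ring_is_ring[OF ring_uq]) (auto simp: carrier_uq)

lemma uq_plus_subset: "carrier (uq_plus q d) \<subseteq> carrier (uq q d)"
proof -
  have "range (uq_scalar q d) \<union> {uq_E q d, uq_K q d} \<subseteq> carrier (uq q d)"
    by (auto simp: carrier_uq)
  then show ?thesis
    using ring.generate_ring_incl[OF ring_uq] by (simp add: uq_plus_def)
qed

lemma carrier_uq_plus: "carrier (uq_plus q d) = uq_class q d ` borel_alg q d"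
  using uq_plus_subset[of q d] by (auto simp: borel_alg_def carrier_uq)

lemma borel_alg_gens [simp]:
  "scalar c \<in> borel_alg q d" "gen_var Gen_E \<in> borel_alg q d" "gen_var Gen_K \<in> borel_alg q d"
  by (simp_all add: borel_alg_def uq_plus_def generate_ring.incl)

lemma borel_alg_closed:
  "0 \<in> borel_alg q d" "1 \<in> borel_alg q d"
  "x \<in> borel_alg q d \<Longrightarrow> y \<in> borel_alg q d \<Longrightarrow> x + y \<in> borel_alg q d"
  "x \<in> borel_alg q d \<Longrightarrow> y \<in> borel_alg q d \<Longrightarrow> x * y \<in> borel_alg q d"
proof -
  interpret ring "uq_plus q d" by (rule ring_uq_plus)
  show "0 \<in> borel_alg q d" "1 \<in> borel_alg q d"
    using zero_closed one_closed by (simp_all add: borel_alg_def uq_class_simps)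
  show "x \<in> borel_alg q d \<Longrightarrow> y \<in> borel_alg q d \<Longrightarrow> x + y \<in> borel_alg q d"
    "x \<in> borel_alg q d \<Longrightarrow> y \<in> borel_alg q d \<Longrightarrow> x * y \<in> borel_alg q d"
    using a_closed m_closed by (force simp: borel_alg_def uq_class_simps)+
qed

lemma borel_alg_power: "x \<in> borel_alg q d \<Longrightarrow> x ^ k \<in> borel_alg q d"
  by (induction k) (auto intro: borel_alg_closed)

lemma borel_alg_sum: "(\<And>k. k \<in> A \<Longrightarrow> f k \<in> borel_alg q d) \<Longrightarrow> sum f A \<in> borel_alg q d"
  by (induction A rule: infinite_finite_induct) (auto intro: borel_alg_closed)

text \<open>The property is one of classes and not of representatives, because the Borel part is generated
  as a subring of the quotient.\<close>

lemma borel_alg_induct [consumes 1, case_names scalar E K add mult]: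
  assumes "x \<in> borel_alg q d"
    and scalar: "\<And>c. P (uq_scalar q d c)"
    and E: "P (uq_E q d)"
    and K: "P (uq_K q d)"
    and add: "\<And>x y. x \<in> borel_alg q d \<Longrightarrow> y \<in> borel_alg q d \<Longrightarrow>
      P (uq_class q d x) \<Longrightarrow> P (uq_class q d y) \<Longrightarrow> P (uq_class q d (x + y))"
    and mult: "\<And>x y. x \<in> borel_alg q d \<Longrightarrow> y \<in> borel_alg q d \<Longrightarrow>
      P (uq_class q d x) \<Longrightarrow> P (uq_class q d y) \<Longrightarrow> P (uq_class q d (x * y))"
  shows "P (uq_class q d x)"
proof -
  have "uq_class q d x \<in> generate_ring (uq q d) (range (uq_scalar q d) \<union> {uq_E q d, uq_K q d})"
    using assms(1) by (simp add: borel_alg_def uq_plus_def)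
  then have "\<exists>y\<in>borel_alg q d. uq_class q d x = uq_class q d y \<and> P (uq_class q d y)"
  proof induction
    case one
    then show ?case using scalar[of 1] borel_alg_closed(2) by (auto simp: uq_class_simps scalar_simps)
  next
    case (incl h)
    then show ?case using scalar E K borel_alg_gens by auto
  next
    case (a_inv h)
    then obtain y where y: "y \<in> borel_alg q d" "h = uq_class q d y" "P (uq_class q d y)" by auto
    have "scalar (- 1) + 1 = 0"
      using scalar_simps(1,2) scalar_simps(3)[of "- 1" 1] by simp
    then have "scalar (- 1) * y + y = 0"
      by (metis distrib_right mult_1 mult_zero_left)
    then have "- y = scalar (- 1) * y"
      by (simp add: add_eq_0_iff2)
    then show ?case
      using y mult[OF borel_alg_gens(1)[of "-1"] y(1) scalar y(3)]
        borel_alg_closed(4)[OF borel_alg_gens(1)[of "-1"] y(1)]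
      by (auto simp: uq_minus)
  next
    case (eng_add h1 h2)
    then show ?case using add borel_alg_closed(3) by (metis uq_class_simps(1))
  next
    case (eng_mult h1 h2)
    then show ?case using mult borel_alg_closed(4) by (metis uq_class_simps(2))
  qed
  then show ?thesis by auto
qed

section \<open>Roots of unity\<close>

locale small_quantum =
  fixes n d :: nat and q :: complex
  assumes n_ge: "n \<ge> 3" and n_neq: "n \<noteq> 4"
    and prim: "primitive_root_of_unity n q"
    and d_def: "d = (if odd n then n else n div 2)"
begin

definition \<omega> :: complex where "\<omega> = q\<^sup>2"

lemma q_pow_eq_1_iff: "q ^ k = 1 \<longleftrightarrow> n dvd k"
proof -
  have q: "q ^ n = 1" "\<And>j. 0 < j \<Longrightarrow> j < n \<Longrightarrow> q ^ j \<noteq> 1" and "n > 0"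
    using prim by (auto simp: primitive_root_of_unity_def)
  have "q ^ k = q ^ (k mod n)"
    by (metis div_mult_mod_eq mult.commute power_add power_mult power_one mult_1 q(1))
  then show ?thesis
    using q(2)[of "k mod n"] \<open>n > 0\<close> by (auto simp: dvd_eq_mod_eq_0)
qed

lemma d_ge: "d \<ge> 3"
  using n_ge n_neq by (cases "odd n") (auto simp: d_def elim!: evenE)

lemma d_pos: "0 < d" "Suc 0 < d" "d \<noteq> 0"
  using d_ge by auto

lemma omega_pow_eq_1_iff: "\<omega> ^ k = 1 \<longleftrightarrow> d dvd k"
proof -
  have "\<omega> ^ k = q ^ (2 * k)" by (simp add: \<omega>_def power_mult)
  moreover have "n dvd 2 * k \<longleftrightarrow> d dvd k"
  proof (cases "odd n")
    case True
    then have "coprime n 2" by simp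
    then show ?thesis using True by (simp add: d_def coprime_dvd_mult_right_iff)
  next
    case False
    then obtain m where "n = 2 * m" by (auto elim: evenE)
    then show ?thesis using False by (simp add: d_def)
  qed
  ultimately show ?thesis by (simp add: q_pow_eq_1_iff)
qed

lemma omega_pow_d [simp]: "\<omega> ^ d = 1"
  by (simp add: omega_pow_eq_1_iff)

lemma q_nonzero [simp]: "q \<noteq> 0"
  using q_pow_eq_1_iff[of n] n_ge by (auto simp: power_0_left)

lemma omega_nonzero [simp]: "\<omega> \<noteq> 0"
  by (simp add: \<omega>_def)

lemma omega_neq_1 [simp]: "\<omega> \<noteq> 1"
  using omega_pow_eq_1_iff[of 1] d_ge by auto

lemma omega_pow_mod: "\<omega> ^ (k mod d) = \<omega> ^ k"
  by (metis div_mult_mod_eq mult.commute power_add power_mult power_one mult_1 omega_pow_d)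

lemma omega_pow_eq_iff: "\<omega> ^ a = \<omega> ^ b \<longleftrightarrow> a mod d = b mod d"
proof
  have *: "a mod d = b mod d" if "\<omega> ^ a = \<omega> ^ b" "a \<le> b" for a b
  proof -
    have "\<omega> ^ b = \<omega> ^ a * \<omega> ^ (b - a)" using that(2) by (metis le_add_diff_inverse power_add)
    then have "\<omega> ^ (b - a) = 1" using that by simp
    then have "d dvd b - a" by (simp add: omega_pow_eq_1_iff)
    then show ?thesis using mod_eq_dvd_iff_nat[OF that(2), of d] by simp
  qed
  show "a mod d = b mod d" if "\<omega> ^ a = \<omega> ^ b"
    using *[OF that] *[OF that[symmetric]] by (metis nat_le_linear)
  show "\<omega> ^ a = \<omega> ^ b" if "a mod d = b mod d"
    using that omega_pow_mod[of a] omega_pow_mod[of b] by simp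
qed

lemma omega_pow_inj: "a < d \<Longrightarrow> b < d \<Longrightarrow> \<omega> ^ a = \<omega> ^ b \<longleftrightarrow> a = b"
  by (simp add: omega_pow_eq_iff)

lemma inverse_omega_pow: "\<omega> ^ (k * (d - 1)) = inverse (\<omega> ^ k)"
proof -
  have "k + k * (d - 1) = k * d"
    using d_pos(1) by (metis Suc_diff_1 mult_Suc_right)
  then have "\<omega> ^ k * \<omega> ^ (k * (d - 1)) = \<omega> ^ (k * d)"
    by (simp only: power_add[symmetric])
  also have "\<dots> = 1" by (simp add: omega_pow_eq_1_iff)
  finally show ?thesis by (rule inverse_unique[symmetric])
qed

lemma q_minus_inverse_nonzero: "q - inverse q \<noteq> 0"
proof
  assume "q - inverse q = 0"
  then have "q * q = q * inverse q" by simp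
  then have "q * q = 1" by simp
  then have "\<omega> = 1" by (simp add: \<omega>_def power2_eq_square)
  then show False by simp
qed

text \<open>The projection onto the eigenspace of \<open>K\<close> for \<open>\<omega>\<^sup>r\<close> along the other eigenspaces, written as a
  polynomial in \<open>K\<close> by discrete Fourier inversion.\<close>

definition weight_proj :: "nat \<Rightarrow> free_alg" where
  "weight_proj r = (\<Sum>k<d. scalar (inverse (\<omega> ^ r) ^ k / of_nat d) * gen_var Gen_K ^ k)"

lemma weight_proj_borel [simp]: "weight_proj r \<in> borel_alg q d"
  unfolding weight_proj_def
  by (intro borel_alg_sum borel_alg_closed(4) borel_alg_power borel_alg_gens)

lemma scalar_sum: "scalar (sum f A) = (\<Sum>k\<in>A. scalar (f k))"
  by (induction A rule: infinite_finite_induct) (auto simp: scalar_simps)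

text \<open>The orthogonality of characters gives this identity already in the free algebra.\<close>

lemma sum_weight_proj: "(\<Sum>r<d. weight_proj r) = 1"
proof -
  \<comment> \<open>for \<open>k \<noteq> 0\<close> a geometric series with ratio \<open>\<omega>\<^sup>-\<^sup>k \<noteq> 1\<close>\<close>
  have geo: "(\<Sum>r<d. inverse (\<omega> ^ r) ^ k / of_nat d) = (if k = 0 then 1 else 0)"
    if "k < d" for k
  proof (cases "k = 0")
    case False
    define z where "z = inverse \<omega> ^ k"
    have z1: "z \<noteq> 1"
      using False that omega_pow_eq_1_iff[of k] by (auto simp: z_def power_inverse dest: dvd_imp_le)
    have zd: "z ^ d = 1"
      by (simp add: z_def power_inverse flip: power_mult) (simp add: mult.commute power_mult)
    have "(\<Sum>r<d. inverse (\<omega> ^ r) ^ k) = (\<Sum>r<d. z ^ r)"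
      by (intro sum.cong) (simp_all add: z_def power_inverse mult.commute flip: power_mult)
    also have "\<dots> = 0" using geometric_sum[OF z1, of d] zd by simp
    finally show ?thesis using False by (simp flip: sum_divide_distrib)
  qed (use d_pos in simp)
  have "(\<Sum>r<d. weight_proj r) =
      (\<Sum>k<d. scalar (\<Sum>r<d. inverse (\<omega> ^ r) ^ k / of_nat d) * gen_var Gen_K ^ k)"
    unfolding weight_proj_def by (subst sum.swap) (simp add: scalar_sum sum_distrib_right)
  also have "\<dots> = (\<Sum>k<d. if k = 0 then 1 else 0)"
    by (intro sum.cong) (auto simp: geo scalar_simps)
  also have "\<dots> = 1" using d_pos by simp
  finally show ?thesis .
qed

text \<open>The scalar by which \<open>(K - K\<^sup>-\<^sup>1) / (q - q\<^sup>-\<^sup>1)\<close> acts on vectors of weight \<open>\<omega>\<^sup>r\<close>.\<close>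

definition bracket :: "nat \<Rightarrow> complex" where
  "bracket r = (\<omega> ^ r - inverse (\<omega> ^ r)) / (q - inverse q)"

end

section \<open>Modules over the Borel part\<close>

locale borel_module = small_quantum n d q + M?: abelian_group M
  for n d q and M :: "(uq_elem, 'v) module" (structure) +
  assumes left_module: "left_module (uq_plus q d) M"
begin

abbreviation act :: "free_alg \<Rightarrow> 'v \<Rightarrow> 'v" where
  "act a x \<equiv> uq_class q d a \<odot> x"

abbreviation sc :: "complex \<Rightarrow> 'v \<Rightarrow> 'v" where
  "sc c x \<equiv> act (scalar c) x"

abbreviation E :: "'v \<Rightarrow> 'v" where "E x \<equiv> act (gen_var Gen_E) x"
abbreviation K :: "'v \<Rightarrow> 'v" where "K x \<equiv> act (gen_var Gen_K) x"

lemma act_closed [simp, intro]: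
  "a \<in> borel_alg q d \<Longrightarrow> x \<in> carrier M \<Longrightarrow> act a x \<in> carrier M"
  using left_module.smult_closed[OF left_module] by (auto simp: carrier_uq_plus)

lemma act_add:
  "a \<in> borel_alg q d \<Longrightarrow> b \<in> borel_alg q d \<Longrightarrow> x \<in> carrier M \<Longrightarrow>
    act (a + b) x = act a x \<oplus> act b x"
  using left_module.smult_l_distr[OF left_module, of "uq_class q d a" "uq_class q d b" x]
  by (auto simp: carrier_uq_plus uq_class_simps)

lemma act_mult:
  "a \<in> borel_alg q d \<Longrightarrow> b \<in> borel_alg q d \<Longrightarrow> x \<in> carrier M \<Longrightarrow>
    act (a * b) x = act a (act b x)"
  using left_module.smult_assoc1[OF left_module, of "uq_class q d a" "uq_class q d b" x]
  by (auto simp: carrier_uq_plus uq_class_simps)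

lemma act_distrib:
  "a \<in> borel_alg q d \<Longrightarrow> x \<in> carrier M \<Longrightarrow> y \<in> carrier M \<Longrightarrow>
    act a (x \<oplus> y) = act a x \<oplus> act a y"
  using left_module.smult_r_distr[OF left_module, of "uq_class q d a" x y]
  by (auto simp: carrier_uq_plus)

lemma act_one: "x \<in> carrier M \<Longrightarrow> act 1 x = x"
  using left_module.smult_one[OF left_module, of x] by (simp add: uq_class_simps)

lemma act_scalar_0: "x \<in> carrier M \<Longrightarrow> sc 0 x = \<zero>"
  using act_add[of "scalar 0" "scalar 0" x] act_closed[of "scalar 0" x]
  by (simp add: scalar_simps borel_alg_closed)

lemma act_0: "x \<in> carrier M \<Longrightarrow> act 0 x = \<zero>"
  using act_scalar_0[of x] by (simp add: scalar_simps)

lemma act_zero [simp]: "a \<in> borel_alg q d \<Longrightarrow> act a \<zero> = \<zero>"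
  using act_distrib[of a \<zero> \<zero>] act_closed[of a \<zero>]
  by simp

lemma act_power:
  "a \<in> borel_alg q d \<Longrightarrow> x \<in> carrier M \<Longrightarrow> act (a ^ k) x = (act a ^^ k) x"
  by (induction k arbitrary: x) (auto simp: act_one act_mult borel_alg_power)

lemma funpow_closed: "a \<in> borel_alg q d \<Longrightarrow> x \<in> carrier M \<Longrightarrow> (act a ^^ k) x \<in> carrier M"
  by (induction k) auto

lemma funpow_zero: "a \<in> borel_alg q d \<Longrightarrow> (act a ^^ k) \<zero> = \<zero>"
  by (induction k) auto

lemma sc_add: "x \<in> carrier M \<Longrightarrow> sc (a + b) x = sc a x \<oplus> sc b x"
  by (simp add: scalar_simps act_add)

lemma sc_sc: "x \<in> carrier M \<Longrightarrow> sc a (sc b x) = sc (a * b) x"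
  by (simp flip: scalar_simps(4) act_mult)

lemma sc_1 [simp]: "x \<in> carrier M \<Longrightarrow> sc 1 x = x"
  by (simp add: scalar_simps act_one)

lemma act_sc: "a \<in> borel_alg q d \<Longrightarrow> x \<in> carrier M \<Longrightarrow> act a (sc c x) = sc c (act a x)"
  by (simp flip: act_mult scalar_commute)

lemmas E_sc = act_sc[OF borel_alg_gens(2)] and K_sc = act_sc[OF borel_alg_gens(3)]

lemma minus_eq_sc: "x \<in> carrier M \<Longrightarrow> \<ominus> x = sc (- 1) x"
  using sc_add[of x "-1" 1] act_scalar_0[of x] by (intro M.minus_equality) auto

lemma sc_eq_zero_iff:
  assumes "x \<in> carrier M"
  shows "sc c x = \<zero> \<longleftrightarrow> c = 0 \<or> x = \<zero>"
proof
  assume *: "sc c x = \<zero>"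
  show "c = 0 \<or> x = \<zero>"
  proof (cases "c = 0")
    case False
    then have "x = sc (inverse c) (sc c x)" using assms by (simp add: sc_sc)
    then show ?thesis using * by simp
  qed simp
qed (use assms act_scalar_0 in auto)

lemma K_E: "x \<in> carrier M \<Longrightarrow> K (E x) = sc \<omega> (E (K x))"
  using arg_cong[OF uq_class_relations(4)[of q d], of "\<lambda>a. a \<odot> x"]
  by (simp add: act_mult borel_alg_closed(4) \<omega>_def)

lemma E_power_d: "x \<in> carrier M \<Longrightarrow> (E ^^ d) x = \<zero>"
  using act_power[of "gen_var Gen_E" x d] by (simp add: uq_class_relations(1) act_0)

lemma K_power_d: "x \<in> carrier M \<Longrightarrow> (K ^^ d) x = x"
  using act_power[of "gen_var Gen_K" x d] by (simp add: uq_class_relations(3) act_one)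

lemma E_power_ge_d: "x \<in> carrier M \<Longrightarrow> d \<le> k \<Longrightarrow> (E ^^ k) x = \<zero>"
  using E_power_d[of x] funpow_zero[of "gen_var Gen_E" "k - d"]
    funpow_add[of "k - d" d E] by simp

lemma K_E_power:
  assumes "x \<in> carrier M" "K x = sc (\<omega> ^ i) x"
  shows "K ((E ^^ k) x) = sc (\<omega> ^ (i + k)) ((E ^^ k) x)"
  using assms by (induction k) (auto simp: K_E E_sc sc_sc funpow_closed mult.commute)

lemma K_power_weight:
  assumes "x \<in> carrier M" "K x = sc a x"
  shows "(K ^^ k) x = sc (a ^ k) x"
  using assms by (induction k) (auto simp: K_sc sc_sc mult.commute)

text \<open>In the free algebra, \<open>K * weight_proj r - \<omega>\<^sup>r * weight_proj r\<close> telescopes to a scalar multiple of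
  \<open>K\<^sup>d - 1\<close>.\<close>

lemma K_weight_proj:
  assumes "x \<in> carrier M"
  shows "K (act (weight_proj r) x) = sc (\<omega> ^ r) (act (weight_proj r) x)"
proof -
  \<comment> \<open>\<open>T k\<close> is \<open>\<omega>\<^sup>r\<close> times the \<open>k\<close>-th summand, \<open>T (k + 1)\<close> is \<open>K\<close> times that summand\<close>
  define T where "T k = scalar (inverse (\<omega> ^ r) ^ k * \<omega> ^ r / of_nat d) * gen_var Gen_K ^ k" for k
  have inv: "inverse (\<omega> ^ r) * z * \<omega> ^ r = z" for z
    by (simp add: field_simps)
  have 1: "gen_var Gen_K * weight_proj r = (\<Sum>k<d. T (Suc k))"
    unfolding weight_proj_def sum_distrib_left
    by (intro sum.cong)
      (auto simp: T_def inv mult.assoc[symmetric] scalar_commute[of _ "gen_var Gen_K", symmetric])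
  have 2: "scalar (\<omega> ^ r) * weight_proj r = (\<Sum>k<d. T k)"
    unfolding weight_proj_def sum_distrib_left
    by (intro sum.cong) (auto simp: T_def mult.assoc[symmetric] scalar_simps mult.commute)
  have "gen_var Gen_K * weight_proj r - scalar (\<omega> ^ r) * weight_proj r = T d - T 0"
    unfolding 1 2 using sum_lessThan_telescope[of T d] by (simp add: sum_subtractf)
  moreover have "T d = scalar (\<omega> ^ r / of_nat d) * gen_var Gen_K ^ d"
    by (simp add: T_def power_inverse flip: power_mult)
      (simp add: mult.commute[of r] power_mult)
  moreover have "T 0 = scalar (\<omega> ^ r / of_nat d)"
    by (simp add: T_def)
  ultimately have eq: "gen_var Gen_K * weight_proj r + scalar (\<omega> ^ r / of_nat d) =
      scalar (\<omega> ^ r) * weight_proj r + scalar (\<omega> ^ r / of_nat d) * gen_var Gen_K ^ d"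
    by (simp add: algebra_simps)
  have "act (gen_var Gen_K * weight_proj r + scalar (\<omega> ^ r / of_nat d)) x =
      act (scalar (\<omega> ^ r) * weight_proj r + scalar (\<omega> ^ r / of_nat d) * gen_var Gen_K ^ d) x"
    by (simp add: eq)
  then show ?thesis using assms
    by (simp add: act_add act_mult borel_alg_closed(4) borel_alg_power
        act_power K_power_d)
qed

lemma weight_proj_weight:
  assumes "x \<in> carrier M" "K x = sc (\<omega> ^ r) x"
  shows "act (weight_proj r) x = x"
proof -
  have "act (\<Sum>k<m. scalar (inverse (\<omega> ^ r) ^ k / of_nat d) * gen_var Gen_K ^ k) x =
      sc (of_nat m / of_nat d) x" for m
  proof (induction m)
    case 0
    then show ?case using assms by (simp add: act_0 act_scalar_0)
  next
    case (Suc m)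
    have "act (\<Sum>k<Suc m. scalar (inverse (\<omega> ^ r) ^ k / of_nat d) * gen_var Gen_K ^ k) x
       = sc (of_nat m / of_nat d) x \<oplus>
         act (scalar (inverse (\<omega> ^ r) ^ m / of_nat d) * gen_var Gen_K ^ m) x"
      using assms
      by (simp add: act_add borel_alg_sum borel_alg_closed(4) borel_alg_power Suc.IH)
    also have "act (scalar (inverse (\<omega> ^ r) ^ m / of_nat d) * gen_var Gen_K ^ m) x =
        sc (1 / of_nat d) x"
      using assms K_power_weight[OF assms, of m]
      by (simp add: act_mult borel_alg_power act_power sc_sc power_inverse field_simps)
    also have "sc (of_nat m / of_nat d) x \<oplus> sc (1 / of_nat d) x = sc (of_nat (Suc m) / of_nat d) x"
      using assms by (simp flip: sc_add add: add_divide_distrib add.commute)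
    finally show ?case .
  qed
  from this[of d] show ?thesis using assms d_pos by (simp add: weight_proj_def)
qed

text \<open>Every vector is the sum of its weight components. This is how statements about arbitrary
  vectors, in any dimension, are reduced to eigenvectors of \<open>K\<close>.\<close>

lemma weight_span:
  assumes zero: "\<zero> \<in> H" and add: "\<And>x y. x \<in> H \<Longrightarrow> y \<in> H \<Longrightarrow> x \<oplus> y \<in> H"
    and weight: "\<And>x r. x \<in> carrier M \<Longrightarrow> r < d \<Longrightarrow> K x = sc (\<omega> ^ r) x \<Longrightarrow> x \<in> H"
    and x: "x \<in> carrier M"
  shows "x \<in> H"
proof -
  have "act (\<Sum>r<m. weight_proj r) x \<in> H" if "m \<le> d" for m
    using that
  proof (induction m)
    case 0
    then show ?case using x zero by (simp add: act_0)
  next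
    case (Suc m)
    then have "act (weight_proj m) x \<in> H" using K_weight_proj[OF x] x by (intro weight) auto
    with Suc show ?case using x by (simp add: act_add borel_alg_sum add)
  qed
  from this[of d] show ?thesis using x by (simp add: sum_weight_proj act_one)
qed

end

section \<open>Modules over the small quantum group\<close>

lemma left_module_restrict:
  assumes "left_module (uq q d) M"
  shows "left_module (uq_plus q d) M"
proof -
  interpret left_module "uq q d" M by (rule assms)
  show ?thesis
  proof (rule left_module.intro)
    show "ring (uq_plus q d)" by (rule ring_uq_plus)
    show "abelian_group M" by (rule M.abelian_group_axioms)
    show "left_module_axioms (uq_plus q d) M"
      unfolding left_module_axioms_def using uq_plus_subset[of q d]
      by (auto simp: subset_iff smult_closed smult_l_distr smult_r_distr smult_assoc1 smult_one)
  qed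
qed

locale uq_module = small_quantum n d q + M?: abelian_group M
  for n d q and M :: "(uq_elem, 'v) module" (structure) +
  assumes uq_left_module: "left_module (uq q d) M"

sublocale uq_module \<subseteq> borel_module
  by (intro borel_module.intro borel_module_axioms.intro left_module_restrict uq_left_module
      small_quantum_axioms M.abelian_group_axioms)

context uq_module
begin

abbreviation F :: "'v \<Rightarrow> 'v" where "F x \<equiv> act (gen_var Gen_F) x"

lemma uact_closed [simp, intro]: "x \<in> carrier M \<Longrightarrow> act a x \<in> carrier M"
  using left_module.smult_closed[OF uq_left_module] by (auto simp: carrier_uq)

lemma uact_add: "x \<in> carrier M \<Longrightarrow> act (a + b) x = act a x \<oplus> act b x"
  using left_module.smult_l_distr[OF uq_left_module, of "uq_class q d a" "uq_class q d b" x]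
  by (auto simp: carrier_uq uq_class_simps)

lemma uact_mult: "x \<in> carrier M \<Longrightarrow> act (a * b) x = act a (act b x)"
  using left_module.smult_assoc1[OF uq_left_module, of "uq_class q d a" "uq_class q d b" x]
  by (auto simp: carrier_uq uq_class_simps)

lemma uact_distrib:
  "x \<in> carrier M \<Longrightarrow> y \<in> carrier M \<Longrightarrow> act a (x \<oplus> y) = act a x \<oplus> act a y"
  using left_module.smult_r_distr[OF uq_left_module, of "uq_class q d a" x y]
  by (auto simp: carrier_uq)

lemma uact_zero [simp]: "act a \<zero> = \<zero>"
  using uact_distrib[of \<zero> \<zero> a] uact_closed[of \<zero> a] by simp

lemma uact_power: "x \<in> carrier M \<Longrightarrow> act (a ^ k) x = (act a ^^ k) x"
  by (induction k arbitrary: x) (auto simp: act_one uact_mult)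

lemma ufunpow_closed: "x \<in> carrier M \<Longrightarrow> (act a ^^ k) x \<in> carrier M"
  by (induction k) auto

lemma F_sc: "x \<in> carrier M \<Longrightarrow> F (sc c x) = sc c (F x)"
  by (simp flip: uact_mult scalar_commute)

lemma F_power_d: "x \<in> carrier M \<Longrightarrow> (F ^^ d) x = \<zero>"
  using uact_power[of x "gen_var Gen_F" d] by (simp add: uq_class_relations(2) act_0)

lemma K_F: "x \<in> carrier M \<Longrightarrow> K (F x) = sc (inverse \<omega>) (F (K x))"
  using arg_cong[OF uq_class_relations(5)[of q d], of "\<lambda>a. a \<odot> x"]
  by (simp add: uact_mult \<omega>_def)

lemma E_F:
  assumes "x \<in> carrier M" "K x = sc (\<omega> ^ r) x"
  shows "E (F x) = F (E x) \<oplus> sc (bracket r) x"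
proof -
  let ?K = "gen_var Gen_K"
  have "(?K - ?K ^ (d - 1)) + ?K ^ (d - 1) = ?K" by simp
  then have "K x = act (?K - ?K ^ (d - 1)) x \<oplus> act (?K ^ (d - 1)) x"
    using uact_add[OF assms(1)] by metis
  moreover have "act (?K ^ (d - 1)) x = sc (inverse (\<omega> ^ r)) x"
    using K_power_weight[OF assms, of "d - 1"] inverse_omega_pow[of r] assms
    by (simp add: act_power power_mult)
  ultimately have "act (?K - ?K ^ (d - 1)) x = sc (\<omega> ^ r) x \<oplus> \<ominus> sc (inverse (\<omega> ^ r)) x"
    using assms by (metis M.add.inv_solve_right M.minus_eq uact_closed)
  also have "\<dots> = sc (\<omega> ^ r - inverse (\<omega> ^ r)) x"
    using assms sc_add[of x "\<omega> ^ r" "- inverse (\<omega> ^ r)"] by (simp add: minus_eq_sc sc_sc)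
  finally have "sc (1 / (q - inverse q)) (act (?K - ?K ^ (d - 1)) x) = sc (bracket r) x"
    using assms by (simp add: sc_sc bracket_def)
  then show ?thesis
    using arg_cong[OF uq_class_relations(6)[of q d], of "\<lambda>a. a \<odot> x"] assms
    by (simp add: uact_mult uact_add)
qed

end

section \<open>Homomorphisms and submodules are recognised on generators\<close>

text \<open>The scalars on which a map is equivariant form a subring, so generators suffice.\<close>

lemma module_hom_borelI:
  assumes M: "left_module (uq_plus q d) M" and N: "left_module (uq_plus q d) N"
    and closed: "\<And>x. x \<in> carrier M \<Longrightarrow> f x \<in> carrier N"
    and add: "\<And>x y. x \<in> carrier M \<Longrightarrow> y \<in> carrier M \<Longrightarrow> f (x \<oplus>\<^bsub>M\<^esub> y) = f x \<oplus>\<^bsub>N\<^esub> f y"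
    and sc: "\<And>c x. x \<in> carrier M \<Longrightarrow>
      f (uq_scalar q d c \<odot>\<^bsub>M\<^esub> x) = uq_scalar q d c \<odot>\<^bsub>N\<^esub> f x"
    and E: "\<And>x. x \<in> carrier M \<Longrightarrow> f (uq_E q d \<odot>\<^bsub>M\<^esub> x) = uq_E q d \<odot>\<^bsub>N\<^esub> f x"
    and K: "\<And>x. x \<in> carrier M \<Longrightarrow> f (uq_K q d \<odot>\<^bsub>M\<^esub> x) = uq_K q d \<odot>\<^bsub>N\<^esub> f x"
  shows "f \<in> module_hom (uq_plus q d) M N"
proof -
  interpret M: left_module "uq_plus q d" M by (rule M)
  interpret N: left_module "uq_plus q d" N by (rule N)
  have "\<forall>x\<in>carrier M. f (uq_class q d a \<odot>\<^bsub>M\<^esub> x) = uq_class q d a \<odot>\<^bsub>N\<^esub> f x"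
    if "a \<in> borel_alg q d" for a
    using that
  proof (induction rule: borel_alg_induct)
    case (add a b)
    then have "uq_class q d a \<in> carrier (uq_plus q d)" "uq_class q d b \<in> carrier (uq_plus q d)"
      by (auto simp: carrier_uq_plus)
    with add show ?case
      using M.smult_l_distr[of "uq_class q d a" "uq_class q d b"]
        N.smult_l_distr[of "uq_class q d a" "uq_class q d b"]
      by (auto simp: uq_class_simps assms(4) closed M.smult_closed)
  next
    case (mult a b)
    then have "uq_class q d a \<in> carrier (uq_plus q d)" "uq_class q d b \<in> carrier (uq_plus q d)"
      by (auto simp: carrier_uq_plus)
    with mult show ?case
      using M.smult_assoc1[of "uq_class q d a" "uq_class q d b"]
        N.smult_assoc1[of "uq_class q d a" "uq_class q d b"]
      by (auto simp: uq_class_simps closed M.smult_closed)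
  qed (use sc E K in auto)
  then show ?thesis
    using closed add by (auto simp: module_hom_def carrier_uq_plus)
qed

lemma module_hom_uqI:
  assumes M: "left_module (uq q d) M" and N: "left_module (uq q d) N"
    and hom: "f \<in> module_hom (uq_plus q d) M N"
    and F: "\<And>x. x \<in> carrier M \<Longrightarrow>
      f (uq_class q d (gen_var Gen_F) \<odot>\<^bsub>M\<^esub> x) = uq_class q d (gen_var Gen_F) \<odot>\<^bsub>N\<^esub> f x"
  shows "f \<in> module_hom (uq q d) M N"
proof -
  interpret M: left_module "uq q d" M by (rule M)
  interpret N: left_module "uq q d" N by (rule N)
  have closed: "f x \<in> carrier N" if "x \<in> carrier M" for x
    using hom that by (auto simp: module_hom_def)
  have borel: "f (uq_class q d a \<odot>\<^bsub>M\<^esub> x) = uq_class q d a \<odot>\<^bsub>N\<^esub> f x"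
    if "a \<in> borel_alg q d" "x \<in> carrier M" for a x
    using hom that by (auto simp: module_hom_def carrier_uq_plus)
  have carr: "uq_class q d a \<in> carrier (uq q d)" for a by (simp add: carrier_uq)
  have "\<forall>x\<in>carrier M. f (uq_class q d a \<odot>\<^bsub>M\<^esub> x) = uq_class q d a \<odot>\<^bsub>N\<^esub> f x" for a
  proof (induction a rule: free_alg_induct)
    case (scalar c)
    then show ?case by (simp add: borel)
  next
    case (gen g)
    then show ?case by (cases g) (simp_all add: borel F)
  next
    case (add a b)
    then show ?case
      using M.smult_l_distr[OF carr[of a] carr[of b]] N.smult_l_distr[OF carr[of a] carr[of b]] hom
      by (auto simp: uq_class_simps closed M.smult_closed carr module_hom_def)
  next
    case (mult a b)
    then show ?case
      using M.smult_assoc1[OF carr[of a] carr[of b]] N.smult_assoc1[OF carr[of a] carr[of b]]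
      by (auto simp: uq_class_simps closed M.smult_closed carr)
  qed
  then show ?thesis
    using hom by (auto simp: module_hom_def carrier_uq)
qed

lemma (in borel_module) submodule_borelI:
  assumes sub: "H \<subseteq> carrier M" and zero: "\<zero> \<in> H"
    and add: "\<And>x y. x \<in> H \<Longrightarrow> y \<in> H \<Longrightarrow> x \<oplus> y \<in> H"
    and sc: "\<And>c x. x \<in> H \<Longrightarrow> sc c x \<in> H"
    and E: "\<And>x. x \<in> H \<Longrightarrow> E x \<in> H" and K: "\<And>x. x \<in> H \<Longrightarrow> K x \<in> H"
  shows "submodule H (uq_plus q d) M"
proof (rule submodule.intro)
  have "\<ominus> x \<in> H" if "x \<in> H" for x
    using sc[OF that, of "-1"] sub that by (auto simp: minus_eq_sc)
  then show "subgroup H (add_monoid M)"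
    using sub zero add by (intro M.add.subgroupI) (auto simp flip: a_inv_def)
  have "\<forall>x\<in>H. act a x \<in> H" if "a \<in> borel_alg q d" for a
    using that
  proof (induction rule: borel_alg_induct)
    case (add a b)
    then show ?case using sub assms(3) by (auto simp: act_add)
  next
    case (mult a b)
    then show ?case using sub by (auto simp: act_mult)
  qed (use sc E K in auto)
  then show "submodule_axioms H (uq_plus q d) M"
    by (auto simp: submodule_axioms_def carrier_uq_plus)
qed

lemma (in uq_module) submodule_uqI:
  assumes H: "submodule H (uq_plus q d) M"
    and F: "\<And>x. x \<in> H \<Longrightarrow> F x \<in> H"
  shows "submodule H (uq q d) M"
proof (rule submodule.intro)
  show sg: "subgroup H (add_monoid M)" using H by (rule submodule.axioms)
  have sub: "H \<subseteq> carrier M" using subgroup.subset[OF sg] by simp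
  have borel: "act a x \<in> H" if "a \<in> borel_alg q d" "x \<in> H" for a x
    using submodule.smult_closed[OF H, of "uq_class q d a" x] that by (auto simp: carrier_uq_plus)
  have "\<forall>x\<in>H. act a x \<in> H" for a
  proof (induction a rule: free_alg_induct)
    case (scalar c)
    then show ?case by (simp add: borel)
  next
    case (gen g)
    then show ?case using F by (cases g) (simp_all add: borel)
  next
    case (add a b)
    then show ?case using sub subgroup.m_closed[OF sg] by (auto simp: uact_add subset_iff)
  next
    case (mult a b)
    then show ?case using sub by (auto simp: uact_mult subset_iff)
  qed
  then show "submodule_axioms H (uq q d) M"
    by (auto simp: submodule_axioms_def carrier_uq)
qed

lemma (in borel_module) submodule_borelD:
  assumes "submodule H (uq_plus q d) M"
  shows "H \<subseteq> carrier M" "\<zero> \<in> H" "x \<in> H \<Longrightarrow> y \<in> H \<Longrightarrow> x \<oplus> y \<in> H"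
    "a \<in> borel_alg q d \<Longrightarrow> x \<in> H \<Longrightarrow> act a x \<in> H"
  using subgroup.subset[OF submodule.axioms(1)[OF assms]]
    subgroup.one_closed[OF submodule.axioms(1)[OF assms]]
    subgroup.m_closed[OF submodule.axioms(1)[OF assms], of x y]
    submodule.smult_closed[OF assms, of "uq_class q d a" x]
  by (auto simp: carrier_uq_plus)

lemma (in uq_module) submodule_restrict:
  assumes "submodule H (uq q d) M"
  shows "submodule H (uq_plus q d) M"
  using assms uq_plus_subset[of q d]
  by (auto simp: submodule_def submodule_axioms_def)

section \<open>Strings and coordinates\<close>

text \<open>Coordinate vectors with respect to a basis \<open>e 0, \<dots>, e u\<close> are functions on all natural numbers
  that vanish beyond \<open>u\<close>. Thus strings of all lengths share one coordinate type.\<close>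

definition coords :: "nat \<Rightarrow> (nat \<Rightarrow> complex) set" where
  "coords u = {c. \<forall>j>u. c j = 0}"

definition unit_vec :: "nat \<Rightarrow> nat \<Rightarrow> complex" where
  "unit_vec k j = (if j = k then 1 else 0)"

text \<open>The matrix of \<open>E\<close> in string coordinates.\<close>

definition raise_op :: "nat \<Rightarrow> (nat \<Rightarrow> complex) \<Rightarrow> nat \<Rightarrow> complex" where
  "raise_op u c j = (if 0 < j \<and> j \<le> u then c (j - 1) else 0)"

lemma unit_vec_coords: "k \<le> u \<Longrightarrow> unit_vec k \<in> coords u"
  by (auto simp: unit_vec_def coords_def)

lemma raise_op_funpow: "c \<in> coords u \<Longrightarrow>
    (raise_op u ^^ m) c j = (if m \<le> j \<and> j \<le> u then c (j - m) else 0)"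
  by (induction m arbitrary: j) (auto simp: raise_op_def coords_def)

text \<open>The module is an explicit argument because the same string has to be considered for a module and
  for all its extensions, which are different records.\<close>

definition lin :: "complex \<Rightarrow> nat \<Rightarrow> (uq_elem, 'v) module \<Rightarrow> (nat \<Rightarrow> 'v) \<Rightarrow> nat \<Rightarrow>
    (nat \<Rightarrow> complex) \<Rightarrow> 'v" where
  "lin q d M e u c = (\<Oplus>\<^bsub>M\<^esub>j\<in>{..u}. uq_scalar q d (c j) \<odot>\<^bsub>M\<^esub> e j)"

text \<open>Both maps are expanded along unit vectors. The operations \<open>pl\<close> and \<open>ml\<close> of the target are
  parameters in order to cover carrier-based modules and complex-valued functionals alike.\<close>

lemma coords_linear_ext:
  fixes T1 T2 :: "(nat \<Rightarrow> complex) \<Rightarrow> 'w"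
  assumes add: "\<And>c c'. T1 (\<lambda>j. c j + c' j) = pl (T1 c) (T1 c')"
      "\<And>c c'. T2 (\<lambda>j. c j + c' j) = pl (T2 c) (T2 c')"
    and scale: "\<And>a c. T1 (\<lambda>j. a * c j) = ml a (T1 c)" "\<And>a c. T2 (\<lambda>j. a * c j) = ml a (T2 c)"
    and unit: "\<And>k. k \<le> u \<Longrightarrow> T1 (unit_vec k) = T2 (unit_vec k)"
    and c: "c \<in> coords u"
  shows "T1 c = T2 c"
proof -
  have "T1 c = T2 c" if "m \<le> Suc u" "\<And>j. j \<ge> m \<Longrightarrow> c j = 0" for m c
    using that
  proof (induction m arbitrary: c)
    case 0
    then have "c = (\<lambda>j. 0 * unit_vec 0 j)" by auto
    then show ?case using scale[of 0 "unit_vec 0"] unit[of 0] by simp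
  next
    case (Suc m)
    have "c = (\<lambda>j. (c(m := 0)) j + c m * unit_vec m j)"
      by (auto simp: unit_vec_def)
    moreover have "T1 (c(m := 0)) = T2 (c(m := 0))"
      using Suc.prems by (intro Suc.IH) auto
    ultimately show ?case
      using add[of "c(m := 0)" "\<lambda>j. c m * unit_vec m j"] scale[of "c m" "unit_vec m"]
        unit[of m] Suc.prems(1)
      by (metis Suc_le_mono)
  qed
  from this[of "Suc u" c] c show ?thesis by (auto simp: coords_def)
qed

text \<open>A string may be zero at its top here; this generality is needed for the target of a lifting
  problem, where the images of basis vectors can vanish.\<close>

locale string_module = borel_module n d q M for n d q and M :: "(uq_elem, 'v) module" (structure) +
  fixes e :: "nat \<Rightarrow> 'v" and i u :: nat
  assumes e_closed: "j \<le> u \<Longrightarrow> e j \<in> carrier M"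
    and K_e: "j \<le> u \<Longrightarrow> K (e j) = sc (\<omega> ^ (i + j)) (e j)"
    and E_e: "j < u \<Longrightarrow> E (e j) = e (Suc j)"
    and E_e_top: "E (e u) = \<zero>"
begin

abbreviation L :: "(nat \<Rightarrow> complex) \<Rightarrow> 'v" where "L \<equiv> lin q d M e u"

lemma lin_closed [simp]: "L c \<in> carrier M"
  unfolding lin_def by (intro M.finsum_closed) (auto intro: e_closed)

lemma lin_add: "L (\<lambda>j. c j + c' j) = L c \<oplus> L c'"
proof -
  have "L (\<lambda>j. c j + c' j) = (\<Oplus>j\<in>{..u}. sc (c j) (e j) \<oplus> sc (c' j) (e j))"
    unfolding lin_def by (intro M.finsum_cong') (auto simp: sc_add e_closed)
  also have "\<dots> = L c \<oplus> L c'"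
    unfolding lin_def by (intro M.finsum_addf) (auto simp: e_closed)
  finally show ?thesis .
qed

lemma lin_scale: "L (\<lambda>j. a * c j) = sc a (L c)"
proof -
  have "(\<Oplus>j\<in>{..m}. sc (a * c j) (e j)) = sc a (\<Oplus>j\<in>{..m}. sc (c j) (e j))" if "m \<le> u" for m
    using that
  proof (induction m)
    case (Suc m)
    have *: "(\<lambda>j. sc (b j) (e j)) \<in> {..Suc m} \<rightarrow> carrier M" for b
      using Suc.prems e_closed by auto
    then have "(\<Oplus>j\<in>{..m}. sc (b j) (e j)) \<in> carrier M" for b
      by (intro M.finsum_closed) (auto simp: Pi_def)
    then show ?case
      using Suc * e_closed by (simp add: M.finsum_Suc act_distrib sc_sc)
  qed (use e_closed in \<open>simp add: sc_sc\<close>)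
  then show ?thesis by (simp add: lin_def)
qed

lemma lin_cong: "(\<And>j. j \<le> u \<Longrightarrow> c j = c' j) \<Longrightarrow> L c = L c'"
  unfolding lin_def by (intro M.finsum_cong') (auto intro: e_closed)

lemma lin_zero: "L (\<lambda>_. 0) = \<zero>"
  using lin_scale[of 0 "\<lambda>_. 0"] by (simp add: act_scalar_0)

lemma lin_unit: "k \<le> u \<Longrightarrow> L (unit_vec k) = e k"
proof -
  assume k: "k \<le> u"
  have "L (unit_vec k) = (\<Oplus>j\<in>{..u}. if k = j then e j else \<zero>)"
    unfolding lin_def by (intro M.finsum_cong') (auto simp: unit_vec_def act_scalar_0 e_closed)
  also have "\<dots> = e k"
    using k e_closed by (intro M.finsum_singleton) auto
  finally show ?thesis .
qed

text \<open>The pattern by which the matrices of \<open>K\<close>, \<open>E\<close> and \<open>F\<close> are read off from their values on the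
  string.\<close>

lemma lin_eqI:
  assumes "\<And>c c'. T (\<lambda>j. c j + c' j) = T c \<oplus> T c'" "\<And>a c. T (\<lambda>j. a * c j) = sc a (T c)"
    and "\<And>c c' j. t (\<lambda>j. c j + c' j) j = t c j + t c' j" "\<And>a c j. t (\<lambda>j. a * c j) j = a * t c j"
    and "\<And>k. k \<le> u \<Longrightarrow> T (unit_vec k) = L (t (unit_vec k))" and "c \<in> coords u"
  shows "T c = L (t c)"
proof (rule coords_linear_ext[where ?T1.0 = T and ?T2.0 = "\<lambda>c. L (t c)" and pl = "(\<oplus>)" and ml = sc])
  show "L (t (\<lambda>j. c j + c' j)) = L (t c) \<oplus> L (t c')" for c c'
    using assms(3) by (simp flip: lin_add cong: lin_cong)
  show "L (t (\<lambda>j. a * c j)) = sc a (L (t c))" for a c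
    using assms(4) by (simp flip: lin_scale cong: lin_cong)
qed (use assms in auto)

lemma lin_K: "c \<in> coords u \<Longrightarrow> K (L c) = L (\<lambda>j. \<omega> ^ (i + j) * c j)"
proof (rule lin_eqI[where T = "\<lambda>c. K (L c)" and t = "\<lambda>c j. \<omega> ^ (i + j) * c j"])
  fix k assume k: "k \<le> u"
  have "L (\<lambda>j. \<omega> ^ (i + j) * unit_vec k j) = L (\<lambda>j. \<omega> ^ (i + k) * unit_vec k j)"
    by (intro lin_cong) (auto simp: unit_vec_def)
  then show "K (L (unit_vec k)) = L (\<lambda>j. \<omega> ^ (i + j) * unit_vec k j)"
    using k by (simp add: lin_unit K_e lin_scale)
qed (auto simp: lin_add lin_scale act_distrib K_sc algebra_simps)

lemma lin_E: "c \<in> coords u \<Longrightarrow> E (L c) = L (raise_op u c)"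
proof (rule lin_eqI[where T = "\<lambda>c. E (L c)" and t = "raise_op u"])
  fix k assume k: "k \<le> u"
  show "E (L (unit_vec k)) = L (raise_op u (unit_vec k))"
  proof (cases "k = u")
    case True
    have "L (raise_op u (unit_vec k)) = L (\<lambda>_. 0)"
      using True by (intro lin_cong) (auto simp: unit_vec_def raise_op_def)
    then show ?thesis using True by (simp add: lin_unit E_e_top lin_zero)
  next
    case False
    then have "L (raise_op u (unit_vec k)) = L (unit_vec (Suc k))"
      using k by (intro lin_cong) (auto simp: unit_vec_def raise_op_def)
    then show ?thesis using k False by (simp add: lin_unit E_e)
  qed
qed (auto simp: lin_add lin_scale act_distrib E_sc algebra_simps raise_op_def)

lemma raise_op_coords: "raise_op u c \<in> coords u"
  by (auto simp: raise_op_def coords_def)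

lemma lin_E_power: "c \<in> coords u \<Longrightarrow> (E ^^ m) (L c) = L ((raise_op u ^^ m) c)"
proof (induction m)
  case (Suc m)
  have "(raise_op u ^^ m) c \<in> coords u"
    using Suc.prems raise_op_coords by (cases m) auto
  then show ?case using Suc by (simp add: lin_E)
qed simp

text \<open>Shifting by \<open>u - k\<close> pushes all coordinates after the first possibly nonzero one, at \<open>k\<close>, over the
  top of the string.\<close>

lemma lin_E_power_top:
  assumes "c \<in> coords u" "k \<le> u" "\<And>j. j < k \<Longrightarrow> c j = 0"
  shows "(E ^^ (u - k)) (L c) = sc (c k) (e u)"
proof -
  have "L ((raise_op u ^^ (u - k)) c) = L (\<lambda>j. c k * unit_vec u j)"
    using assms by (intro lin_cong) (auto simp: raise_op_funpow unit_vec_def)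
  then show ?thesis using assms by (simp add: lin_E_power lin_scale lin_unit)
qed

lemma e_power: "j \<le> u \<Longrightarrow> e j = (E ^^ j) (e 0)"
  by (induction j) (auto simp: E_e[symmetric])

end

text \<open>The first nonzero coordinate is the one that survives longest under \<open>E\<close>.\<close>

lemma first_nonzero_coord:
  assumes "c \<in> coords u" "c \<noteq> (\<lambda>_. 0)"
  obtains k where "k \<le> u" "c k \<noteq> 0" "\<And>j. j < k \<Longrightarrow> c j = 0"
proof -
  obtain k0 where "c k0 \<noteq> 0" using assms(2) by auto
  then have "c (LEAST k. c k \<noteq> 0) \<noteq> 0" by (rule LeastI)
  moreover have "c j = 0" if "j < (LEAST k. c k \<noteq> 0)" for j
    using not_less_Least[OF that] by simp
  moreover have "(LEAST k. c k \<noteq> 0) \<le> u"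
    using calculation(1) assms(1) unfolding coords_def by (metis (mono_tags, lifting) mem_Collect_eq not_le)
  ultimately show ?thesis by (intro that)
qed

locale faithful_string = string_module +
  assumes e_top: "e u \<noteq> \<zero>"
begin

text \<open>A string with nonzero top vector is linearly independent: by \<open>lin_E_power_top\<close>, a power of
  \<open>E\<close> detects the first nonzero coordinate.\<close>

lemma lin_eq_zero_iff: "c \<in> coords u \<Longrightarrow> L c = \<zero> \<longleftrightarrow> c = (\<lambda>_. 0)"
proof
  assume c: "c \<in> coords u" "L c = \<zero>"
  show "c = (\<lambda>_. 0)"
  proof (rule ccontr)
    assume "c \<noteq> (\<lambda>_. 0)"
    then obtain k where k: "k \<le> u" "c k \<noteq> 0" "\<And>j. j < k \<Longrightarrow> c j = 0"
      using first_nonzero_coord[OF c(1)] by blast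
    then have "sc (c k) (e u) = (E ^^ (u - k)) \<zero>" using lin_E_power_top[OF c(1)] c(2) by simp
    then show False using k e_top e_closed[of u] by (simp add: funpow_zero sc_eq_zero_iff)
  qed
qed (simp add: lin_zero)

lemma lin_inj: "inj_on L (coords u)"
proof (rule inj_onI)
  fix c c' assume c: "c \<in> coords u" "c' \<in> coords u" "L c = L c'"
  have "L (\<lambda>j. c j + - 1 * c' j) = \<zero>"
    unfolding lin_add lin_scale using c(3) by (simp flip: minus_eq_sc add: M.r_neg)
  moreover have "(\<lambda>j. c j + - 1 * c' j) \<in> coords u" using c by (auto simp: coords_def)
  ultimately have "(\<lambda>j. c j + - 1 * c' j) = (\<lambda>_. 0)" using lin_eq_zero_iff by blast
  then show "c = c'" by (auto simp: fun_eq_iff)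
qed

lemma u_less_d: "u < d"
  using e_top e_power[of u] E_power_ge_d[of "e 0" u] e_closed[of 0] by force

text \<open>The line spanned by the top vector is the socle of the string: raising any nonzero vector as far
  as possible ends there.\<close>

lemma socle:
  assumes "submodule H (uq_plus q d) M" "H \<noteq> {\<zero>}" "H \<subseteq> L ` coords u"
  shows "e u \<in> H"
proof -
  note H = submodule_borelD[OF assms(1)]
  obtain x where "x \<in> H" "x \<noteq> \<zero>" using assms(2) H(2) by auto
  then obtain c where c: "c \<in> coords u" "L c \<in> H" "c \<noteq> (\<lambda>_. 0)"
    using assms(3) lin_zero by auto
  then obtain k where k: "k \<le> u" "c k \<noteq> 0" "\<And>j. j < k \<Longrightarrow> c j = 0"
    using first_nonzero_coord[OF c(1)] by blast
  have "(E ^^ m) (L c) \<in> H" for m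
    by (induction m) (use c H(4) in auto)
  then have "sc (c k) (e u) \<in> H" using lin_E_power_top[OF c(1) k(1,3)] by metis
  then have "sc (inverse (c k)) (sc (c k) (e u)) \<in> H"
    by (rule H(4)[OF borel_alg_gens(1)])
  moreover have "sc (inverse (c k)) (sc (c k) (e u)) = e u"
    using k(2) e_closed[of u] by (subst sc_sc) auto
  ultimately show ?thesis by simp
qed

end

lemma (in borel_module) is_M_iff:
  "is_M q d i u M \<longleftrightarrow> (\<exists>e. faithful_string n d q M e i u \<and> carrier M = lin q d M e u ` coords u)"
proof
  assume "is_M q d i u M"
  then obtain e where e: "\<forall>j\<le>u. e j \<in> carrier M"
    "\<forall>x\<in>carrier M. \<exists>!c. c \<in> coords u \<and> x = lin q d M e u c"
    "\<forall>j\<le>u. K (e j) = sc (\<omega> ^ (i + j)) (e j)"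
    "\<forall>j<u. E (e j) = e (Suc j)" "E (e u) = \<zero>"
    unfolding is_M_def by (auto simp: coords_def lin_def \<omega>_def simp flip: power_mult)
  have lin0: "lin q d M e u (\<lambda>_. 0) = \<zero>"
  proof -
    have "lin q d M e u (\<lambda>_. 0) = (\<Oplus>j\<in>{..u}. \<zero>)"
      unfolding lin_def using e(1) by (intro M.finsum_cong') (auto simp: act_scalar_0)
    then show ?thesis by simp
  qed
  have "e u \<noteq> \<zero>"
  proof
    assume "e u = \<zero>"
    then have "lin q d M e u (unit_vec u) = (\<Oplus>j\<in>{..u}. \<zero>)"
      unfolding lin_def using e(1) by (intro M.finsum_cong') (auto simp: unit_vec_def act_scalar_0)
    then have "lin q d M e u (unit_vec u) = lin q d M e u (\<lambda>_. 0)" using lin0 by simp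
    moreover have "unit_vec u \<in> coords u" "(\<lambda>_. 0) \<in> coords u"
      by (auto simp: unit_vec_def coords_def)
    ultimately have "unit_vec u = (\<lambda>_. 0)" using e(2) lin0 M.zero_closed by metis
    then have "unit_vec u u = 0" by simp
    then show False by (simp add: unit_vec_def)
  qed
  then interpret faithful_string n d q M e i u
    using e by unfold_locales auto
  have "carrier M = L ` coords u" using e(2) by auto
  then show "\<exists>e. faithful_string n d q M e i u \<and> carrier M = lin q d M e u ` coords u"
    using faithful_string_axioms by blast
next
  assume "\<exists>e. faithful_string n d q M e i u \<and> carrier M = lin q d M e u ` coords u"
  then obtain e where e: "faithful_string n d q M e i u" "carrier M = lin q d M e u ` coords u"
    by auto
  interpret faithful_string n d q M e i u by (rule e(1))
  have "\<exists>!c. c \<in> coords u \<and> x = L c" if "x \<in> carrier M" for x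
    using that lin_inj unfolding e(2) by (auto simp: inj_on_def)
  note ex1 = this
  show "is_M q d i u M"
    unfolding is_M_def
  proof (intro conjI left_module exI[of _ e])
    show "\<forall>j\<le>u. e j \<in> carrier M" using e_closed by simp
    show "\<forall>x\<in>carrier M. \<exists>!c. (\<forall>j>u. c j = 0) \<and> x = (\<Oplus>j\<in>{..u}. sc (c j) (e j))"
      using ex1 unfolding coords_def lin_def mem_Collect_eq by blast
    show "\<forall>j\<le>u. K (e j) = sc (q ^ (2 * (i + j))) (e j)"
      using K_e unfolding \<omega>_def power_mult[symmetric] by blast
    show "\<forall>j<u. E (e j) = e (j + 1)" using E_e by simp
    show "E (e u) = \<zero>" by (rule E_e_top)
  qed
qed

text \<open>Two nonzero summands would share the socle.\<close>

lemma (in faithful_string) indecomposable: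
  assumes surj: "carrier M = L ` coords u"
  shows "indecomposable_module (uq_plus q d) M"
  unfolding indecomposable_module_def
proof (intro conjI allI impI left_module)
  show "carrier M \<noteq> {\<zero>}" using e_top e_closed[of u] by auto
  fix H1 H2
  assume H: "submodule H1 (uq_plus q d) M \<and> submodule H2 (uq_plus q d) M \<and>
    H1 <+>\<^bsub>M\<^esub> H2 = carrier M \<and> H1 \<inter> H2 = {\<zero>}"
  show "H1 = {\<zero>} \<or> H2 = {\<zero>}"
  proof (rule ccontr)
    assume "\<not> ?thesis"
    then have "e u \<in> H1 \<inter> H2"
      using H socle[of H1] socle[of H2] submodule_borelD(1)[of H1] submodule_borelD(1)[of H2] surj
      by auto
    then show False using H e_top by auto
  qed
qed

section \<open>Splitting off a longest string\<close>

context borel_module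
begin

lemma E_power_add: "x \<in> carrier M \<Longrightarrow> y \<in> carrier M \<Longrightarrow> (E ^^ k) (x \<oplus> y) = (E ^^ k) x \<oplus> (E ^^ k) y"
  by (induction k) (auto simp: act_distrib funpow_closed)

lemma E_power_sc: "x \<in> carrier M \<Longrightarrow> (E ^^ k) (sc c x) = sc c ((E ^^ k) x)"
  by (induction k) (auto simp: E_sc funpow_closed)

lemma K_E_funpow: "x \<in> carrier M \<Longrightarrow> K ((E ^^ k) x) = sc (\<omega> ^ k) ((E ^^ k) (K x))"
  by (induction k) (auto simp: K_E E_sc sc_sc funpow_closed)

definition K_subspace :: "'v set \<Rightarrow> bool" where
  "K_subspace H \<longleftrightarrow> H \<subseteq> carrier M \<and> \<zero> \<in> H \<and> (\<forall>x\<in>H. \<forall>y\<in>H. x \<oplus> y \<in> H) \<and>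
     (\<forall>c. \<forall>x\<in>H. sc c x \<in> H) \<and> (\<forall>x\<in>H. K x \<in> H)"

text \<open>The functional must vanish on all weights other than \<open>\<omega>\<^sup>r\<close>, which is what equivariance says. Its
  kernel is a maximal \<open>K\<close>-stable subspace \<open>H\<close> that avoids \<open>v\<close>: for a weight vector \<open>x\<close> outside \<open>H\<close>
  the span of \<open>H\<close> and \<open>x\<close> is again \<open>K\<close>-stable, so it contains \<open>v\<close> by maximality, and solving for \<open>x\<close>
  shows that \<open>H\<close> and \<open>v\<close> span everything.\<close>

lemma K_equivariant_functional:
  assumes v: "v \<in> carrier M" "v \<noteq> \<zero>" "K v = sc (\<omega> ^ r) v"
  obtains \<phi> where "\<phi> v = 1"
    "\<And>x y. x \<in> carrier M \<Longrightarrow> y \<in> carrier M \<Longrightarrow> \<phi> (x \<oplus> y) = \<phi> x + \<phi> y"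
    "\<And>c x. x \<in> carrier M \<Longrightarrow> \<phi> (sc c x) = c * \<phi> x"
    "\<And>x. x \<in> carrier M \<Longrightarrow> \<phi> (K x) = \<omega> ^ r * \<phi> x"
proof -
  let ?A = "{H. K_subspace H \<and> v \<notin> H}"
  have "{\<zero>} \<in> ?A" using v by (auto simp: K_subspace_def)
  moreover have "\<Union>C \<in> ?A" if "C \<noteq> {}" "subset.chain ?A C" for C
  proof -
    have C: "C \<subseteq> ?A" and tot: "\<And>X Y. X \<in> C \<Longrightarrow> Y \<in> C \<Longrightarrow> X \<subseteq> Y \<or> Y \<subseteq> X"
      using that(2) by (auto simp: subset.chain_def)
    have "x \<oplus> y \<in> \<Union>C" if xy: "x \<in> \<Union>C" "y \<in> \<Union>C" for x y
    proof -
      obtain X Y where XY: "X \<in> C" "Y \<in> C" "x \<in> X" "y \<in> Y" using xy by auto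
      then obtain Z where Z: "Z \<in> C" "x \<in> Z" "y \<in> Z" using tot[of X Y] by blast
      then have "K_subspace Z" using C by blast
      then have "x \<oplus> y \<in> Z" using Z by (simp add: K_subspace_def)
      then show ?thesis using Z(1) by blast
    qed
    moreover have "\<Union>C \<subseteq> carrier M" "\<zero> \<in> \<Union>C" "v \<notin> \<Union>C"
      "\<And>c x. x \<in> \<Union>C \<Longrightarrow> sc c x \<in> \<Union>C" "\<And>x. x \<in> \<Union>C \<Longrightarrow> K x \<in> \<Union>C"
      using that(1) C unfolding K_subspace_def by blast+
    ultimately show ?thesis unfolding K_subspace_def by blast
  qed
  ultimately have "\<exists>H\<in>?A. \<forall>X\<in>?A. H \<subseteq> X \<longrightarrow> X = H"
    by (intro subset_Zorn_nonempty) auto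
  then obtain H where H: "K_subspace H" "v \<notin> H"
    and max: "\<And>X. K_subspace X \<Longrightarrow> v \<notin> X \<Longrightarrow> H \<subseteq> X \<Longrightarrow> X = H"
    by blast
  have HD: "H \<subseteq> carrier M" "\<zero> \<in> H" "\<And>x y. x \<in> H \<Longrightarrow> y \<in> H \<Longrightarrow> x \<oplus> y \<in> H"
    "\<And>c x. x \<in> H \<Longrightarrow> sc c x \<in> H" "\<And>x. x \<in> H \<Longrightarrow> K x \<in> H"
    using H(1) by (auto simp: K_subspace_def)
  have decomp: "\<exists>c. \<exists>h\<in>H. x = sc c v \<oplus> h" if x: "x \<in> carrier M" for x
  proof -
    have "x \<in> {x \<in> carrier M. \<exists>c. \<exists>h\<in>H. x = sc c v \<oplus> h}" (is "x \<in> ?P")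
    proof (rule weight_span)
      have "\<zero> = sc 0 v \<oplus> \<zero>" using v by (simp add: act_scalar_0)
      then show "\<zero> \<in> ?P" using HD(2) by blast
    next
      fix x y assume xy: "x \<in> ?P" "y \<in> ?P"
      then obtain c h c' h' where *: "h \<in> H" "x = sc c v \<oplus> h" "h' \<in> H" "y = sc c' v \<oplus> h'"
        by auto
      then have "x \<oplus> y = sc (c + c') v \<oplus> (h \<oplus> h')"
        using v HD(1) by (auto simp: sc_add M.a_ac subset_iff)
      moreover have "x \<oplus> y \<in> carrier M" using xy by simp
      ultimately show "x \<oplus> y \<in> ?P" using * HD(3) by blast
    next
      fix x s assume x: "x \<in> carrier M" "K x = sc (\<omega> ^ s) x"
      \<comment> \<open>the span of \<open>H\<close> and \<open>x\<close>\<close>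
      let ?X = "{y. \<exists>h\<in>H. \<exists>a. y = h \<oplus> sc a x}"
      have X: "K_subspace ?X"
        unfolding K_subspace_def
      proof (intro conjI ballI allI subsetI)
        fix y assume "y \<in> ?X" then show "y \<in> carrier M" using x HD(1) by auto
      next
        have "\<zero> = \<zero> \<oplus> sc 0 x" using x by (simp add: act_scalar_0)
        then show "\<zero> \<in> ?X" using HD(2) by blast
      next
        fix y z assume "y \<in> ?X" "z \<in> ?X"
        then obtain h a h' a' where *: "h \<in> H" "y = h \<oplus> sc a x" "h' \<in> H" "z = h' \<oplus> sc a' x"
          by auto
        then have "y \<oplus> z = (h \<oplus> h') \<oplus> sc (a + a') x"
          using x HD(1) by (auto simp: sc_add M.a_ac subset_iff)
        then show "y \<oplus> z \<in> ?X" using * HD(3) by blast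
      next
        fix c y assume "y \<in> ?X"
        then obtain h a where *: "h \<in> H" "y = h \<oplus> sc a x" by auto
        then have "sc c y = sc c h \<oplus> sc (c * a) x"
          using x HD(1) by (auto simp: act_distrib sc_sc subset_iff)
        then show "sc c y \<in> ?X" using * HD(4) by blast
      next
        fix y assume "y \<in> ?X"
        then obtain h a where *: "h \<in> H" "y = h \<oplus> sc a x" by auto
        then have "K y = K h \<oplus> sc (a * \<omega> ^ s) x"
          using x HD(1) by (auto simp: act_distrib K_sc sc_sc subset_iff)
        then show "K y \<in> ?X" using * HD(5) by blast
      qed
      have sub: "H \<subseteq> ?X"
      proof
        fix h assume "h \<in> H"
        then have "h = h \<oplus> sc 0 x" using x HD(1) by (auto simp: act_scalar_0 subset_iff)
        then show "h \<in> ?X" using \<open>h \<in> H\<close> by blast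
      qed
      have "x = \<zero> \<oplus> sc 1 x" using x by simp
      then have xX: "x \<in> ?X" using HD(2) by blast
      show "x \<in> ?P"
      proof (cases "v \<in> ?X")
        case False
        then have "x \<in> H" using max[OF X False sub] xX by blast
        moreover have "x = sc 0 v \<oplus> x" using x v by (simp add: act_scalar_0)
        ultimately show ?thesis using x by blast
      next
        case True
        then obtain h a where ha: "h \<in> H" "v = h \<oplus> sc a x" by auto
        have h: "h \<in> carrier M" using ha HD by auto
        have "a \<noteq> 0"
          using ha H(2) x h by (auto simp: act_scalar_0)
        have "sc (inverse a) v = sc (inverse a) h \<oplus> x"
          unfolding ha(2) using x h \<open>a \<noteq> 0\<close> by (simp add: act_distrib sc_sc)
        then have "sc (inverse a) v \<oplus> sc (- inverse a) h = x \<oplus> (sc (inverse a) h \<oplus> sc (- inverse a) h)"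
          using x h by (simp add: M.a_ac)
        also have "\<dots> = x"
          using x h sc_add[of h "inverse a" "- inverse a"] by (simp add: act_scalar_0)
        finally show ?thesis using x HD(4)[OF ha(1)] by force
      qed
    qed (rule x)
    then show ?thesis by simp
  qed
  define \<phi> where "\<phi> x = (SOME c. \<exists>h\<in>H. x = sc c v \<oplus> h)" for x
  have phi: "\<phi> (sc c v \<oplus> h) = c" if h: "h \<in> H" for c h
  proof -
    have "\<exists>h'\<in>H. sc c v \<oplus> h = sc (\<phi> (sc c v \<oplus> h)) v \<oplus> h'"
      unfolding \<phi>_def by (rule someI[where x = c]) (use h in blast)
    then obtain c' h' where c': "c' = \<phi> (sc c v \<oplus> h)" "h' \<in> H" "sc c v \<oplus> h = sc c' v \<oplus> h'"
      by blast
    have hc: "h \<in> carrier M" "h' \<in> carrier M" using h c' HD(1) by auto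
    have "sc c v = sc c' v \<oplus> sc (c - c') v"
      using v sc_add[of v c' "c - c'"] by simp
    then have "sc c' v \<oplus> (sc (c - c') v \<oplus> h) = sc c' v \<oplus> h'"
      using c'(3) v hc by (simp add: M.a_assoc)
    then have "sc (c - c') v \<oplus> h = h'"
      using v hc by simp
    then have "sc (c - c') v = h' \<oplus> sc (- 1) h"
      using v hc M.add.inv_solve_right[of "sc (c - c') v" h' h] by (simp add: minus_eq_sc)
    then have "sc (c - c') v \<in> H" using c'(2) h HD(3,4) by simp
    then have *: "sc (inverse (c - c')) (sc (c - c') v) \<in> H" by (rule HD(4))
    have "c - c' = 0"
    proof (rule ccontr)
      assume "c - c' \<noteq> 0"
      then have "sc (inverse (c - c')) (sc (c - c') v) = v" using v by (subst sc_sc) auto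
      then show False using * H(2) by simp
    qed
    then show ?thesis using c'(1) by simp
  qed
  show ?thesis
  proof (rule that)
    show "\<phi> v = 1" using phi[OF HD(2), of 1] v by simp
  next
    fix x y assume xy: "x \<in> carrier M" "y \<in> carrier M"
    then obtain c h c' h' where *: "h \<in> H" "x = sc c v \<oplus> h" "h' \<in> H" "y = sc c' v \<oplus> h'"
      using decomp by metis
    then have "x \<oplus> y = sc (c + c') v \<oplus> (h \<oplus> h')"
      using v HD(1) by (auto simp: sc_add M.a_ac subset_iff)
    then show "\<phi> (x \<oplus> y) = \<phi> x + \<phi> y" using phi * HD(3) by simp
  next
    fix c x assume "x \<in> carrier M"
    then obtain a h where *: "h \<in> H" "x = sc a v \<oplus> h" using decomp by metis
    then have "sc c x = sc (c * a) v \<oplus> sc c h"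
      using v HD(1) by (auto simp: act_distrib sc_sc subset_iff)
    then show "\<phi> (sc c x) = c * \<phi> x" using phi * HD(4) by simp
  next
    fix x assume "x \<in> carrier M"
    then obtain a h where *: "h \<in> H" "x = sc a v \<oplus> h" using decomp by metis
    then have "K x = sc (\<omega> ^ r * a) v \<oplus> K h"
      using v HD(1) by (auto simp: act_distrib K_sc sc_sc subset_iff mult.commute)
    then show "\<phi> (K x) = \<omega> ^ r * \<phi> x" using phi * HD(5) by simp
  qed
qed

end

context string_module
begin

lemma lin_image_submodule: "submodule (L ` coords u) (uq_plus q d) M"
proof (rule submodule_borelI)
  show "\<zero> \<in> L ` coords u" using lin_zero by (force simp: coords_def)
  fix x y assume "x \<in> L ` coords u" "y \<in> L ` coords u"
  then obtain c c' where "c \<in> coords u" "c' \<in> coords u" "x = L c" "y = L c'" by auto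
  then show "x \<oplus> y \<in> L ` coords u"
    by (intro image_eqI[of _ _ "\<lambda>j. c j + c' j"]) (auto simp: lin_add coords_def)
next
  fix a x assume "x \<in> L ` coords u"
  then obtain c where c: "c \<in> coords u" "x = L c" by auto
  then show "sc a x \<in> L ` coords u"
    by (intro image_eqI[of _ _ "\<lambda>j. a * c j"]) (auto simp: lin_scale coords_def)
  from c show "E x \<in> L ` coords u"
    by (intro image_eqI[of _ _ "raise_op u c"]) (auto simp: lin_E raise_op_coords)
  from c show "K x \<in> L ` coords u"
    by (intro image_eqI[of _ _ "\<lambda>j. \<omega> ^ (i + j) * c j"]) (auto simp: lin_K coords_def)
qed auto

end

text \<open>A longest string splits off. In other words, it is injective over the quotient of the Borel part
  by \<open>E\<^sup>u\<^sup>+\<^sup>1\<close>: the coordinates \<open>\<phi> (E\<^sup>u\<^sup>-\<^sup>j x)\<close> define an equivariant projection onto the string, and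
  the complement is its kernel.\<close>

lemma (in faithful_string) complement:
  assumes top: "\<And>x. x \<in> carrier M \<Longrightarrow> (E ^^ Suc u) x = \<zero>"
  obtains H where "submodule H (uq_plus q d) M" "(L ` coords u) <+>\<^bsub>M\<^esub> H = carrier M"
    "L ` coords u \<inter> H = {\<zero>}"
proof -
  obtain \<phi> where phi: "\<phi> (e u) = 1"
    "\<And>x y. x \<in> carrier M \<Longrightarrow> y \<in> carrier M \<Longrightarrow> \<phi> (x \<oplus> y) = \<phi> x + \<phi> y"
    "\<And>c x. x \<in> carrier M \<Longrightarrow> \<phi> (sc c x) = c * \<phi> x"
    "\<And>x. x \<in> carrier M \<Longrightarrow> \<phi> (K x) = \<omega> ^ (i + u) * \<phi> x"
    using K_equivariant_functional[of "e u" "i + u"] e_closed[of u] e_top K_e[of u] by auto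
  have phi0: "\<phi> \<zero> = 0" using phi(3)[of \<zero> 0] by simp
  have phi_e: "\<phi> (e k) = 0" if "k < u" for k
  proof -
    have "\<omega> ^ (i + u) * \<phi> (e k) = \<omega> ^ (i + k) * \<phi> (e k)"
      using phi(3)[of "e k" "\<omega> ^ (i + k)"] phi(4)[of "e k"] K_e[of k] e_closed[of k] that
      by (metis less_imp_le)
    moreover have "\<omega> ^ u \<noteq> \<omega> ^ k" using omega_pow_inj[of u k] that u_less_d by auto
    ultimately show ?thesis by (auto simp: power_add)
  qed
  have phi_L: "\<phi> (L c) = c u" if "c \<in> coords u" for c
  proof (rule coords_linear_ext[where ?T1.0 = "\<lambda>c. \<phi> (L c)" and ?T2.0 = "\<lambda>c. c u"
        and pl = "(+)" and ml = "(*)"])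
    fix k assume "k \<le> u"
    then show "\<phi> (L (unit_vec k)) = unit_vec k u"
      using phi(1) phi_e[of k] by (auto simp: lin_unit unit_vec_def)
  qed (use that phi in \<open>auto simp: lin_add lin_scale\<close>)
  have phi_E: "\<phi> ((E ^^ j) (L c)) = c (u - j)" if "c \<in> coords u" "j \<le> u" for c j
  proof -
    have "(raise_op u ^^ j) c \<in> coords u"
      using that raise_op_coords by (cases j) auto
    then show ?thesis using that by (simp add: lin_E_power phi_L raise_op_funpow)
  qed
  define H where "H = {x \<in> carrier M. \<forall>j\<le>u. \<phi> ((E ^^ j) x) = 0}"
  have H: "submodule H (uq_plus q d) M"
  proof (rule submodule_borelI)
    fix x assume x: "x \<in> H"
    have "\<phi> ((E ^^ j) (E x)) = 0" if "j \<le> u" for j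
    proof (cases "j = u")
      case True
      then show ?thesis using top[of x] x phi0 by (simp add: H_def funpow_swap1)
    next
      case False
      then have "Suc j \<le> u" using that by simp
      then have "\<phi> ((E ^^ Suc j) x) = 0" using x unfolding H_def by blast
      then show ?thesis by (simp add: funpow_swap1)
    qed
    then show "E x \<in> H" using x by (simp add: H_def)
    have "\<phi> ((E ^^ j) (K x)) = 0" if "j \<le> u" for j
    proof -
      have "\<omega> ^ j * \<phi> ((E ^^ j) (K x)) = \<omega> ^ (i + u) * \<phi> ((E ^^ j) x)"
        using x phi(3)[of "(E ^^ j) (K x)" "\<omega> ^ j"] phi(4)[of "(E ^^ j) x"]
        by (simp add: H_def K_E_funpow funpow_closed)
      then show ?thesis using x that by (simp add: H_def)
    qed
    then show "K x \<in> H" using x by (simp add: H_def)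
  qed (auto simp: H_def phi phi0 funpow_zero E_power_add E_power_sc funpow_closed)
  have "x \<in> (L ` coords u) <+>\<^bsub>M\<^esub> H" if x: "x \<in> carrier M" for x
  proof -
    define c where "c j = (if j \<le> u then \<phi> ((E ^^ (u - j)) x) else 0)" for j
    have c: "c \<in> coords u" by (auto simp: c_def coords_def)
    \<comment> \<open>subtracting the projection of \<open>x\<close> to the string leaves the component in \<open>H\<close>\<close>
    define y where "y = x \<oplus> sc (- 1) (L c)"
    have "\<phi> ((E ^^ j) y) = 0" if "j \<le> u" for j
      using x c that phi_E[OF c that]
      by (simp add: y_def E_power_add E_power_sc funpow_closed phi(2,3) c_def)
    then have "y \<in> H" using x by (simp add: H_def y_def)
    moreover have "x = L c \<oplus> y"
      using x by (simp add: y_def minus_eq_sc[symmetric] M.a_ac)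
        (metis M.r_neg lin_closed)
    ultimately show ?thesis using c by (auto simp: set_add_defs)
  qed
  then have "(L ` coords u) <+>\<^bsub>M\<^esub> H = carrier M"
    by (auto simp: set_add_defs H_def)
  moreover have "L ` coords u \<inter> H = {\<zero>}"
  proof -
    have "L c = \<zero>" if c: "c \<in> coords u" "L c \<in> H" for c
    proof -
      have "c j = 0" for j
      proof (cases "j \<le> u")
        case True
        then show ?thesis using phi_E[OF c(1), of "u - j"] c(2) by (simp add: H_def)
      qed (use c in \<open>auto simp: coords_def\<close>)
      then have "c = (\<lambda>_. 0)" by auto
      then show ?thesis by (simp add: lin_zero)
    qed
    moreover have "\<zero> \<in> L ` coords u" "\<zero> \<in> H"
      using submodule_borelD(2) lin_image_submodule H by auto
    ultimately show ?thesis by auto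
  qed
  ultimately show ?thesis using that H by blast
qed

text \<open>A string of maximal length exists because the nilpotency of \<open>E\<close> is bounded by \<open>d\<close>, and the
  complement from \<open>complement\<close> has to be zero.\<close>

lemma (in borel_module) indecomposable_is_M:
  assumes ind: "indecomposable_module (uq_plus q d) M"
  obtains i u where "i < d" "u < d" "is_M q d i u M"
proof -
  have nz: "carrier M \<noteq> {\<zero>}" using ind by (simp add: indecomposable_module_def)
  define m where "m = (LEAST m. \<forall>x\<in>carrier M. (E ^^ m) x = \<zero>)"
  have m: "\<forall>x\<in>carrier M. (E ^^ m) x = \<zero>"
    unfolding m_def by (rule LeastI[of _ d]) (simp add: E_power_d)
  have "m \<noteq> 0" using m nz by (cases m) auto
  then obtain u where u: "m = Suc u" by (cases m) auto
  have "\<not> (\<forall>x\<in>carrier M. (E ^^ u) x = \<zero>)"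
    using not_less_Least[of u "\<lambda>m. \<forall>x\<in>carrier M. (E ^^ m) x = \<zero>"] u by (simp add: m_def)
  then obtain x0 where x0: "x0 \<in> carrier M" "(E ^^ u) x0 \<noteq> \<zero>" by auto
  have "\<exists>x i. x \<in> carrier M \<and> i < d \<and> K x = sc (\<omega> ^ i) x \<and> (E ^^ u) x \<noteq> \<zero>"
  proof (rule ccontr)
    assume no: "\<not> ?thesis"
    have "x0 \<in> {x \<in> carrier M. (E ^^ u) x = \<zero>}"
      by (rule weight_span) (use no x0 in \<open>auto simp: E_power_add funpow_zero\<close>)
    then show False using x0 by simp
  qed
  then obtain x i where x: "x \<in> carrier M" "i < d" "K x = sc (\<omega> ^ i) x" "(E ^^ u) x \<noteq> \<zero>"
    by auto
  interpret faithful_string n d q M "\<lambda>j. (E ^^ j) x" i u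
  proof
    show "E ((E ^^ u) x) = \<zero>" using m x(1) u by simp
  qed (use x in \<open>auto simp: funpow_closed K_E_power\<close>)
  obtain H where H: "submodule H (uq_plus q d) M" "(L ` coords u) <+>\<^bsub>M\<^esub> H = carrier M"
    "L ` coords u \<inter> H = {\<zero>}"
    using complement m u by metis
  have "(E ^^ u) x \<in> L ` coords u"
    using lin_unit[of u] unit_vec_coords[of u u] by force
  then have "L ` coords u \<noteq> {\<zero>}" using x(4) by auto
  then have "H = {\<zero>}"
    using ind H lin_image_submodule unfolding indecomposable_module_def by blast
  then have "carrier M \<subseteq> L ` coords u"
    using H(2) by (auto simp: set_add_defs)
  then have "carrier M = L ` coords u" by auto
  then have "is_M q d i u M" using is_M_iff faithful_string_axioms by blast
  then show ?thesis using that x(2) u_less_d by blast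
qed

section \<open>Projectivity\<close>

lemma (in faithful_string) lin_inverse:
  assumes "c \<in> coords u"
  shows "inv_into (coords u) L (L c) = c"
  using assms lin_inj by simp

text \<open>Strings with the same length and the same lowest weight have the same matrices, so matching
  coordinates is equivariant.\<close>

lemma lin_transfer:
  assumes M: "faithful_string n d q M e i u" and surj: "carrier M = lin q d M e u ` coords u"
    and N: "string_module n d q N e' i u"
  shows "(\<lambda>x. lin q d N e' u (inv_into (coords u) (lin q d M e u) x)) \<in> module_hom (uq_plus q d) M N"
proof -
  interpret M: faithful_string n d q M e i u by (rule M)
  interpret N: string_module n d q N e' i u by (rule N)
  note inv = M.lin_inverse
  show ?thesis
  proof (rule module_hom_borelI[OF M.left_module N.left_module])
    fix x y assume "x \<in> carrier M" "y \<in> carrier M"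
    then obtain c c' where c: "c \<in> coords u" "c' \<in> coords u" "x = M.L c" "y = M.L c'"
      using surj by auto
    moreover have "(\<lambda>j. c j + c' j) \<in> coords u" using c by (auto simp: coords_def)
    ultimately show "N.L (inv_into (coords u) M.L (x \<oplus>\<^bsub>M\<^esub> y)) =
        N.L (inv_into (coords u) M.L x) \<oplus>\<^bsub>N\<^esub> N.L (inv_into (coords u) M.L y)"
      by (simp add: inv N.lin_add flip: M.lin_add)
  next
    fix a x assume "x \<in> carrier M"
    then obtain c where c: "c \<in> coords u" "x = M.L c" using surj by auto
    have 1: "(\<lambda>j. a * c j) \<in> coords u" "(\<lambda>j. M.\<omega> ^ (i + j) * c j) \<in> coords u"
      using c by (auto simp: coords_def)
    show "N.L (inv_into (coords u) M.L (M.sc a x)) = N.sc a (N.L (inv_into (coords u) M.L x))"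
      using c 1 by (simp add: inv N.lin_scale flip: M.lin_scale)
    show "N.L (inv_into (coords u) M.L (M.E x)) = N.E (N.L (inv_into (coords u) M.L x))"
      using c by (simp add: inv N.lin_E M.lin_E M.raise_op_coords)
    show "N.L (inv_into (coords u) M.L (M.K x)) = N.K (N.L (inv_into (coords u) M.L x))"
      using c 1 by (simp add: inv N.lin_K M.lin_K)
  qed auto
qed

text \<open>The condition on \<open>u\<close> makes the string that starts at the lifted vector \<open>y\<close> close up: \<open>E\<^sup>d y = 0\<close>
  holds automatically, whereas a shorter string would impose a relation on \<open>y\<close>.\<close>

lemma (in faithful_string) projective:
  assumes surj: "carrier M = L ` coords u" and u: "u = d - 1"
  shows "projective_module TYPE('x) TYPE('y) (uq_plus q d) M"
  unfolding projective_module_def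
proof (intro conjI allI impI left_module)
  fix N :: "(uq_elem, 'x) module" and B :: "(uq_elem, 'y) module" and g f
  assume "left_module (uq_plus q d) N \<and> left_module (uq_plus q d) B \<and>
    g \<in> module_hom (uq_plus q d) N B \<and> g ` carrier N = carrier B \<and> f \<in> module_hom (uq_plus q d) M B"
  then have N: "left_module (uq_plus q d) N" and B: "left_module (uq_plus q d) B"
    and g: "g \<in> module_hom (uq_plus q d) N B" "g ` carrier N = carrier B"
    and f: "f \<in> module_hom (uq_plus q d) M B" by auto
  interpret N: borel_module n d q N
    using N by (intro borel_module.intro borel_module_axioms.intro small_quantum_axioms)
      (auto simp: left_module_def)
  interpret B: borel_module n d q B
    using B by (intro borel_module.intro borel_module_axioms.intro small_quantum_axioms)
      (auto simp: left_module_def)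
  have fD: "f x \<in> carrier B" "a \<in> borel_alg q d \<Longrightarrow> f (act a x) = B.act a (f x)"
    if "x \<in> carrier M" for x a
    using f that by (auto simp: module_hom_def carrier_uq_plus)
  have f_add: "f (x \<oplus> y) = f x \<oplus>\<^bsub>B\<^esub> f y" if "x \<in> carrier M" "y \<in> carrier M" for x y
    using f that by (auto simp: module_hom_def)
  have gD: "g x \<in> carrier B" "a \<in> borel_alg q d \<Longrightarrow> g (N.act a x) = B.act a (g x)"
    if "x \<in> carrier N" for x a
    using g that by (auto simp: module_hom_def carrier_uq_plus)
  have g_add: "g (x \<oplus>\<^bsub>N\<^esub> y) = g x \<oplus>\<^bsub>B\<^esub> g y" if "x \<in> carrier N" "y \<in> carrier N" for x y
    using g that by (auto simp: module_hom_def)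
  have e0: "e 0 \<in> carrier M" by (simp add: e_closed)
  then have "f (e 0) \<in> g ` carrier N" using fD(1)[OF e0] g(2) by simp
  then obtain y0 where y0: "y0 \<in> carrier N" "g y0 = f (e 0)" by auto
  \<comment> \<open>\<open>y0\<close> is an arbitrary preimage of \<open>f (e 0)\<close>; its component of weight \<open>\<omega>\<^sup>i\<close> is still a preimage\<close>
  define y where "y = N.act (weight_proj i) y0"
  have y: "y \<in> carrier N" "N.K y = N.sc (\<omega> ^ i) y"
    using y0 N.K_weight_proj by (auto simp: y_def)
  have "B.K (f (e 0)) = B.sc (\<omega> ^ i) (f (e 0))"
    using K_e[of 0] fD(2)[OF e0] by (metis add_0_right borel_alg_gens(1,3) le0)
  then have "B.act (weight_proj i) (f (e 0)) = f (e 0)"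
    using fD(1)[OF e0] by (intro B.weight_proj_weight) auto
  then have gy: "g y = f (e 0)"
    using y0 gD(2)[OF y0(1)] by (simp add: y_def)
  interpret NS: string_module n d q N "\<lambda>j. (N.E ^^ j) y" i u
  proof
    have "Suc u = d" using u d_pos by simp
    then show "N.E ((N.E ^^ u) y) = \<zero>\<^bsub>N\<^esub>" using N.E_power_d[OF y(1)] by (metis comp_apply funpow.simps(2))
  qed (use y in \<open>auto simp: N.funpow_closed N.K_E_power\<close>)
  let ?h = "\<lambda>x. NS.L (inv_into (coords u) L x)"
  have g_e: "g ((N.E ^^ k) y) = f (e k)" if "k \<le> u" for k
    using that
  proof (induction k)
    case (Suc k)
    then have "g ((N.E ^^ Suc k) y) = B.E (f (e k))"
      using gD(2)[of "(N.E ^^ k) y" "gen_var Gen_E"] y by (simp add: N.funpow_closed)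
    also have "\<dots> = f (e (Suc k))"
      using Suc.prems fD(2)[of "e k" "gen_var Gen_E"] E_e[of k] e_closed[of k] by simp
    finally show ?case .
  qed (simp add: gy)
  have "g (NS.L c) = f (L c)" if "c \<in> coords u" for c
  proof (rule coords_linear_ext[where ?T1.0 = "\<lambda>c. g (NS.L c)" and ?T2.0 = "\<lambda>c. f (L c)"
        and pl = "(\<oplus>\<^bsub>B\<^esub>)" and ml = B.sc])
    fix k assume "k \<le> u"
    then show "g (NS.L (unit_vec k)) = f (L (unit_vec k))"
      by (simp add: NS.lin_unit lin_unit g_e)
  qed (use that in \<open>auto simp: NS.lin_add lin_add NS.lin_scale lin_scale fD gD f_add g_add\<close>)
  then have "\<forall>x\<in>carrier M. g (?h x) = f x"
    unfolding surj by (auto simp: lin_inverse)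
  moreover have "?h \<in> module_hom (uq_plus q d) M N"
    by (rule lin_transfer[OF faithful_string_axioms surj NS.string_module_axioms])
  ultimately show "\<exists>h\<in>module_hom (uq_plus q d) M N. \<forall>x\<in>carrier M. g (h x) = f x"
    by (intro bexI[of _ ?h])
qed

section \<open>The action of F on a string\<close>

context small_quantum
begin

text \<open>The coefficient of \<open>F (e j) = f_coef i j * e (j - 1)\<close>, as it results from summing the
  commutator relation over the lower part of the string.\<close>

definition f_coef :: "nat \<Rightarrow> nat \<Rightarrow> complex" where
  "f_coef i j = - (\<Sum>l<j. bracket (i + l))"

lemma f_coef_0 [simp]: "f_coef i 0 = 0"
  by (simp add: f_coef_def)

lemma f_coef_Suc: "f_coef i (Suc j) = f_coef i j - bracket (i + j)"
  by (simp add: f_coef_def)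

text \<open>The defining sum consists of two geometric series.\<close>

lemma f_coef_closed_form:
  "f_coef i (Suc j) = - ((\<omega> ^ Suc j - 1) * (\<omega> ^ (2 * i + j) - 1)) /
     ((\<omega> - 1) * (q - inverse q) * \<omega> ^ (i + j))"
proof (induction j)
  case 0
  define Q where "Q = q - inverse q"
  define a c where "a = \<omega> ^ i" and "c = \<omega>"
  have nz: "a \<noteq> 0" "c - 1 \<noteq> 0" "Q \<noteq> 0"
    using q_minus_inverse_nonzero by (auto simp: a_def c_def Q_def)
  have "f_coef i (Suc 0) = - ((a - inverse a) / Q)"
    by (simp add: f_coef_def bracket_def a_def Q_def)
  also have "\<dots> = - ((c - 1) * (a * a - 1)) / ((c - 1) * Q * a)"
    using nz by (simp add: divide_simps) algebra
  finally show ?case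
    unfolding Q_def by (simp add: a_def c_def power_add mult_2)
next
  case (Suc j)
  define Q where "Q = q - inverse q"
  define a b c where "a = \<omega> ^ i" and "b = \<omega> ^ j" and "c = \<omega>"
  have nz: "a \<noteq> 0" "b \<noteq> 0" "c \<noteq> 0" "c - 1 \<noteq> 0" "Q \<noteq> 0"
    using q_minus_inverse_nonzero by (auto simp: a_def b_def c_def Q_def)
  have "f_coef i (Suc (Suc j)) = f_coef i (Suc j) - bracket (i + Suc j)"
    by (rule f_coef_Suc)
  also have "\<dots> = - ((c * b - 1) * (a * a * b - 1)) / ((c - 1) * Q * (a * b))
      - (a * (c * b) - inverse (a * (c * b))) / Q"
    unfolding Suc.IH bracket_def Q_def[symmetric]
    by (simp add: a_def b_def c_def power_add mult_2_right mult.commute mult.left_commute)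
  also have "\<dots> = - ((c * (c * b) - 1) * (a * a * (c * b) - 1)) / ((c - 1) * Q * (a * (c * b)))"
    using nz by (simp add: divide_simps) (simp add: algebra_simps)
  finally show ?case
    unfolding Q_def by (simp add: a_def b_def c_def power_add mult_2_right mult.commute mult.left_commute)
qed

lemma f_coef_eq_0_iff: "f_coef i (Suc j) = 0 \<longleftrightarrow> d dvd Suc j \<or> d dvd 2 * i + j"
proof -
  have "\<omega> - 1 \<noteq> 0" by simp
  then have "f_coef i (Suc j) = 0 \<longleftrightarrow> \<omega> ^ Suc j = 1 \<or> \<omega> ^ (2 * i + j) = 1"
    unfolding f_coef_closed_form using q_minus_inverse_nonzero by simp
  then show ?thesis by (simp only: omega_pow_eq_1_iff)
qed

text \<open>The matrix of \<open>F\<close> in string coordinates. The parameter \<open>\<kappa>\<close>, the coefficient of \<open>F (e 0)\<close> at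
  \<open>e u\<close>, has a meaning only for strings of full length \<open>d\<close>.\<close>

definition lower_op :: "nat \<Rightarrow> nat \<Rightarrow> complex \<Rightarrow> (nat \<Rightarrow> complex) \<Rightarrow> nat \<Rightarrow> complex" where
  "lower_op i u \<kappa> c j =
     (if j < u then f_coef i (Suc j) * c (Suc j) else if j = u \<and> Suc u = d then \<kappa> * c 0 else 0)"

text \<open>The conditions on \<open>i\<close>, \<open>u\<close> and \<open>\<kappa>\<close> under which \<open>lower_op i u \<kappa>\<close> satisfies the relations of the
  quantum group: the commutator relation at the top vector, and \<open>F\<^sup>d = 0\<close>.\<close>

definition admissible :: "nat \<Rightarrow> nat \<Rightarrow> complex \<Rightarrow> bool" where
  "admissible i u \<kappa> \<longleftrightarrow> u < d \<and> f_coef i (Suc u) = 0 \<and>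
     (Suc u = d \<longrightarrow> \<kappa> = 0 \<or> (\<exists>m. 0 < m \<and> m < d \<and> f_coef i m = 0))"

text \<open>With the indices read modulo \<open>d\<close>, the operator \<open>F\<close> is a cyclic shift scaled by these
  coefficients, for full and for shorter strings alike. Its \<open>d\<close>-th power is then multiplication by
  the product of the coefficients.\<close>

definition cyclic_coef :: "nat \<Rightarrow> nat \<Rightarrow> complex \<Rightarrow> nat \<Rightarrow> complex" where
  "cyclic_coef i u \<kappa> j =
     (if j < u then f_coef i (Suc j) else if j = u \<and> Suc u = d then \<kappa> else 0)"

lemma lower_op_coords: "lower_op i u \<kappa> c \<in> coords u"
  by (auto simp: lower_op_def coords_def)

lemma lower_op_cyclic:
  assumes "u < d" "j < d"
  shows "lower_op i u \<kappa> c j = cyclic_coef i u \<kappa> j * c (Suc j mod d)"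
  using assms by (auto simp: lower_op_def cyclic_coef_def)

lemma lower_op_funpow:
  assumes u: "u < d" and j: "j < d"
  shows "(lower_op i u \<kappa> ^^ k) c j =
    (\<Prod>l<k. cyclic_coef i u \<kappa> ((j + l) mod d)) * c ((j + k) mod d)"
  using j
proof (induction k arbitrary: j)
  case (Suc k)
  have "Suc j mod d < d" using d_pos by simp
  have "(lower_op i u \<kappa> ^^ Suc k) c j =
      cyclic_coef i u \<kappa> j * (lower_op i u \<kappa> ^^ k) c (Suc j mod d)"
    using Suc.prems u by (simp add: lower_op_cyclic)
  also have "\<dots> = cyclic_coef i u \<kappa> j *
      ((\<Prod>l<k. cyclic_coef i u \<kappa> ((j + Suc l) mod d)) * c ((j + Suc k) mod d))"
    using Suc.IH[OF \<open>Suc j mod d < d\<close>] by (simp add: mod_simps)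
  also have "\<dots> = (\<Prod>l<Suc k. cyclic_coef i u \<kappa> ((j + l) mod d)) * c ((j + Suc k) mod d)"
    using Suc.prems unfolding prod.lessThan_Suc_shift by (simp add: mult.assoc)
  finally show ?case .
qed simp

lemma cyclic_coef_zero_iff:
  assumes u: "u < d"
  shows "(\<exists>l<d. cyclic_coef i u \<kappa> l = 0) \<longleftrightarrow>
    (Suc u = d \<longrightarrow> \<kappa> = 0 \<or> (\<exists>m. 0 < m \<and> m < d \<and> f_coef i m = 0))"
proof (cases "Suc u = d")
  case False
  then have "cyclic_coef i u \<kappa> u = 0" by (simp add: cyclic_coef_def)
  then show ?thesis using False u by auto
next
  case True
  have "(\<exists>l<d. cyclic_coef i u \<kappa> l = 0) \<longleftrightarrow>
      (\<exists>l<u. f_coef i (Suc l) = 0) \<or> \<kappa> = 0"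
    using True by (auto simp: cyclic_coef_def less_Suc_eq)
  also have "(\<exists>l<u. f_coef i (Suc l) = 0) \<longleftrightarrow> (\<exists>m. 0 < m \<and> m < d \<and> f_coef i m = 0)"
    using True by (metis Suc_less_eq gr0_conv_Suc zero_less_Suc)
  finally show ?thesis using True by auto
qed

lemma lower_op_power_d_zero:
  assumes "admissible i u \<kappa>" "c \<in> coords u"
  shows "(lower_op i u \<kappa> ^^ d) c = (\<lambda>_. 0)"
proof
  fix j
  have u: "u < d" using assms by (simp add: admissible_def)
  obtain m where m: "m < d" "cyclic_coef i u \<kappa> m = 0"
    using assms cyclic_coef_zero_iff[OF u, of i \<kappa>] by (auto simp: admissible_def)
  show "(lower_op i u \<kappa> ^^ d) c j = 0"
  proof (cases "j < d")
    case True
    \<comment> \<open>the vanishing factor at \<open>m\<close> is met after \<open>m - j\<close> steps around the cycle\<close>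
    define l where "l = (m + (d - j)) mod d"
    have "(j + l) mod d = (j + (m + (d - j))) mod d"
      unfolding l_def by (simp add: mod_simps)
    also have "\<dots> = m" using True m by (simp add: algebra_simps)
    finally have "cyclic_coef i u \<kappa> ((j + l) mod d) = 0" using m by simp
    moreover have "l < d" using d_pos by (simp add: l_def)
    ultimately have "(\<Prod>l<d. cyclic_coef i u \<kappa> ((j + l) mod d)) = 0" by auto
    then show ?thesis using lower_op_funpow[OF u True] by simp
  next
    case False
    obtain d' where "d = Suc d'" using d_pos by (cases d) auto
    then have "(lower_op i u \<kappa> ^^ d) c = lower_op i u \<kappa> ((lower_op i u \<kappa> ^^ d') c)" by simp
    then show ?thesis using False u by (simp add: lower_op_def)
  qed
qed

end

text \<open>A module over the quantum group whose restriction to the Borel part is a string.\<close>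

locale uq_string = uq_module n d q M + faithful_string n d q M e i u
  for n d q and M :: "(uq_elem, 'v) module" (structure) and e i u +
  assumes surj: "carrier M = L ` coords u"
begin

text \<open>Comparing weights: \<open>F (e k)\<close> has weight \<open>\<omega>\<^sup>i\<^sup>+\<^sup>k\<^sup>-\<^sup>1\<close>, which occurs in the string only at \<open>e (k - 1)\<close>,
  or, for \<open>k = 0\<close>, at the top of a string of length \<open>d\<close>.\<close>

lemma F_e_weight:
  assumes k: "k \<le> u"
  obtains a where "a \<in> coords u" "F (e k) = L a"
    "\<And>j. a j \<noteq> 0 \<Longrightarrow> Suc j = k \<or> (k = 0 \<and> j = u \<and> Suc u = d)"
proof -
  have "F (e k) \<in> carrier M" using e_closed[OF k] by simp
  then obtain a where a: "a \<in> coords u" "F (e k) = L a" using surj by auto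
  have "L (\<lambda>j. \<omega> ^ (i + j) * a j) = K (F (e k))"
    using a by (simp add: lin_K)
  also have "\<dots> = sc (inverse \<omega> * \<omega> ^ (i + k)) (F (e k))"
    using e_closed[OF k] K_e[OF k] by (simp add: K_F F_sc sc_sc)
  also have "\<dots> = L (\<lambda>j. inverse \<omega> * \<omega> ^ (i + k) * a j)"
    unfolding a(2) by (rule lin_scale[symmetric])
  finally have eq: "(\<lambda>j. \<omega> ^ (i + j) * a j) = (\<lambda>j. inverse \<omega> * \<omega> ^ (i + k) * a j)"
    by (rule inj_onD[OF lin_inj]) (use a in \<open>auto simp: coords_def\<close>)
  have "Suc j = k \<or> (k = 0 \<and> j = u \<and> Suc u = d)" if "a j \<noteq> 0" for j
  proof -
    have j: "j \<le> u"
      using that a(1) unfolding coords_def by (metis (mono_tags, lifting) mem_Collect_eq not_le)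
    have "\<omega> ^ (i + j) = inverse \<omega> * \<omega> ^ (i + k)"
      using fun_cong[OF eq, of j] that by simp
    then have "\<omega> ^ Suc j = \<omega> ^ k" by (simp add: power_add field_simps)
    then have "Suc j mod d = k mod d" by (simp only: omega_pow_eq_iff)
    moreover have "k < d" "j < d" using k j u_less_d by auto
    ultimately show ?thesis using j u_less_d by (cases "Suc j = d") auto
  qed
  then show ?thesis using that a by blast
qed

text \<open>The coefficients follow by induction from the commutator relation applied to \<open>e k\<close>; the relation
  for the top vector gives the last claim, because \<open>E (e u) = 0\<close>.\<close>

lemma F_e:
  obtains \<kappa> where "F (e 0) = (if Suc u = d then sc \<kappa> (e u) else \<zero>)"
    "\<And>k. k < u \<Longrightarrow> F (e (Suc k)) = sc (f_coef i (Suc k)) (e k)" "f_coef i (Suc u) = 0"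
proof -
  obtain a where a: "a \<in> coords u" "F (e 0) = L a" "\<And>j. a j \<noteq> 0 \<Longrightarrow> j = u \<and> Suc u = d"
    using F_e_weight[of 0] by auto
  have F0: "F (e 0) = (if Suc u = d then sc (a u) (e u) else \<zero>)"
  proof (cases "Suc u = d")
    case True
    have "L a = L (\<lambda>j. a u * unit_vec u j)"
      using a(3) by (intro lin_cong) (auto simp: unit_vec_def)
    then show ?thesis using True a(2) by (simp add: lin_scale lin_unit)
  next
    case False
    then have "a = (\<lambda>_. 0)" using a(3) by auto
    then show ?thesis using False a(2) by (simp add: lin_zero)
  qed
  have EF0: "E (F (e 0)) = \<zero>"
    using F0 e_closed[of u] by (auto simp: E_sc E_e_top)
  \<comment> \<open>one step of the commutator relation along the string\<close>
  have next_coef: "b = f_coef i (Suc k)"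
    if "k \<le> u" "E (F (e k)) = sc (f_coef i k) (e k)" "F (E (e k)) = sc b (e k)" for b k
  proof -
    have ek: "e k \<in> carrier M" "e k \<noteq> \<zero>"
    proof -
      show "e k \<in> carrier M" using that e_closed by simp
      have "L (unit_vec k) \<noteq> \<zero>"
        using lin_eq_zero_iff[OF unit_vec_coords[OF that(1)]] by (auto simp: unit_vec_def fun_eq_iff)
      then show "e k \<noteq> \<zero>" using that by (simp add: lin_unit)
    qed
    have "sc (f_coef i k) (e k) = sc b (e k) \<oplus> sc (bracket (i + k)) (e k)"
      using E_F[OF ek(1) K_e[OF that(1)]] that by simp
    then have "sc (f_coef i k) (e k) = sc (b + bracket (i + k)) (e k)"
      using ek by (simp add: sc_add)
    then have "sc (f_coef i k) (e k) \<oplus> sc (- (b + bracket (i + k))) (e k) = \<zero>"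
      using ek sc_add[of "e k" "b + bracket (i + k)" "- (b + bracket (i + k))"]
      by (simp add: act_scalar_0)
    then have "sc (f_coef i k + - (b + bracket (i + k))) (e k) = \<zero>"
      using ek(1) by (subst sc_add) auto
    then have "sc (f_coef i k - (b + bracket (i + k))) (e k) = \<zero>"
      by (simp only: add_uminus_conv_diff)
    then show ?thesis using ek by (simp add: sc_eq_zero_iff f_coef_Suc)
  qed
  have "E (F (e k)) = sc (f_coef i k) (e k) \<and> (k < u \<longrightarrow> F (e (Suc k)) = sc (f_coef i (Suc k)) (e k))"
    if "k \<le> u" for k
    using that
  proof (induction k)
    case 0
    have EF: "E (F (e 0)) = sc (f_coef i 0) (e 0)" using EF0 e_closed[of 0] by (simp add: act_scalar_0)
    have "F (e (Suc 0)) = sc (f_coef i (Suc 0)) (e 0)" if u: "0 < u"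
    proof -
      obtain b where b: "b \<in> coords u" "F (e (Suc 0)) = L b" "\<And>j. b j \<noteq> 0 \<Longrightarrow> j = 0"
        using F_e_weight[of "Suc 0"] u by auto
      have "L b = L (\<lambda>j. b 0 * unit_vec 0 j)"
        using b(3) by (intro lin_cong) (auto simp: unit_vec_def)
      then have Fb: "F (e (Suc 0)) = sc (b 0) (e 0)" using b(2) by (simp add: lin_scale lin_unit)
      then have "b 0 = f_coef i (Suc 0)" using next_coef[of 0 "b 0"] EF E_e[of 0] u by simp
      then show ?thesis using Fb by simp
    qed
    then show ?case using EF by simp
  next
    case (Suc k)
    then have Fk: "F (e (Suc k)) = sc (f_coef i (Suc k)) (e k)" by simp
    then have EF: "E (F (e (Suc k))) = sc (f_coef i (Suc k)) (e (Suc k))"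
      using Suc.prems e_closed[of k] E_e[of k] by (simp add: E_sc)
    have "F (e (Suc (Suc k))) = sc (f_coef i (Suc (Suc k))) (e (Suc k))" if u: "Suc k < u"
    proof -
      obtain b where b: "b \<in> coords u" "F (e (Suc (Suc k))) = L b" "\<And>j. b j \<noteq> 0 \<Longrightarrow> j = Suc k"
        using F_e_weight[of "Suc (Suc k)"] u by auto
      have "L b = L (\<lambda>j. b (Suc k) * unit_vec (Suc k) j)"
        using b(3) by (intro lin_cong) (auto simp: unit_vec_def)
      then have Fb: "F (e (Suc (Suc k))) = sc (b (Suc k)) (e (Suc k))"
        using b(2) u by (simp add: lin_scale lin_unit)
      then have "b (Suc k) = f_coef i (Suc (Suc k))"
        using next_coef[of "Suc k" "b (Suc k)"] EF E_e[of "Suc k"] u by simp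
      then show ?thesis using Fb by simp
    qed
    then show ?case using EF by simp
  qed
  note Fk = this
  have "0 = f_coef i (Suc u)"
    using Fk[of u] e_closed[of u] by (intro next_coef) (auto simp: E_e_top act_scalar_0)
  then show ?thesis using that F0 Fk by auto
qed

text \<open>Every structure of \<open>uq\<close>-module on a string has the shape \<open>lower_op\<close>. The remaining condition
  comes from evaluating \<open>F\<^sup>d = 0\<close> at \<open>e 0\<close>.\<close>

lemma F_structure:
  obtains \<kappa> where "\<And>c. c \<in> coords u \<Longrightarrow> F (L c) = L (lower_op i u \<kappa> c)" "admissible i u \<kappa>"
proof -
  obtain \<kappa> where k: "F (e 0) = (if Suc u = d then sc \<kappa> (e u) else \<zero>)"
    "\<And>k. k < u \<Longrightarrow> F (e (Suc k)) = sc (f_coef i (Suc k)) (e k)" "f_coef i (Suc u) = 0"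
    using F_e by blast
  have F_L: "F (L c) = L (lower_op i u \<kappa> c)" if "c \<in> coords u" for c
  proof (rule lin_eqI[where T = "\<lambda>c. F (L c)" and t = "lower_op i u \<kappa>"])
    fix m assume m: "m \<le> u"
    show "F (L (unit_vec m)) = L (lower_op i u \<kappa> (unit_vec m))"
    proof (cases m)
      case 0
      have "L (lower_op i u \<kappa> (unit_vec 0)) = L (\<lambda>j. (if Suc u = d then \<kappa> else 0) * unit_vec u j)"
        by (intro lin_cong) (auto simp: lower_op_def unit_vec_def)
      then show ?thesis using 0 k(1) e_closed[of u]
        by (auto simp: lin_unit lin_scale act_scalar_0)
    next
      case (Suc m')
      have "L (lower_op i u \<kappa> (unit_vec m)) = L (\<lambda>j. f_coef i m * unit_vec m' j)"
        using Suc m by (intro lin_cong) (auto simp: lower_op_def unit_vec_def)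
      then show ?thesis using Suc k(2)[of m'] m by (simp add: lin_unit lin_scale)
    qed
  qed (use that in \<open>auto simp: lin_add lin_scale uact_distrib F_sc algebra_simps lower_op_def\<close>)
  have F_pow: "(F ^^ m) (L c) = L ((lower_op i u \<kappa> ^^ m) c)" if "c \<in> coords u" for m c
  proof (induction m)
    case (Suc m)
    have "(lower_op i u \<kappa> ^^ m) c \<in> coords u"
      using that lower_op_coords by (cases m) auto
    then show ?case using Suc by (simp add: F_L)
  qed simp
  have "unit_vec 0 \<in> coords u" by (simp add: unit_vec_coords)
  then have "L ((lower_op i u \<kappa> ^^ d) (unit_vec 0)) = \<zero>"
    using F_pow[of "unit_vec 0" d] F_power_d[of "L (unit_vec 0)"] by simp
  moreover have "(lower_op i u \<kappa> ^^ d) (unit_vec 0) \<in> coords u"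
    using d_pos lower_op_coords by (cases d) auto
  ultimately have "(lower_op i u \<kappa> ^^ d) (unit_vec 0) 0 = 0"
    using lin_eq_zero_iff by metis
  then have "(\<Prod>l<d. cyclic_coef i u \<kappa> l) = 0"
    using lower_op_funpow[OF u_less_d d_pos(1), where i = i and \<kappa> = \<kappa> and k = d and c = "unit_vec 0"] by (simp add: unit_vec_def)
  then have "admissible i u \<kappa>"
    using cyclic_coef_zero_iff[OF u_less_d, of i \<kappa>] k(3) u_less_d by (auto simp: admissible_def)
  then show ?thesis using that F_L by blast
qed

end

section \<open>Evaluating the free algebra at operators\<close>

text \<open>Linear operators for the three generators, with an invariant subspace \<open>V\<close>. The relations will hold
  on \<open>V\<close> only; for the matrices of a string, the commutator relation fails at coordinates
  beyond \<open>u\<close>.\<close>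

locale operators =
  fixes T :: "gen \<Rightarrow> (nat \<Rightarrow> complex) \<Rightarrow> nat \<Rightarrow> complex" and V :: "(nat \<Rightarrow> complex) set"
  assumes T_add: "T g (\<lambda>j. c j + c' j) = (\<lambda>j. T g c j + T g c' j)"
    and T_scale: "T g (\<lambda>j. a * c j) = (\<lambda>j. a * T g c j)"
    and T_closed: "c \<in> V \<Longrightarrow> T g c \<in> V"
    and V_zero: "(\<lambda>_. 0) \<in> V" and V_add: "c \<in> V \<Longrightarrow> c' \<in> V \<Longrightarrow> (\<lambda>j. c j + c' j) \<in> V"
    and V_scale: "c \<in> V \<Longrightarrow> (\<lambda>j. a * c j) \<in> V"
begin

definition word :: "gen list \<Rightarrow> (nat \<Rightarrow> complex) \<Rightarrow> nat \<Rightarrow> complex" where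
  "word w = foldr T w"

text \<open>The action of the free algebra by its universal property.\<close>

definition eval_at :: "free_alg \<Rightarrow> (nat \<Rightarrow> complex) \<Rightarrow> nat \<Rightarrow> complex" where
  "eval_at a c j = (\<Sum>w\<in>Poly_Mapping.keys a. Poly_Mapping.lookup a w * word w c j)"

lemma word_append: "word (v @ w) c = word v (word w c)"
  by (simp add: word_def)

lemma word_add: "word w (\<lambda>j. c j + c' j) = (\<lambda>j. word w c j + word w c' j)"
  by (induction w) (simp_all add: word_def T_add)

lemma word_scale: "word w (\<lambda>j. a * c j) = (\<lambda>j. a * word w c j)"
  by (induction w) (simp_all add: word_def T_scale)

lemma eval_superset:
  assumes "finite S" "Poly_Mapping.keys a \<subseteq> S"
  shows "eval_at a c j = (\<Sum>w\<in>S. Poly_Mapping.lookup a w * word w c j)"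
  unfolding eval_at_def using assms by (intro sum.mono_neutral_left) (auto simp: in_keys_iff)

lemma eval_add: "eval_at (a + b) c = (\<lambda>j. eval_at a c j + eval_at b c j)"
proof
  fix j
  let ?S = "Poly_Mapping.keys a \<union> Poly_Mapping.keys b"
  have "Poly_Mapping.keys (a + b) \<subseteq> ?S" by (rule keys_add)
  then show "eval_at (a + b) c j = eval_at a c j + eval_at b c j"
    using eval_superset[of ?S "a + b"] eval_superset[of ?S a] eval_superset[of ?S b]
    by (simp add: lookup_add algebra_simps sum.distrib)
qed

lemma eval_single: "eval_at (Poly_Mapping.single w s) c = (\<lambda>j. s * word w c j)"
  using eval_superset[of "{w}" "Poly_Mapping.single w s" c] by (auto simp: fun_eq_iff)

lemma eval_distrib: "eval_at a (\<lambda>j. c j + c' j) = (\<lambda>j. eval_at a c j + eval_at a c' j)"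
  by (auto simp: eval_at_def word_add algebra_simps sum.distrib fun_eq_iff)

lemma eval_scale: "eval_at a (\<lambda>j. s * c j) = (\<lambda>j. s * eval_at a c j)"
  by (auto simp: eval_at_def word_scale sum_distrib_left algebra_simps fun_eq_iff)

lemma eval_mult: "eval_at (a * b) c = eval_at a (eval_at b c)"
proof (induction a rule: free_alg_single_induct)
  case (single w s)
  show ?case
  proof (induction b rule: free_alg_single_induct)
    case (single v t)
    then show ?case
      by (simp add: mult_single plus_list_def eval_single word_append word_scale algebra_simps)
  next
    case (add x y)
    then show ?case by (simp add: distrib_left eval_add eval_distrib)
  qed
next
  case (add x y)
  then show ?case by (simp add: distrib_right eval_add)
qed

lemma eval_scalar: "eval_at (scalar s) c = (\<lambda>j. s * c j)"
  by (simp add: scalar_def eval_single word_def)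

lemma eval_gen: "eval_at (gen_var g) c = T g c"
  by (simp add: gen_var_def eval_single word_def)

lemma eval_one: "eval_at 1 c = c"
  using eval_scalar[of 1 c] by (simp add: scalar_simps)

lemma eval_zero: "eval_at 0 c = (\<lambda>_. 0)"
  by (auto simp: eval_at_def)

lemma eval_power: "eval_at (a ^ k) c = (eval_at a ^^ k) c"
  by (induction k arbitrary: c) (simp_all add: eval_one eval_mult)

lemma eval_diff: "eval_at (a - b) c = (\<lambda>j. eval_at a c j - eval_at b c j)"
  using eval_add[of "a - b" b c] by (auto simp: fun_eq_iff)

lemma eval_closed: "c \<in> V \<Longrightarrow> eval_at a c \<in> V"
proof (induction a arbitrary: c rule: free_alg_induct)
  case (scalar s)
  then show ?case by (simp add: eval_scalar V_scale)
next
  case (gen g)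
  then show ?case by (simp add: eval_gen T_closed)
next
  case (add x y)
  then show ?case by (simp add: eval_add V_add)
next
  case (mult x y)
  then show ?case by (simp add: eval_mult)
qed

lemma eval_zero_vec: "eval_at a (\<lambda>_. 0) = (\<lambda>_. 0)"
  using eval_scale[of a 0 "\<lambda>_. 0"] by simp

definition annihilator :: "free_alg set" where
  "annihilator = {a. \<forall>c\<in>V. eval_at a c = (\<lambda>_. 0)}"

lemma ideal_annihilator: "ideal annihilator free_ring"
proof -
  interpret ring free_ring by (rule ring_free_ring)
  have "- a \<in> annihilator" if "a \<in> annihilator" for a
    using that eval_diff[of 0 a] by (auto simp: annihilator_def eval_zero)
  moreover have "\<ominus>\<^bsub>free_ring\<^esub> a = - a" for a
    by (rule minus_equality) auto
  ultimately have "subgroup annihilator (add_monoid free_ring)"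
    by (intro add.subgroupI)
      (auto simp: annihilator_def eval_add eval_zero a_inv_def[symmetric] intro: exI[of _ 0])
  then show ?thesis
    by (intro idealI ring_free_ring)
      (auto simp: annihilator_def eval_mult eval_zero_vec eval_closed)
qed

text \<open>Operators that satisfy the relations on \<open>V\<close> turn \<open>V\<close> into a module over the quantum group, as the
  elements acting by zero form a two-sided ideal. Elements of the quotient act through
  representatives.\<close>

lemma uq_action:
  assumes rel: "uq_relations q d \<subseteq> annihilator"
  obtains s where "\<And>a c. c \<in> V \<Longrightarrow> s (uq_class q d a) c = eval_at a c"
    "left_module (uq q d) \<lparr>carrier = V, monoid.mult = undefined, one = undefined, zero = (\<lambda>_. 0),
       add = (\<lambda>c c' j. c j + c' j), smult = s\<rparr>"
proof -
  have sub: "uq_ideal q d \<subseteq> annihilator"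
    unfolding uq_ideal_def by (rule ring.genideal_minimal[OF ring_free_ring ideal_annihilator rel])
  define s where "s A c = eval_at (SOME a. A = uq_class q d a) c" for A c
  have s: "s (uq_class q d a) c = eval_at a c" if "c \<in> V" for a c
  proof -
    define b where "b = (SOME b. uq_class q d a = uq_class q d b)"
    have "uq_class q d a = uq_class q d b" unfolding b_def by (rule someI_ex) blast
    then have "a - b \<in> annihilator" using sub uq_class_eqD by blast
    then have "eval_at a c = eval_at b c"
      using that by (auto simp: annihilator_def eval_diff fun_eq_iff)
    then show ?thesis by (simp add: s_def b_def)
  qed
  let ?M = "\<lparr>carrier = V, monoid.mult = undefined, one = undefined, zero = (\<lambda>_. 0),
       add = (\<lambda>c c' j. c j + c' j), smult = s\<rparr> :: (uq_elem, nat \<Rightarrow> complex) module"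
  have ab: "abelian_group ?M"
  proof (rule abelian_groupI)
    fix c assume "c \<in> carrier ?M"
    then show "\<exists>y\<in>carrier ?M. y \<oplus>\<^bsub>?M\<^esub> c = \<zero>\<^bsub>?M\<^esub>"
      using V_scale[of c "-1"] by (intro bexI[of _ "\<lambda>j. - 1 * c j"]) auto
  qed (auto simp: V_zero V_add algebra_simps)
  have "left_module (uq q d) ?M"
  proof (rule left_module.intro[OF ring_uq ab])
    show "left_module_axioms (uq q d) ?M"
      unfolding left_module_axioms_def
      by (auto simp: carrier_uq uq_class_simps s eval_closed eval_add eval_distrib eval_mult eval_one V_add)
  qed
  then show ?thesis using that s by blast
qed

end

section \<open>Standard modules\<close>

definition std_module :: "nat \<Rightarrow> (uq_elem \<Rightarrow> (nat \<Rightarrow> complex) \<Rightarrow> nat \<Rightarrow> complex) \<Rightarrow>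
    (uq_elem, nat \<Rightarrow> complex) module" where
  "std_module u s = \<lparr>carrier = coords u, monoid.mult = undefined, one = undefined, zero = (\<lambda>_. 0),
     add = (\<lambda>c c' j. c j + c' j), smult = s\<rparr>"

text \<open>All relations are checked coordinatewise. The conditions in \<open>admissible\<close> are used for the
  commutator relation at \<open>j = u\<close> and for \<open>F\<^sup>d = 0\<close>; the wrap-around term with \<open>\<kappa>\<close> respects weights
  because \<open>\<omega>\<^sup>d = 1\<close>.\<close>

lemma (in small_quantum) std_action:
  assumes adm: "admissible i u \<kappa>"
  obtains s where "left_module (uq q d) (std_module u s)"
    "\<And>a c. c \<in> coords u \<Longrightarrow> s (uq_scalar q d a) c = (\<lambda>j. a * c j)"
    "\<And>c. c \<in> coords u \<Longrightarrow> s (uq_E q d) c = raise_op u c"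
    "\<And>c. c \<in> coords u \<Longrightarrow> s (uq_K q d) c = (\<lambda>j. \<omega> ^ (i + j) * c j)"
    "\<And>c. c \<in> coords u \<Longrightarrow> s (uq_class q d (gen_var Gen_F)) c = lower_op i u \<kappa> c"
proof -
  have u: "u < d" and top: "f_coef i (Suc u) = 0" using adm by (auto simp: admissible_def)
  define T where "T g = (case g of Gen_E \<Rightarrow> raise_op u | Gen_F \<Rightarrow> lower_op i u \<kappa>
    | Gen_K \<Rightarrow> (\<lambda>c j. \<omega> ^ (i + j) * c j))" for g
  have T [simp]: "T Gen_E = raise_op u" "T Gen_F = lower_op i u \<kappa>"
    "T Gen_K = (\<lambda>c j. \<omega> ^ (i + j) * c j)" by (simp_all add: T_def)
  interpret operators T "coords u"
  proof
    fix g and c c' :: "nat \<Rightarrow> complex" and a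
    show "T g (\<lambda>j. c j + c' j) = (\<lambda>j. T g c j + T g c' j)"
      by (cases g) (auto simp: raise_op_def lower_op_def algebra_simps)
    show "T g (\<lambda>j. a * c j) = (\<lambda>j. a * T g c j)"
      by (cases g) (auto simp: raise_op_def lower_op_def algebra_simps)
    show "T g c \<in> coords u" if "c \<in> coords u"
      using that by (cases g) (auto simp: raise_op_def lower_op_def coords_def)
  qed (auto simp: coords_def)
  have Kpow: "((\<lambda>c j. \<omega> ^ (i + j) * c j) ^^ k) c = (\<lambda>j. (\<omega> ^ (i + j)) ^ k * c j)" for k c
    by (induction k) (auto simp: algebra_simps)
  have gen_pow: "eval_at (gen_var g ^ k) c = (T g ^^ k) c" for g k c
    by (simp add: eval_power eval_gen[abs_def])
  have "eval_at r c = (\<lambda>_. 0)" if r: "r \<in> uq_relations q d" and c: "c \<in> coords u" for r c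
  proof -
    have "eval_at (gen_var Gen_E ^ d) c = (\<lambda>_. 0)"
      using c u by (auto simp: gen_pow raise_op_funpow fun_eq_iff)
    moreover have "eval_at (gen_var Gen_F ^ d) c = (\<lambda>_. 0)"
      using lower_op_power_d_zero[OF adm c] by (simp add: gen_pow)
    moreover have "eval_at (gen_var Gen_K ^ d - 1) c = (\<lambda>_. 0)"
    proof -
      have "(\<omega> ^ m) ^ d = 1" for m
        by (metis omega_pow_d power_mult mult.commute power_one)
      then show ?thesis by (simp add: eval_diff gen_pow Kpow eval_one)
    qed
    moreover have "eval_at (gen_var Gen_K * gen_var Gen_E -
        scalar (q ^ 2) * gen_var Gen_E * gen_var Gen_K) c = (\<lambda>_. 0)"
      unfolding \<omega>_def[symmetric]
    proof
      fix j
      show "eval_at (gen_var Gen_K * gen_var Gen_E -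
        scalar \<omega> * gen_var Gen_E * gen_var Gen_K) c j = 0"
        by (cases j) (auto simp: eval_diff eval_mult eval_gen eval_scalar raise_op_def)
    qed
    moreover have "eval_at (gen_var Gen_K * gen_var Gen_F -
        scalar (inverse (q ^ 2)) * gen_var Gen_F * gen_var Gen_K) c = (\<lambda>_. 0)"
      unfolding \<omega>_def[symmetric]
    proof
      fix j
      have "\<omega> ^ (i + u) = inverse \<omega> * \<omega> ^ i" if "Suc u = d"
      proof -
        have "\<omega> ^ u * \<omega> = 1" using that by (metis omega_pow_d power_Suc2)
        then show ?thesis by (simp add: power_add field_simps)
      qed
      then show "eval_at (gen_var Gen_K * gen_var Gen_F -
        scalar (inverse \<omega>) * gen_var Gen_F * gen_var Gen_K) c j = 0"
        by (auto simp: eval_diff eval_mult eval_gen eval_scalar lower_op_def field_simps)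
    qed
    moreover have "eval_at (gen_var Gen_E * gen_var Gen_F - gen_var Gen_F * gen_var Gen_E -
        scalar (1 / (q - inverse q)) * (gen_var Gen_K - gen_var Gen_K ^ (d - 1))) c = (\<lambda>_. 0)"
    proof
      fix j
      have inv: "(\<omega> ^ m) ^ (d - Suc 0) = inverse (\<omega> ^ m)" for m
        using inverse_omega_pow[of m] by (simp add: power_mult)
      have "eval_at (scalar (1 / (q - inverse q)) * (gen_var Gen_K - gen_var Gen_K ^ (d - 1))) c j =
          bracket (i + j) * c j"
        by (simp add: eval_mult eval_scalar eval_diff gen_pow Kpow inv eval_gen bracket_def)
          (simp add: left_diff_distrib diff_divide_distrib)
      moreover have "eval_at (gen_var Gen_E * gen_var Gen_F - gen_var Gen_F * gen_var Gen_E) c j =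
          bracket (i + j) * c j"
      proof (cases "j \<le> u")
        case False
        then show ?thesis using c
          by (auto simp: eval_diff eval_mult eval_gen raise_op_def lower_op_def coords_def)
      next
        case True
        have "raise_op u (lower_op i u \<kappa> c) j = f_coef i j * c j"
          using True by (cases j) (auto simp: raise_op_def lower_op_def)
        moreover have "lower_op i u \<kappa> (raise_op u c) j = f_coef i (Suc j) * c j"
          using True top by (auto simp: raise_op_def lower_op_def)
        ultimately show ?thesis
          by (simp add: eval_diff eval_mult eval_gen f_coef_Suc algebra_simps)
      qed
      ultimately show "eval_at (gen_var Gen_E * gen_var Gen_F - gen_var Gen_F * gen_var Gen_E -
        scalar (1 / (q - inverse q)) * (gen_var Gen_K - gen_var Gen_K ^ (d - 1))) c j = 0"
        by (subst eval_diff) simp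
    qed
    ultimately show ?thesis using r by (auto simp: uq_relations_def Let_def)
  qed
  then have "uq_relations q d \<subseteq> annihilator" by (auto simp: annihilator_def)
  then obtain s where s: "\<And>a c. c \<in> coords u \<Longrightarrow> s (uq_class q d a) c = eval_at a c"
    "left_module (uq q d) (std_module u s)"
    unfolding std_module_def by (rule uq_action) blast
  show ?thesis
    by (rule that[OF s(2)]) (simp_all add: s(1) eval_scalar eval_gen)
qed

section \<open>Arithmetic of the admissible lengths\<close>

context small_quantum
begin

lemma residue_rep_less: "residue_rep d a < d"
proof -
  have "a mod int d < int d" using d_pos by simp
  then show ?thesis unfolding residue_rep_def using d_pos by linarith
qed

lemma eq_residue_rep_iff:
  assumes "u < d"
  shows "u = residue_rep d (- 2 * int i) \<longleftrightarrow> d dvd 2 * i + u"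
proof -
  have "u = residue_rep d (- 2 * int i) \<longleftrightarrow> int u = (- 2 * int i) mod int d"
    unfolding residue_rep_def using d_pos by auto
  also have "\<dots> \<longleftrightarrow> int u mod int d = (- 2 * int i) mod int d"
    using assms by simp
  also have "\<dots> \<longleftrightarrow> int d dvd int u - (- 2 * int i)"
    by (rule mod_eq_dvd_iff)
  also have "int u - (- 2 * int i) = int (2 * i + u)" by simp
  finally show ?thesis by (simp only: int_dvd_int_iff)
qed

lemma admissible_top_or_residue:
  assumes "admissible i u \<kappa>"
  shows "Suc u = d \<or> u = residue_rep d (- 2 * int i)"
proof -
  have u: "u < d" "f_coef i (Suc u) = 0" using assms by (auto simp: admissible_def)
  then have "d dvd Suc u \<or> d dvd 2 * i + u" by (simp add: f_coef_eq_0_iff)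
  moreover have "Suc u = d" if "d dvd Suc u" using dvd_imp_le[OF that] u(1) by simp
  ultimately show ?thesis using eq_residue_rep_iff[OF u(1)] by blast
qed

text \<open>If also \<open>f_coef i (Suc k)\<close> vanished, \<open>d\<close> would divide the difference \<open>u - k\<close>.\<close>

lemma f_coef_nonzero:
  assumes "k < u" "u < d" "d dvd 2 * i + u"
  shows "f_coef i (Suc k) \<noteq> 0"
proof
  assume "f_coef i (Suc k) = 0"
  moreover have "\<not> d dvd Suc k" using assms by (intro nat_dvd_not_less) auto
  ultimately have "d dvd 2 * i + k" using f_coef_eq_0_iff by blast
  then have "d dvd (2 * i + u) - (2 * i + k)" by (rule dvd_diff_nat[OF assms(3)])
  then have "d dvd u - k" by simp
  moreover have "\<not> d dvd u - k" using assms by (intro nat_dvd_not_less) auto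
  ultimately show False by blast
qed

lemma admissible_residue: "admissible i (residue_rep d (- 2 * int i)) 0"
  using residue_rep_less[of "- 2 * int i"] eq_residue_rep_iff[of "residue_rep d (- 2 * int i)" i]
  by (simp add: admissible_def f_coef_eq_0_iff)

lemma admissible_top: "Suc u = d \<Longrightarrow> admissible i u 0"
  using f_coef_eq_0_iff[of i u] by (auto simp: admissible_def)

text \<open>For a full string that is also of the first kind no coefficient vanishes, so \<open>F\<^sup>d = 0\<close> forces
  \<open>\<kappa> = 0\<close>. This is the exceptional projective module.\<close>

lemma lower_op_residue:
  assumes "admissible i u \<kappa>" "u = residue_rep d (- 2 * int i)"
  shows "lower_op i u \<kappa> = lower_op i u 0"
proof (cases "Suc u = d")
  case False
  then show ?thesis by (auto simp: lower_op_def fun_eq_iff)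
next
  case True
  have "f_coef i m \<noteq> 0" if "0 < m" "m < d" for m
    using f_coef_nonzero[of "m - 1" u i] that True eq_residue_rep_iff[of u i] assms(2) by auto
  then have "\<kappa> = 0" using assms(1) True by (auto simp: admissible_def)
  then show ?thesis by simp
qed

lemma f_coef_zero_below_top:
  assumes "Suc u = d" "u \<noteq> residue_rep d (- 2 * int i)"
  obtains m where "0 < m" "m < d" "f_coef i m = 0"
proof -
  let ?r = "residue_rep d (- 2 * int i)"
  have "Suc ?r < d" using residue_rep_less[of "- 2 * int i"] assms by linarith
  moreover have "f_coef i (Suc ?r) = 0"
    using eq_residue_rep_iff[of ?r i] residue_rep_less[of "- 2 * int i"]
    by (simp add: f_coef_eq_0_iff)
  ultimately show ?thesis using that by blast
qed

text \<open>The residue of \<open>- 2 i\<close> is \<open>d - 1\<close> exactly if \<open>d\<close> divides \<open>2 i - 1\<close>, which is less than \<open>2 d\<close>.\<close>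

lemma residue_rep_top_iff:
  assumes "i < d"
  shows "residue_rep d (- 2 * int i) = d - 1 \<longleftrightarrow> odd d \<and> i = (d + 1) div 2"
proof -
  have "residue_rep d (- 2 * int i) = d - 1 \<longleftrightarrow> d dvd 2 * i + (d - 1)"
    using eq_residue_rep_iff[of "d - 1" i] d_pos by auto
  also have "\<dots> \<longleftrightarrow> odd d \<and> i = (d + 1) div 2"
  proof (cases "i = 0")
    case True
    then show ?thesis using d_ge by (auto dest: dvd_imp_le)
  next
    case False
    then have "2 * i + (d - 1) = d + (2 * i - 1)" using d_pos by simp
    then have "d dvd 2 * i + (d - 1) \<longleftrightarrow> d dvd 2 * i - 1" by simp
    also have "\<dots> \<longleftrightarrow> 2 * i - 1 = d"
    proof
      assume "d dvd 2 * i - 1"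
      then obtain k where k: "2 * i - 1 = d * k" by auto
      have "d * k < d * 2" using k assms False by linarith
      then have "k < 2" by simp
      moreover have "k \<noteq> 0" using k False by (intro notI) simp
      ultimately have "k = 1" by simp
      then show "2 * i - 1 = d" using k by simp
    qed simp
    also have "\<dots> \<longleftrightarrow> odd d \<and> i = (d + 1) div 2"
      using False by presburger
    finally show ?thesis .
  qed
  finally show ?thesis .
qed

lemma borel_moduleI: "left_module (uq_plus q d) M \<Longrightarrow> borel_module n d q M"
  by (intro borel_module.intro borel_module_axioms.intro small_quantum_axioms)
    (auto simp: left_module_def)

lemma uq_moduleI: "left_module (uq q d) M \<Longrightarrow> uq_module n d q M"
  by (intro uq_module.intro uq_module_axioms.intro small_quantum_axioms)
    (auto simp: left_module_def)

section \<open>Standard modules are strings\<close>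

lemma std_uq_string:
  assumes "admissible i u \<kappa>"
  obtains s where "uq_string n d q (std_module u s) unit_vec i u"
    "\<And>c. c \<in> coords u \<Longrightarrow> lin q d (std_module u s) unit_vec u c = c"
    "\<And>c. c \<in> coords u \<Longrightarrow> s (uq_class q d (gen_var Gen_F)) c = lower_op i u \<kappa> c"
proof -
  obtain s where lm: "left_module (uq q d) (std_module u s)"
    and s: "\<And>a c. c \<in> coords u \<Longrightarrow> s (uq_scalar q d a) c = (\<lambda>j. a * c j)"
    "\<And>c. c \<in> coords u \<Longrightarrow> s (uq_E q d) c = raise_op u c"
    "\<And>c. c \<in> coords u \<Longrightarrow> s (uq_K q d) c = (\<lambda>j. \<omega> ^ (i + j) * c j)"
    "\<And>c. c \<in> coords u \<Longrightarrow> s (uq_class q d (gen_var Gen_F)) c = lower_op i u \<kappa> c"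
    by (rule std_action[OF assms]) blast
  let ?M = "std_module u s"
  have [simp]: "carrier ?M = coords u" "c \<oplus>\<^bsub>?M\<^esub> c' = (\<lambda>j. c j + c' j)"
    "\<zero>\<^bsub>?M\<^esub> = (\<lambda>_. 0)" "a \<odot>\<^bsub>?M\<^esub> c = s a c" for c c' a
    by (simp_all add: std_module_def)
  interpret uq_module n d q ?M by (rule uq_moduleI[OF lm])
  interpret faithful_string n d q ?M unit_vec i u
  proof
    fix j assume "j \<le> u"
    then show "uq_K q d \<odot>\<^bsub>?M\<^esub> unit_vec j = uq_scalar q d (\<omega> ^ (i + j)) \<odot>\<^bsub>?M\<^esub> unit_vec j"
      by (simp add: s unit_vec_coords) (auto simp: unit_vec_def fun_eq_iff)
    from \<open>j \<le> u\<close> show "unit_vec j \<in> carrier ?M" by (simp add: unit_vec_coords)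
  next
    fix j assume "j < u"
    then show "uq_E q d \<odot>\<^bsub>?M\<^esub> unit_vec j = unit_vec (Suc j)"
      by (simp add: s unit_vec_coords) (auto simp: unit_vec_def raise_op_def fun_eq_iff)
  next
    show "uq_E q d \<odot>\<^bsub>?M\<^esub> unit_vec u = \<zero>\<^bsub>?M\<^esub>"
      by (simp add: s unit_vec_coords) (auto simp: unit_vec_def raise_op_def fun_eq_iff)
    have "unit_vec u u \<noteq> 0" by (simp add: unit_vec_def)
    then show "unit_vec u \<noteq> \<zero>\<^bsub>?M\<^esub>" by force
  qed
  have L: "L c = c" if "c \<in> coords u" for c
  proof -
    have "L c = (\<lambda>j. if j \<le> u then c j else 0)"
    proof (rule coords_linear_ext[where ?T1.0 = L and ?T2.0 = "\<lambda>c j. if j \<le> u then c j else 0"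
          and pl = "\<lambda>c c' j. c j + c' j" and ml = "\<lambda>a c j. a * c j"])
      show "L (\<lambda>j. c j + c' j) = (\<lambda>j. L c j + L c' j)" for c c'
        unfolding lin_add by simp
      show "L (\<lambda>j. a * c j) = (\<lambda>j. a * L c j)" for a c
        unfolding lin_scale using lin_closed[of c] by (simp add: s)
      show "L (unit_vec k) = (\<lambda>j. if j \<le> u then unit_vec k j else 0)" if "k \<le> u" for k
        using that by (auto simp: lin_unit unit_vec_def fun_eq_iff)
    qed (use that in \<open>auto simp: fun_eq_iff\<close>)
    then show ?thesis using that by (auto simp: coords_def fun_eq_iff)
  qed
  have "uq_string n d q ?M unit_vec i u"
    by unfold_locales (use L in \<open>force simp: image_iff\<close>)
  then show ?thesis using that L s(4) by blast
qed

end

section \<open>Extensions\<close>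

lemma abelian_group_smult: "abelian_group (M\<lparr>smult := s\<rparr>) \<longleftrightarrow> abelian_group M"
  by (simp add: abelian_group_def abelian_monoid_def abelian_group_axioms_def)

lemma finsum_smult: "finsum (M\<lparr>smult := s\<rparr>) = finsum M"
  by (simp add: finsum_def fun_eq_iff)

text \<open>The standard module with the same parameters is carried over along the coordinates.\<close>

lemma (in faithful_string) extensionI:
  assumes surj: "carrier M = L ` coords u" and adm: "admissible i u \<kappa>"
  obtains s where "is_extension q d M s"
    "\<And>c. c \<in> coords u \<Longrightarrow> s (uq_F q d) (L c) = L (lower_op i u \<kappa> c)"
proof -
  obtain s0 where str: "uq_string n d q (std_module u s0) unit_vec i u"
    and lin0: "\<And>c. c \<in> coords u \<Longrightarrow> lin q d (std_module u s0) unit_vec u c = c"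
    and F0: "\<And>c. c \<in> coords u \<Longrightarrow> s0 (uq_F q d) c = lower_op i u \<kappa> c"
    using std_uq_string[OF adm] by blast
  interpret S: uq_string n d q "std_module u s0" unit_vec i u by (rule str)
  have sel: "carrier (std_module u s0) = coords u"
    "c \<oplus>\<^bsub>std_module u s0\<^esub> c' = (\<lambda>j. c j + c' j)" "a \<odot>\<^bsub>std_module u s0\<^esub> c = s0 a c" for c c' a
    by (simp_all add: std_module_def)
  define s where "s A x = L (s0 A (inv_into (coords u) L x))" for A x
  have s: "s A (L c) = L (s0 A c)" if "c \<in> coords u" for A c
    using that by (simp add: s_def lin_inverse)
  have s0_closed: "s0 (uq_class q d a) c \<in> coords u" if "c \<in> coords u" for a c
    using S.uact_closed[of c a] that by (simp add: sel)
  have s0_add: "s0 (uq_class q d a) (\<lambda>j. c j + c' j) = (\<lambda>j. s0 (uq_class q d a) c j + s0 (uq_class q d a) c' j)"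
    if "c \<in> coords u" "c' \<in> coords u" for a c c'
    using S.uact_distrib[of c c' a] that by (simp add: sel)
  have s0_plus: "s0 (uq_class q d (a + b)) c = (\<lambda>j. s0 (uq_class q d a) c j + s0 (uq_class q d b) c j)"
    if "c \<in> coords u" for a b c
    using S.uact_add[of c a b] that by (simp add: sel)
  have s0_mult: "s0 (uq_class q d (a * b)) c = s0 (uq_class q d a) (s0 (uq_class q d b) c)"
    if "c \<in> coords u" for a b c
    using S.uact_mult[of c a b] that by (simp add: sel)
  have s0_one: "s0 (uq_class q d 1) c = c" if "c \<in> coords u" for c
    using S.act_one[of c] that by (simp add: sel)
  have lm: "left_module (uq q d) (M\<lparr>smult := s\<rparr>)"
  proof (rule left_module.intro[OF ring_uq])
    show "abelian_group (M\<lparr>smult := s\<rparr>)"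
      unfolding abelian_group_smult by (rule M.abelian_group_axioms)
    show "left_module_axioms (uq q d) (M\<lparr>smult := s\<rparr>)"
      unfolding left_module_axioms_def
    proof (intro conjI allI impI)
      fix A x assume "A \<in> carrier (uq q d)" "x \<in> carrier (M\<lparr>smult := s\<rparr>)"
      then show "A \<odot>\<^bsub>M\<lparr>smult := s\<rparr>\<^esub> x \<in> carrier (M\<lparr>smult := s\<rparr>)" by (simp add: s_def)
    next
      fix A B x
      assume "A \<in> carrier (uq q d)" "B \<in> carrier (uq q d)" "x \<in> carrier (M\<lparr>smult := s\<rparr>)"
      then obtain a b c where *: "A = uq_class q d a" "B = uq_class q d b" "c \<in> coords u" "x = L c"
        using surj by (auto simp: carrier_uq)
      show "(A \<oplus>\<^bsub>uq q d\<^esub> B) \<odot>\<^bsub>M\<lparr>smult := s\<rparr>\<^esub> x =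
          A \<odot>\<^bsub>M\<lparr>smult := s\<rparr>\<^esub> x \<oplus>\<^bsub>M\<lparr>smult := s\<rparr>\<^esub> B \<odot>\<^bsub>M\<lparr>smult := s\<rparr>\<^esub> x"
        using * by (simp add: uq_class_simps s s0_plus lin_add)
      show "(A \<otimes>\<^bsub>uq q d\<^esub> B) \<odot>\<^bsub>M\<lparr>smult := s\<rparr>\<^esub> x =
          A \<odot>\<^bsub>M\<lparr>smult := s\<rparr>\<^esub> (B \<odot>\<^bsub>M\<lparr>smult := s\<rparr>\<^esub> x)"
        using * by (simp add: uq_class_simps s s0_mult s0_closed)
    next
      fix A x y
      assume "A \<in> carrier (uq q d)" "x \<in> carrier (M\<lparr>smult := s\<rparr>)" "y \<in> carrier (M\<lparr>smult := s\<rparr>)"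
      then obtain a c c' where *: "A = uq_class q d a" "c \<in> coords u" "x = L c"
        "c' \<in> coords u" "y = L c'"
        using surj by (auto simp: carrier_uq)
      have "(\<lambda>j. c j + c' j) \<in> coords u" using * by (auto simp: coords_def)
      then have "s A (x \<oplus> y) = L (s0 A (\<lambda>j. c j + c' j))"
        using * by (simp add: s flip: lin_add)
      also have "\<dots> = s A x \<oplus> s A y"
        using * by (simp add: s s0_add lin_add)
      finally show "A \<odot>\<^bsub>M\<lparr>smult := s\<rparr>\<^esub> (x \<oplus>\<^bsub>M\<lparr>smult := s\<rparr>\<^esub> y) =
          A \<odot>\<^bsub>M\<lparr>smult := s\<rparr>\<^esub> x \<oplus>\<^bsub>M\<lparr>smult := s\<rparr>\<^esub> A \<odot>\<^bsub>M\<lparr>smult := s\<rparr>\<^esub> y"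
        by simp
    next
      fix x assume "x \<in> carrier (M\<lparr>smult := s\<rparr>)"
      then obtain c where *: "c \<in> coords u" "x = L c" using surj by auto
      then show "\<one>\<^bsub>uq q d\<^esub> \<odot>\<^bsub>M\<lparr>smult := s\<rparr>\<^esub> x = x"
        by (simp add: uq_class_simps s s0_one)
    qed
  qed
  have hom: "(\<lambda>x. L (inv_into (coords u) (lin q d (std_module u s0) unit_vec u) x))
      \<in> module_hom (uq_plus q d) (std_module u s0) M"
    by (rule lin_transfer[OF S.faithful_string_axioms S.surj string_module_axioms])
  have inv0: "inv_into (coords u) (lin q d (std_module u s0) unit_vec u) c = c" if "c \<in> coords u" for c
    using S.lin_inverse[OF that] lin0[OF that] by simp
  have "s A x = A \<odot> x" if A: "A \<in> carrier (uq_plus q d)" and x: "x \<in> carrier M" for A x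
  proof -
    obtain a where a: "A = uq_class q d a" using A by (auto simp: carrier_uq_plus)
    obtain c where c: "c \<in> coords u" "x = L c" using x surj by auto
    have "L (inv_into (coords u) S.L (s0 A c)) = A \<odot> L (inv_into (coords u) S.L c)"
      using hom A c by (auto simp: module_hom_def sel)
    then show ?thesis using c a by (simp add: inv0 s0_closed s)
  qed
  then have "is_extension q d M s" using lm by (simp add: is_extension_def)
  then show ?thesis using that[of s] s F0 by simp
qed

lemma (in faithful_string) extension_uq_string:
  assumes surj: "carrier M = L ` coords u" and ext: "is_extension q d M s"
  shows "uq_string n d q (M\<lparr>smult := s\<rparr>) e i u" "lin q d (M\<lparr>smult := s\<rparr>) e u = L"
proof -
  have lm: "left_module (uq q d) (M\<lparr>smult := s\<rparr>)"
    and agree: "\<And>a x. a \<in> borel_alg q d \<Longrightarrow> x \<in> carrier M \<Longrightarrow> s (uq_class q d a) x = act a x"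
    using ext by (auto simp: is_extension_def carrier_uq_plus)
  interpret X: uq_module n d q "M\<lparr>smult := s\<rparr>" by (rule uq_moduleI[OF lm])
  have fs: "faithful_string n d q (M\<lparr>smult := s\<rparr>) e i u"
  proof
    fix j assume "j \<le> u"
    then show "e j \<in> carrier (M\<lparr>smult := s\<rparr>)" "X.K (e j) = X.sc (\<omega> ^ (i + j)) (e j)"
      using e_closed K_e by (auto simp: agree)
  qed (use e_closed E_e E_e_top e_top in \<open>auto simp: agree\<close>)
  show lin: "lin q d (M\<lparr>smult := s\<rparr>) e u = L"
  proof
    fix c
    show "lin q d (M\<lparr>smult := s\<rparr>) e u c = L c"
      unfolding lin_def finsum_smult
      by (intro M.finsum_cong') (auto simp: agree e_closed)
  qed
  show "uq_string n d q (M\<lparr>smult := s\<rparr>) e i u"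
    by (intro uq_string.intro uq_string_axioms.intro X.uq_module_axioms fs) (simp add: lin surj)
qed

lemma (in faithful_string) extension_structure:
  assumes surj: "carrier M = L ` coords u" and ext: "is_extension q d M s"
  obtains \<kappa> where "\<And>c. c \<in> coords u \<Longrightarrow> s (uq_F q d) (L c) = L (lower_op i u \<kappa> c)"
    "admissible i u \<kappa>"
proof -
  interpret X: uq_string n d q "M\<lparr>smult := s\<rparr>" e i u by (rule extension_uq_string(1)[OF assms])
  show ?thesis
    using X.F_structure that unfolding extension_uq_string(2)[OF assms] by auto
qed

text \<open>Together with the Borel part, \<open>F\<close> generates the quantum group.\<close>

lemma (in borel_module) extension_eqI:
  assumes s: "is_extension q d M s" and t: "is_extension q d M t"
    and F: "\<And>x. x \<in> carrier M \<Longrightarrow> s (uq_F q d) x = t (uq_F q d) x"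
    and ax: "a \<in> carrier (uq q d)" "x \<in> carrier M"
  shows "s a x = t a x"
proof -
  have lm: "left_module (uq q d) (M\<lparr>smult := s\<rparr>)" "left_module (uq q d) (M\<lparr>smult := t\<rparr>)"
    using s t by (auto simp: is_extension_def)
  have "(\<lambda>x. x) \<in> module_hom (uq_plus q d) (M\<lparr>smult := s\<rparr>) (M\<lparr>smult := t\<rparr>)"
    using s t by (auto simp: module_hom_def is_extension_def)
  then have "(\<lambda>x. x) \<in> module_hom (uq q d) (M\<lparr>smult := s\<rparr>) (M\<lparr>smult := t\<rparr>)"
    using lm F by (intro module_hom_uqI) auto
  then show ?thesis using ax by (auto simp: module_hom_def)
qed

text \<open>By \<open>lower_op_residue\<close> the action of \<open>F\<close> is the same for all extensions.\<close>

lemma (in faithful_string) extends_uniquely: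
  assumes surj: "carrier M = L ` coords u" and u: "u = residue_rep d (- 2 * int i)"
  shows "extends_uniquely q d M"
  unfolding extends_uniquely_def
proof (intro conjI allI impI ballI)
  have "admissible i u 0" using admissible_residue u by simp
  then obtain s where "is_extension q d M s" using extensionI[OF surj] by metis
  then show "extendable q d M" by (auto simp: extendable_def)
  fix s t a x
  assume st: "is_extension q d M s \<and> is_extension q d M t"
    and ax: "a \<in> carrier (uq q d)" "x \<in> carrier M"
  have F: "r (uq_F q d) (L c) = L (lower_op i u 0 c)"
    if r: "is_extension q d M r" and c: "c \<in> coords u" for r c
  proof -
    obtain \<kappa> where k: "r (uq_F q d) (L c) = L (lower_op i u \<kappa> c)" "admissible i u \<kappa>"
      using extension_structure[OF surj r] c by metis
    then show ?thesis by (simp only: lower_op_residue[OF k(2) u])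
  qed
  show "s a x = t a x"
  proof (rule extension_eqI[of s t])
    fix y assume "y \<in> carrier M"
    then show "s (uq_F q d) y = t (uq_F q d) y" using F[of s] F[of t] st surj by auto
  qed (use st ax in auto)
qed

section \<open>Simple modules\<close>

lemma (in string_module) lin_mem:
  assumes "\<zero> \<in> H" "\<And>x y. x \<in> H \<Longrightarrow> y \<in> H \<Longrightarrow> x \<oplus> y \<in> H" "\<And>a x. x \<in> H \<Longrightarrow> sc a x \<in> H"
    and "\<And>k. k \<le> u \<Longrightarrow> e k \<in> H"
  shows "L c \<in> H"
proof -
  have "(\<Oplus>j\<in>{..m}. sc (c j) (e j)) \<in> H" if "m \<le> u" for m
    using that
  proof (induction m)
    case 0
    then show ?case using assms e_closed[of 0] by simp
  next
    case (Suc m)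
    have "(\<lambda>j. sc (c j) (e j)) \<in> {..Suc m} \<rightarrow> carrier M" using Suc.prems e_closed by auto
    then show ?case using Suc assms by simp
  qed
  then show ?thesis by (simp add: lin_def)
qed

text \<open>A nonzero submodule contains \<open>e u\<close> by \<open>socle\<close>, and the nonzero coefficients of \<open>F\<close> lead from
  there down to \<open>e 0\<close>.\<close>

lemma (in uq_string) simple:
  assumes u: "u = residue_rep d (- 2 * int i)"
  shows "simple_module (uq q d) M"
  unfolding simple_module_def
proof (intro conjI allI impI uq_left_module)
  show "carrier M \<noteq> {\<zero>}" using e_top e_closed[of u] by auto
  fix H assume H: "submodule H (uq q d) M"
  note Hb = submodule_restrict[OF H]
  note HD = submodule_borelD[OF Hb]
  have HF: "F x \<in> H" if "x \<in> H" for x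
    using submodule.smult_closed[OF H, of "uq_F q d" x] that by (auto simp: carrier_uq)
  show "H = {\<zero>} \<or> H = carrier M"
  proof (cases "H = {\<zero>}")
    case False
    then have "e u \<in> H" using socle[OF Hb] HD(1) surj by auto
    have "e (u - m) \<in> H" if "m \<le> u" for m
      using that
    proof (induction m)
      case (Suc m)
      define k where "k = u - Suc m"
      have k: "k < u" "u - m = Suc k" using Suc.prems by (auto simp: k_def)
      have nz: "f_coef i (Suc k) \<noteq> 0"
        using f_coef_nonzero[OF k(1) u_less_d] eq_residue_rep_iff[OF u_less_d] u by blast
      have "F (e (Suc k)) = sc (f_coef i (Suc k)) (e k)" using F_e k(1) by metis
      then have "sc (f_coef i (Suc k)) (e k) \<in> H" using HF[of "e (Suc k)"] Suc k by simp
      then have "sc (inverse (f_coef i (Suc k))) (sc (f_coef i (Suc k)) (e k)) \<in> H"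
        by (rule HD(4)[OF borel_alg_gens(1)])
      moreover have "sc (inverse (f_coef i (Suc k))) (sc (f_coef i (Suc k)) (e k)) = e k"
        using nz e_closed[of k] k(1) by (subst sc_sc) auto
      ultimately show ?case by (simp add: k_def)
    qed (use \<open>e u \<in> H\<close> in simp)
    then have e: "e k \<in> H" if "k \<le> u" for k
      using that by (metis diff_diff_cancel diff_le_self)
    have "L c \<in> H" for c
      by (rule lin_mem) (use HD e in auto)
    then show ?thesis using HD(1) surj by auto
  qed simp
qed

context uq_module
begin

lemma F_power_weight:
  assumes "x \<in> carrier M" "K x = sc (\<omega> ^ r) x"
  shows "\<exists>r'. K ((F ^^ m) x) = sc (\<omega> ^ r') ((F ^^ m) x)"
proof (induction m)
  case 0
  then show ?case using assms by auto
next
  case (Suc m)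
  then obtain r' where r': "K ((F ^^ m) x) = sc (\<omega> ^ r') ((F ^^ m) x)" by auto
  have "inverse \<omega> = \<omega> ^ (d - 1)" using inverse_omega_pow[of 1] by simp
  then have "K ((F ^^ Suc m) x) = sc (\<omega> ^ (d - 1 + r')) ((F ^^ Suc m) x)"
    using assms(1) r' by (simp add: K_F F_sc sc_sc ufunpow_closed power_add)
  then show ?case by blast
qed

text \<open>Apply \<open>F\<close> to a weight vector as long as the result is not zero.\<close>

lemma lowest_weight_vector:
  assumes "carrier M \<noteq> {\<zero>}"
  obtains x i where "x \<in> carrier M" "x \<noteq> \<zero>" "i < d" "K x = sc (\<omega> ^ i) x" "F x = \<zero>"
proof -
  have "\<exists>x r. x \<in> carrier M \<and> r < d \<and> K x = sc (\<omega> ^ r) x \<and> x \<noteq> \<zero>"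
  proof (rule ccontr)
    assume no: "\<not> ?thesis"
    have "x \<in> {\<zero>}" if "x \<in> carrier M" for x
      by (rule weight_span) (use no that in auto)
    then show False using assms by auto
  qed
  then obtain x r where x: "x \<in> carrier M" "K x = sc (\<omega> ^ r) x" "x \<noteq> \<zero>" by auto
  define m where "m = (LEAST m. (F ^^ m) x = \<zero>)"
  have m: "(F ^^ m) x = \<zero>" unfolding m_def by (rule LeastI[of _ d]) (rule F_power_d[OF x(1)])
  then have "m \<noteq> 0" using x(3) by (cases m) auto
  then obtain k where k: "m = Suc k" by (cases m) auto
  have nz: "(F ^^ k) x \<noteq> \<zero>" using not_less_Least[of k "\<lambda>m. (F ^^ m) x = \<zero>"] k by (simp add: m_def)
  obtain r' where "K ((F ^^ k) x) = sc (\<omega> ^ r') ((F ^^ k) x)"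
    using F_power_weight[OF x(1,2)] by blast
  then have "K ((F ^^ k) x) = sc (\<omega> ^ (r' mod d)) ((F ^^ k) x)" by (simp add: omega_pow_mod)
  moreover have "r' mod d < d" using d_pos by simp
  ultimately show ?thesis using that[of "(F ^^ k) x" "r' mod d"] nz m k x(1) by (simp add: ufunpow_closed)
qed

text \<open>The string generated by a lowest weight vector is stable under \<open>F\<close>, by induction with the
  commutator relation, and hence exhausts the module. It remains to exclude strings of length \<open>d\<close>
  that are not of the first kind.\<close>

lemma simple_uq_string:
  assumes sim: "simple_module (uq q d) M"
  obtains e i u where "i < d" "u = residue_rep d (- 2 * int i)" "uq_string n d q M e i u"
proof -
  have nz: "carrier M \<noteq> {\<zero>}" using sim by (simp add: simple_module_def)
  obtain x i where x: "x \<in> carrier M" "x \<noteq> \<zero>" "i < d" "K x = sc (\<omega> ^ i) x" "F x = \<zero>"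
    using lowest_weight_vector[OF nz] by metis
  define m where "m = (LEAST m. (E ^^ m) x = \<zero>)"
  have m: "(E ^^ m) x = \<zero>" unfolding m_def by (rule LeastI[of _ d]) (rule E_power_d[OF x(1)])
  then have "m \<noteq> 0" using x(2) by (cases m) auto
  then obtain u where u: "m = Suc u" by (cases m) auto
  have top: "(E ^^ u) x \<noteq> \<zero>"
    using not_less_Least[of u "\<lambda>m. (E ^^ m) x = \<zero>"] u by (simp add: m_def)
  let ?e = "\<lambda>j. (E ^^ j) x"
  interpret faithful_string n d q M ?e i u
    by unfold_locales (use x top m u in \<open>auto simp: funpow_closed K_E_power\<close>)
  let ?I = "L ` coords u"
  note Isub = lin_image_submodule
  note ID = submodule_borelD[OF Isub]
  have eI: "?e k \<in> ?I" if "k \<le> u" for k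
    using lin_unit[OF that] unit_vec_coords[OF that] by force
  have Fe: "F (?e k) \<in> ?I" if "k \<le> u" for k
    using that
  proof (induction k)
    case 0
    then show ?case using x(5) ID(2) by simp
  next
    case (Suc k)
    let ?b = "bracket (i + k)"
    have ek: "?e k \<in> carrier M" using x(1) by (simp add: funpow_closed)
    have "E (F (?e k)) = F (?e (Suc k)) \<oplus> sc ?b (?e k)"
      using E_F[OF ek K_E_power[OF x(1,4)]] by simp
    then have "E (F (?e k)) \<oplus> sc (- ?b) (?e k) = F (?e (Suc k)) \<oplus> (sc ?b (?e k) \<oplus> sc (- ?b) (?e k))"
      using ek by (simp add: M.a_assoc)
    also have "sc ?b (?e k) \<oplus> sc (- ?b) (?e k) = \<zero>"
      using ek sc_add[of "?e k" ?b "- ?b"] by (simp add: act_scalar_0)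
    finally have "F (?e (Suc k)) = E (F (?e k)) \<oplus> sc (- ?b) (?e k)" using ek by simp
    moreover have "E (F (?e k)) \<in> ?I" using Suc by (intro ID(4)[OF borel_alg_gens(2)]) simp
    moreover have "sc (- ?b) (?e k) \<in> ?I" using eI[of k] Suc.prems
      by (intro ID(4)[OF borel_alg_gens(1)]) simp
    ultimately show ?case using ID(3) by simp
  qed
  have FL: "F (L c) \<in> ?I" for c
  proof -
    have "L c \<in> {y \<in> carrier M. F y \<in> ?I}"
    proof (rule lin_mem)
      show "\<zero> \<in> {y \<in> carrier M. F y \<in> ?I}" using ID(2) by simp
      fix y z assume "y \<in> {y \<in> carrier M. F y \<in> ?I}" "z \<in> {y \<in> carrier M. F y \<in> ?I}"
      then show "y \<oplus> z \<in> {y \<in> carrier M. F y \<in> ?I}"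
        using ID(3)[of "F y" "F z"] by (simp add: uact_distrib)
    next
      fix a y assume "y \<in> {y \<in> carrier M. F y \<in> ?I}"
      then show "sc a y \<in> {y \<in> carrier M. F y \<in> ?I}"
        using ID(4)[of "scalar a" "F y"] by (simp add: F_sc)
    qed (use Fe x(1) in \<open>simp add: funpow_closed\<close>)
    then show ?thesis by simp
  qed
  have "submodule ?I (uq q d) M"
    using FL by (intro submodule_uqI[OF Isub]) auto
  moreover have "?I \<noteq> {\<zero>}" using eI[of u] top by auto
  ultimately have I: "?I = carrier M" using sim by (auto simp: simple_module_def)
  interpret uq_string n d q M ?e i u
    by unfold_locales (rule I[symmetric])
  obtain \<kappa> where F_L: "\<And>c. c \<in> coords u \<Longrightarrow> F (L c) = L (lower_op i u \<kappa> c)"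
    and adm: "admissible i u \<kappa>"
    using F_structure by blast
  have "u = residue_rep d (- 2 * int i)"
  proof (rule ccontr)
    assume ne: "u \<noteq> residue_rep d (- 2 * int i)"
    then have ud: "Suc u = d" using admissible_top_or_residue[OF adm] by simp
    obtain m where m: "0 < m" "m < d" "f_coef i m = 0" using f_coef_zero_below_top[OF ud ne] by metis
    have "L (lower_op i u \<kappa> (unit_vec 0)) = L (\<lambda>j. \<kappa> * unit_vec u j)"
      using ud by (intro lin_cong) (auto simp: lower_op_def unit_vec_def)
    then have "sc \<kappa> (?e u) = \<zero>"
      using F_L[OF unit_vec_coords[of 0 u]] x(5) by (simp add: lin_scale lin_unit)
    \<comment> \<open>\<open>0 = F x = \<kappa> (E\<^sup>u x)\<close>\<close>
    then have k0: "\<kappa> = 0" using top x(1) by (simp add: sc_eq_zero_iff funpow_closed)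
    \<comment> \<open>the span of \<open>e m, \<dots>, e u\<close>\<close>
    define V where "V = {c \<in> coords u. \<forall>j<m. c j = 0}"
    have "submodule (L ` V) (uq q d) M"
    proof (rule submodule_uqI[OF submodule_borelI])
      show "\<zero> \<in> L ` V" using lin_zero by (force simp: V_def coords_def)
      fix y z assume "y \<in> L ` V" "z \<in> L ` V"
      then obtain c c' where "c \<in> V" "c' \<in> V" "y = L c" "z = L c'" by auto
      then show "y \<oplus> z \<in> L ` V"
        by (intro image_eqI[of _ _ "\<lambda>j. c j + c' j"]) (auto simp: lin_add V_def coords_def)
    next
      fix a y assume "y \<in> L ` V"
      then obtain c where c: "c \<in> V" "c \<in> coords u" "y = L c" by (auto simp: V_def)
      then show "sc a y \<in> L ` V"
        by (intro image_eqI[of _ _ "\<lambda>j. a * c j"]) (auto simp: lin_scale V_def coords_def)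
      from c show "E y \<in> L ` V"
        by (intro image_eqI[of _ _ "raise_op u c"]) (auto simp: lin_E V_def raise_op_def coords_def)
      from c show "K y \<in> L ` V"
        by (intro image_eqI[of _ _ "\<lambda>j. \<omega> ^ (i + j) * c j"]) (auto simp: lin_K V_def coords_def)
      have "lower_op i u \<kappa> c j = 0" if "j < m" for j
        using c(1) that m(3) k0 by (cases "Suc j = m") (auto simp: lower_op_def V_def)
      then have "lower_op i u \<kappa> c \<in> V" by (simp add: V_def lower_op_coords)
      then show "F y \<in> L ` V" using c F_L by auto
    qed auto
    then have "L ` V = {\<zero>} \<or> L ` V = carrier M" using sim by (auto simp: simple_module_def)
    moreover have "unit_vec u \<in> V" using m ud by (auto simp: V_def unit_vec_def coords_def)
    then have "?e u \<in> L ` V" using lin_unit[of u] by force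
    then have "L ` V \<noteq> {\<zero>}" using top by auto
    ultimately have "?e 0 \<in> L ` V" using x(1) by simp
    then obtain c where c: "c \<in> V" "L c = L (unit_vec 0)" using lin_unit[of 0] by auto
    then have "c = unit_vec 0"
      using inj_onD[OF lin_inj, OF c(2)] unit_vec_coords[of 0 u] by (simp add: V_def)
    then have "unit_vec 0 0 = (0 :: complex)" using c(1) m(1) by (auto simp: V_def)
    then show False by (simp add: unit_vec_def)
  qed
  then show ?thesis using that x(3) uq_string_axioms by blast
qed

end

lemma (in uq_string) isomorphic_std:
  assumes F: "\<And>c. c \<in> coords u \<Longrightarrow> F (L c) = L (lower_op i u \<kappa> c)"
    and std: "uq_string n d q (std_module u s) unit_vec i u"
    "\<And>c. c \<in> coords u \<Longrightarrow> lin q d (std_module u s) unit_vec u c = c"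
    "\<And>c. c \<in> coords u \<Longrightarrow> s (uq_F q d) c = lower_op i u \<kappa> c"
  shows "module_isomorphic (uq q d) M (std_module u s)"
proof -
  interpret S: uq_string n d q "std_module u s" unit_vec i u by (rule std(1))
  let ?f = "\<lambda>x. S.L (inv_into (coords u) L x)"
  have f_L: "?f (L c) = c" if "c \<in> coords u" for c
    using that by (simp add: lin_inverse std(2))
  have "?f \<in> module_hom (uq_plus q d) M (std_module u s)"
    by (rule lin_transfer[OF faithful_string_axioms surj S.string_module_axioms])
  then have "?f \<in> module_hom (uq q d) M (std_module u s)"
  proof (rule module_hom_uqI[OF uq_left_module S.uq_left_module])
    fix x assume "x \<in> carrier M"
    then obtain c where c: "c \<in> coords u" "x = L c" using surj by auto
    have "?f (F x) = lower_op i u \<kappa> c" using c F f_L[OF lower_op_coords] by simp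
    then show "?f (F x) = S.F (?f x)" using c f_L std(3) by (simp add: std_module_def)
  qed
  moreover have "bij_betw ?f (carrier M) (carrier (std_module u s))"
    unfolding bij_betw_def
  proof
    show "inj_on ?f (carrier M)" unfolding surj using f_L by (auto simp: inj_on_def)
    have "?f ` carrier M = (\<lambda>c. c) ` coords u"
      unfolding surj image_image by (intro image_cong) (simp_all only: f_L)
    then show "?f ` carrier M = carrier (std_module u s)"
      by (simp add: std_module_def)
  qed
  ultimately show ?thesis unfolding module_isomorphic_def by (intro bexI[of _ ?f])
qed

section \<open>The two extensions of the projective modules\<close>

text \<open>The extensions with \<open>\<kappa> = 0\<close> and \<open>\<kappa> = 1\<close> are told apart by \<open>F\<close> on the weight space of \<open>\<omega>\<^sup>i\<close>, which is
  the line spanned by \<open>e 0\<close>: an isomorphism has to preserve this line. If the residue of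
  \<open>- 2 i\<close> is \<open>d - 1\<close>, the extension is unique.\<close>

lemma (in faithful_string) extends_in_two_ways_iff:
  assumes surj: "carrier M = L ` coords u" and u: "u = d - 1"
  shows "extends_in_two_ways q d M \<longleftrightarrow> residue_rep d (- 2 * int i) \<noteq> d - 1"
proof
  assume two: "extends_in_two_ways q d M"
  show "residue_rep d (- 2 * int i) \<noteq> d - 1"
  proof
    assume "residue_rep d (- 2 * int i) = d - 1"
    then have uni: "extends_uniquely q d M" using extends_uniquely[OF surj] u by simp
    obtain s t where st: "is_extension q d M s" "is_extension q d M t"
      "\<not> module_isomorphic (uq q d) (M\<lparr>smult := s\<rparr>) (M\<lparr>smult := t\<rparr>)"
      using two by (auto simp: extends_in_two_ways_def)
    have "(\<lambda>x. x) \<in> module_hom (uq q d) (M\<lparr>smult := s\<rparr>) (M\<lparr>smult := t\<rparr>)"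
      using uni st by (auto simp: module_hom_def extends_uniquely_def)
    then have "module_isomorphic (uq q d) (M\<lparr>smult := s\<rparr>) (M\<lparr>smult := t\<rparr>)"
      unfolding module_isomorphic_def by (intro bexI[of _ "\<lambda>x. x"]) (auto simp: bij_betw_def)
    then show False using st by simp
  qed
next
  assume ne: "residue_rep d (- 2 * int i) \<noteq> d - 1"
  have ud: "Suc u = d" using u d_pos by simp
  obtain m where m: "0 < m" "m < d" "f_coef i m = 0"
    using f_coef_zero_below_top[OF ud] ne u by metis
  have "admissible i u 1" using m admissible_top[OF ud, of i] by (auto simp: admissible_def)
  then obtain t where t: "is_extension q d M t"
    "\<And>c. c \<in> coords u \<Longrightarrow> t (uq_F q d) (L c) = L (lower_op i u 1 c)"
    using extensionI[OF surj] by metis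
  obtain s where s: "is_extension q d M s"
    "\<And>c. c \<in> coords u \<Longrightarrow> s (uq_F q d) (L c) = L (lower_op i u 0 c)"
    using extensionI[OF surj admissible_top[OF ud]] by metis
  have agree: "r (uq_class q d a) x = act a x"
    if "is_extension q d M r" "a \<in> borel_alg q d" "x \<in> carrier M" for r a x
    using that by (auto simp: is_extension_def carrier_uq_plus)
  have "\<not> module_isomorphic (uq q d) (M\<lparr>smult := s\<rparr>) (M\<lparr>smult := t\<rparr>)"
  proof
    assume "module_isomorphic (uq q d) (M\<lparr>smult := s\<rparr>) (M\<lparr>smult := t\<rparr>)"
    then obtain f where f: "f \<in> module_hom (uq q d) (M\<lparr>smult := s\<rparr>) (M\<lparr>smult := t\<rparr>)"
      "bij_betw f (carrier M) (carrier M)"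
      by (auto simp: module_isomorphic_def)
    have f_act: "f x \<in> carrier M" "f (s (uq_class q d a) x) = t (uq_class q d a) (f x)"
      if "x \<in> carrier M" for a x
      using f(1) that by (auto simp: module_hom_def carrier_uq)
    have fz: "f \<zero> = \<zero>"
      using f_act(2)[of \<zero> "scalar 0"] f_act(1)[of \<zero>]
      by (simp add: agree[OF s(1)] agree[OF t(1)] act_scalar_0)
    have e0: "e 0 \<in> carrier M" by (simp add: e_closed)
    obtain c where c: "c \<in> coords u" "f (e 0) = L c" using f_act(1)[OF e0] surj by auto
    have "K (f (e 0)) = sc (\<omega> ^ i) (f (e 0))"
      using f_act(2)[OF e0, of "gen_var Gen_K"] f_act(2)[OF e0, of "scalar (\<omega> ^ i)"] f_act(1)[OF e0]
        K_e[of 0] e0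
      by (simp add: agree[OF s(1)] agree[OF t(1)])
    then have "L (\<lambda>j. \<omega> ^ (i + j) * c j) = L (\<lambda>j. \<omega> ^ i * c j)"
      using c by (simp add: lin_K lin_scale)
    then have "(\<lambda>j. \<omega> ^ (i + j) * c j) = (\<lambda>j. \<omega> ^ i * c j)"
      by (rule inj_onD[OF lin_inj]) (use c in \<open>auto simp: coords_def\<close>)
    then have w: "\<omega> ^ (i + j) * c j = \<omega> ^ i * c j" for j by meson
    \<comment> \<open>the weight \<open>\<omega>\<^sup>i\<close> occurs only at \<open>e 0\<close>\<close>
    have "c j = 0" if "j \<noteq> 0" for j
    proof (cases "j \<le> u")
      case True
      then have "\<omega> ^ j \<noteq> \<omega> ^ 0" using omega_pow_inj[of j 0] that u_less_d by auto
      then show ?thesis using w[of j] by (simp add: power_add)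
    qed (use c in \<open>auto simp: coords_def\<close>)
    then have c_eq: "c = (\<lambda>j. c 0 * unit_vec 0 j)" by (auto simp: unit_vec_def fun_eq_iff)
    have "s (uq_F q d) (e 0) = \<zero>"
    proof -
      have "L (lower_op i u 0 (unit_vec 0)) = L (\<lambda>_. 0)"
        by (intro lin_cong) (auto simp: lower_op_def unit_vec_def)
      then show ?thesis using s(2)[OF unit_vec_coords[of 0 u]] by (simp add: lin_unit lin_zero)
    qed
    then have "t (uq_F q d) (L c) = \<zero>"
      using f_act(2)[OF e0, of "gen_var Gen_F"] fz c by simp
    moreover have "L (lower_op i u 1 c) = L (\<lambda>j. c 0 * unit_vec u j)"
      using ud by (subst c_eq, intro lin_cong) (auto simp: lower_op_def unit_vec_def)
    ultimately have "sc (c 0) (e u) = \<zero>"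
      using t(2)[OF c(1)] by (simp add: lin_scale lin_unit)
    then have "c 0 = 0" using e_top e_closed[of u] by (simp add: sc_eq_zero_iff)
    then have "c = (\<lambda>_. 0)" using c_eq by simp
    then have "f (e 0) = f \<zero>" using c fz by (simp add: lin_zero)
    then have "e 0 = \<zero>" using f(2) e0 by (auto simp: bij_betw_def inj_on_def)
    then show False using e_top e_power[of u] by (simp add: funpow_zero)
  qed
  then show "extends_in_two_ways q d M" using s t by (auto simp: extends_in_two_ways_def)
qed

section \<open>Classification\<close>

theorem theorem4p1:
  fixes q :: complex and n d :: nat
  assumes "n \<ge> 3" and "n \<noteq> 4"
    and "primitive_root_of_unity n q"
    and "d = (if odd n then n else n div 2)"
  shows
    "\<comment> \<open>the listed modules exist\<close>
     (\<forall>i<d. \<exists>M :: (uq_elem, nat \<Rightarrow> complex) module. is_M q d i (residue_rep d (- 2 * int i)) M) \<and>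
     (\<forall>i<d. \<exists>M :: (uq_elem, nat \<Rightarrow> complex) module. is_P q d i M) \<and>
     \<comment> \<open>they are exactly the extendable indecomposable modules\<close>
     (\<forall>M :: (uq_elem, 'v) module.
        indecomposable_module (uq_plus q d) M \<and> extendable q d M \<longleftrightarrow>
        (\<exists>i<d. is_M q d i (residue_rep d (- 2 * int i)) M) \<or> (\<exists>i<d. is_P q d i M)) \<and>
     \<comment> \<open>1: unique extensions, and these are the simple modules\<close>
     (\<forall>i<d. \<forall>M :: (uq_elem, 'v) module. is_M q d i (residue_rep d (- 2 * int i)) M \<longrightarrow>
        extends_uniquely q d M \<and>
        (\<forall>s. is_extension q d M s \<longrightarrow> simple_module (uq q d) (M\<lparr>smult := s\<rparr>))) \<and>
     (\<forall>S :: (uq_elem, 'v) module. simple_module (uq q d) S \<longrightarrow>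
        (\<exists>i<d. \<exists>(M :: (uq_elem, nat \<Rightarrow> complex) module) s.
           is_M q d i (residue_rep d (- 2 * int i)) M \<and> is_extension q d M s \<and>
           module_isomorphic (uq q d) S (M\<lparr>smult := s\<rparr>))) \<and>
     \<comment> \<open>2: the projective indecomposable modules\<close>
     (\<forall>i<d. \<forall>M :: (uq_elem, 'v) module. is_P q d i M \<longrightarrow>
        projective_module TYPE('x) TYPE('y) (uq_plus q d) M \<and>
        (extends_in_two_ways q d M \<longleftrightarrow> \<not> (odd d \<and> i = (d + 1) div 2)))"
proof -
  interpret small_quantum n d q by unfold_locales (use assms in auto)
  have string_of: "\<exists>e. faithful_string n d q M e i u \<and> carrier M = lin q d M e u ` coords u"
    if "is_M q d i u M" for i u and M :: "(uq_elem, 'w) module"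
  proof -
    interpret borel_module n d q M using that by (intro borel_moduleI) (simp add: is_M_def)
    show ?thesis using that is_M_iff by blast
  qed
  have std: "\<exists>s. is_M q d i u (std_module u s) \<and> is_extension q d (std_module u s) s \<and>
      uq_string n d q (std_module u s) unit_vec i u \<and>
      (\<forall>c\<in>coords u. lin q d (std_module u s) unit_vec u c = c \<and> s (uq_F q d) c = lower_op i u 0 c)"
    if adm: "admissible i u 0" for i u
  proof -
    obtain s where s: "uq_string n d q (std_module u s) unit_vec i u"
      "\<And>c. c \<in> coords u \<Longrightarrow> lin q d (std_module u s) unit_vec u c = c"
      "\<And>c. c \<in> coords u \<Longrightarrow> s (uq_F q d) c = lower_op i u 0 c"
      using std_uq_string[OF adm] by blast
    interpret S: uq_string n d q "std_module u s" unit_vec i u by (rule s(1))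
    have "is_M q d i u (std_module u s)"
      using S.is_M_iff S.faithful_string_axioms S.surj by blast
    moreover have "is_extension q d (std_module u s) s"
      using S.uq_left_module by (simp add: is_extension_def std_module_def)
    ultimately show ?thesis using s by blast
  qed
  have top: "Suc (d - 1) = d" using d_pos by simp
  have ext: "extendable q d M" and ind: "indecomposable_module (uq_plus q d) M"
    if hyp: "is_M q d i u M" "admissible i u 0" for i u and M :: "(uq_elem, 'v) module"
  proof -
    obtain e where e: "faithful_string n d q M e i u" "carrier M = lin q d M e u ` coords u"
      using string_of[OF hyp(1)] by blast
    interpret faithful_string n d q M e i u by (rule e(1))
    obtain s where "is_extension q d M s" using extensionI[OF e(2) hyp(2)] by metis
    then show "extendable q d M" by (auto simp: extendable_def)
    show "indecomposable_module (uq_plus q d) M" by (rule indecomposable[OF e(2)])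
  qed
  show ?thesis
  proof (intro conjI allI impI)
    fix i
    show "\<exists>M :: (uq_elem, nat \<Rightarrow> complex) module. is_M q d i (residue_rep d (- 2 * int i)) M"
      using std[OF admissible_residue] by blast
    show "\<exists>M :: (uq_elem, nat \<Rightarrow> complex) module. is_P q d i M"
      using std[OF admissible_top[OF top]] by blast
  next
    fix M :: "(uq_elem, 'v) module"
    show "indecomposable_module (uq_plus q d) M \<and> extendable q d M \<longleftrightarrow>
        (\<exists>i<d. is_M q d i (residue_rep d (- 2 * int i)) M) \<or> (\<exists>i<d. is_P q d i M)"
    proof
      assume M: "indecomposable_module (uq_plus q d) M \<and> extendable q d M"
      interpret borel_module n d q M
        using M by (intro borel_moduleI) (simp add: indecomposable_module_def)
      obtain i u where iu: "i < d" "is_M q d i u M" using indecomposable_is_M M by metis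
      obtain e where e: "faithful_string n d q M e i u" "carrier M = lin q d M e u ` coords u"
        using string_of[OF iu(2)] by blast
      interpret faithful_string n d q M e i u by (rule e(1))
      obtain s where "is_extension q d M s" using M by (auto simp: extendable_def)
      then obtain \<kappa> where "admissible i u \<kappa>" using extension_structure[OF e(2)] by metis
      then have "Suc u = d \<or> u = residue_rep d (- 2 * int i)" by (rule admissible_top_or_residue)
      then have "u = d - 1 \<or> u = residue_rep d (- 2 * int i)" by auto
      then show "(\<exists>i<d. is_M q d i (residue_rep d (- 2 * int i)) M) \<or> (\<exists>i<d. is_P q d i M)"
        using iu by blast
    next
      assume "(\<exists>i<d. is_M q d i (residue_rep d (- 2 * int i)) M) \<or> (\<exists>i<d. is_P q d i M)"
      then show "indecomposable_module (uq_plus q d) M \<and> extendable q d M"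
        using ext ind admissible_residue admissible_top[OF top] by blast
    qed
  next
    fix i and M :: "(uq_elem, 'v) module"
    assume M: "is_M q d i (residue_rep d (- 2 * int i)) M"
    define u where "u = residue_rep d (- 2 * int i)"
    obtain e where e: "faithful_string n d q M e i u" "carrier M = lin q d M e u ` coords u"
      using string_of[OF M] by (auto simp: u_def)
    interpret faithful_string n d q M e i u by (rule e(1))
    show "extends_uniquely q d M" by (rule extends_uniquely[OF e(2) u_def])
    fix s assume s: "is_extension q d M s"
    show "simple_module (uq q d) (M\<lparr>smult := s\<rparr>)"
      by (rule uq_string.simple[OF extension_uq_string(1)[OF e(2) s] u_def])
  next
    fix S :: "(uq_elem, 'v) module"
    assume simple: "simple_module (uq q d) S"
    interpret S: uq_module n d q S
      using simple by (intro uq_moduleI) (simp add: simple_module_def)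
    obtain e i u where iu: "i < d" "u = residue_rep d (- 2 * int i)" "uq_string n d q S e i u"
      using S.simple_uq_string[OF simple] by metis
    interpret S: uq_string n d q S e i u by (rule iu(3))
    obtain \<kappa> where k: "\<And>c. c \<in> coords u \<Longrightarrow> S.F (S.L c) = S.L (lower_op i u \<kappa> c)" "admissible i u \<kappa>"
      using S.F_structure by blast
    have F: "S.F (S.L c) = S.L (lower_op i u 0 c)" if "c \<in> coords u" for c
      using k(1)[OF that] lower_op_residue[OF k(2) iu(2)] by simp
    have "admissible i u 0" using admissible_residue iu(2) by simp
    then obtain s where s: "is_M q d i u (std_module u s)" "is_extension q d (std_module u s) s"
      "uq_string n d q (std_module u s) unit_vec i u"
      "\<And>c. c \<in> coords u \<Longrightarrow> lin q d (std_module u s) unit_vec u c = c"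
      "\<And>c. c \<in> coords u \<Longrightarrow> s (uq_F q d) c = lower_op i u 0 c"
      using std by blast
    have "module_isomorphic (uq q d) S (std_module u s)"
      using S.isomorphic_std[OF F s(3-5)] by blast
    moreover have "(std_module u s)\<lparr>smult := s\<rparr> = std_module u s" by (simp add: std_module_def)
    ultimately show "\<exists>i<d. \<exists>(M :: (uq_elem, nat \<Rightarrow> complex) module) s.
           is_M q d i (residue_rep d (- 2 * int i)) M \<and> is_extension q d M s \<and>
           module_isomorphic (uq q d) S (M\<lparr>smult := s\<rparr>)"
      using s(1,2) iu by metis
  next
    fix i and M :: "(uq_elem, 'v) module"
    assume i: "i < d" and M: "is_P q d i M"
    obtain e where e: "faithful_string n d q M e i (d - 1)"
      "carrier M = lin q d M e (d - 1) ` coords (d - 1)"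
      using string_of[OF M] by blast
    interpret faithful_string n d q M e i "d - 1" by (rule e(1))
    show "projective_module TYPE('x) TYPE('y) (uq_plus q d) M" by (rule projective[OF e(2) refl])
    show "extends_in_two_ways q d M \<longleftrightarrow> \<not> (odd d \<and> i = (d + 1) div 2)"
      using extends_in_two_ways_iff[OF e(2) refl] residue_rep_top_iff[OF i] by simp
  qed
qed

end
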